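(* Let $(X,d)$ be a compact metric space, $T:X\to X$ a continuous map, and $m$ a Borel probability measure on $X$ such that $(T,m)$ satisfies the non-uniform specification property, with shadowing holding on the set $K$ of full $m$-measure. Let $\varphi\in C(X)$ satisfy $$\inf_{\mu\in M(K,T)}\int\varphi\, d\mu<\sup_{\mu\in M(K,T)}\int\varphi\, d\mu .$$ Let $$\widehat{X}(\varphi,T)=\Big\{x\in X:\lim_{n\to\infty}\frac1n\sum_{i=0}^{n-1}\varphi(T^ix)\text{ does not exist}\Big\}.$$ Then $\widehat{X}(\varphi,T)\neq\emptyset$, and for all $\psi\in C(X)$, $$P(\widehat{X}(\varphi,T),\psi)\ \geq\ \sup\Big\{h_\mu+\int\psi\, d\mu:\mu\in M(K,T)\Big\}.$$ Moreover, if there exists $\mu\in M(K,T)$ which is an equilibrium state for $T$ with respect to the potential $\psi$, then $P(\widehat{X}(\varphi,T),\psi)=P(X,\psi)$.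
   Context: Notation: $C(X)$ is the space of continuous real functions on $X$; $d_n(x,y)=\max_{0\le i\le n-1}d(T^ix,T^iy)$; $B_n(x,\epsilon)=\{y\in X:d_n(x,y)<\epsilon\}$; $S_n\psi(x)=\sum_{i=0}^{n-1}\psi(T^ix)$; $h_\mu$ is the measure-theoretic entropy of $T$ with respect to the $T$-invariant measure $\mu$. Non-uniform specification property (with time lag $p(x,n,\epsilon)$): there exists $\eta>0$ such that for $m$-almost every $x$, every $n\ge1$ and every $0<\epsilon<\eta$ there is an integer $p(x,n,\epsilon)\ge 1$ with $\lim_{\epsilon\to0}\limsup_{n\to\infty}\frac1n p(x,n,\epsilon)=0$, and so that the following holds: given points $x_1,\dots,x_k$ in a full $m$-measure set and positive integers $n_1,\dots,n_k$, if $p_i\ge p(x_i,n_i,\epsilon)$ for each $i$, then there exists $z\in X$ with $z\in B_{n_1}(x_1,\epsilon)$ and $T^{n_1+p_1+\cdots+n_{i-1}+p_{i-1}}(z)\in B_{n_i}(x_i,\epsilon)$ for every $2\le i\le k$. Throughout, $K$ denotes the full $m$-measure set on which this shadowing property holds with time lag $p(x,n,\epsilon)$. The conventions are that $K$ is $T$-invariant and that for $x\in K$ and $0<\epsilon_1<\epsilon_2$ one has $p(x,n,\epsilon_1)\ge p(x,n,\epsilon_2)$; hence $\limsup_{n\to\infty}p(x,n,\epsilon)/n=0$ for all $x\in K$ and all $\epsilon$. $M(K,T)$ is the set of $T$-invariant Borel probability measures $\mu$ on $X$ with $\mu(K)=1$. Topological pressure of a (not necessarily compact or invariant) Borel set $Z\subset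 X$ with respect to $\psi\in C(X)$: let $\Gamma_n(Z,\epsilon)$ be the collection of all finite or countable covers of $Z$ by sets $B_m(x,\epsilon)$ with $m\ge n$. Put $$M(Z,t,\psi,n,\epsilon)=\inf_{\mathcal C\in\Gamma_n(Z,\epsilon)}\sum_{B_m(x,\epsilon)\in\mathcal C}\exp\Big(-tm+\sup_{y\in B_m(x,\epsilon)}S_m\psi(y)\Big),\quad M(Z,t,\psi,\epsilon)=\lim_{n\to\infty}M(Z,t,\psi,n,\epsilon),$$ $P(Z,\psi,\epsilon)=\inf\{t:M(Z,t,\psi,\epsilon)=0\}=\sup\{t:M(Z,t,\psi,\epsilon)=\infty\}$ and $P(Z,\psi)=\lim_{\epsilon\to0}P(Z,\psi,\epsilon)$. An equilibrium state for $T$ with respect to $\psi$ is a $T$-invariant Borel probability measure $\mu$ with $h_\mu+\int\psi\,d\mu=P(X,\psi)$. *)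

theory Defs
  imports "HOL-Analysis.Analysis" "HOL-Probability.Probability_Measure"
begin

text \<open>The phase space is a whole type \<open>'a\<close>; its compactness is a hypothesis of the theorem.\<close>

definition birkhoff_sum :: "('a \<Rightarrow> 'a) \<Rightarrow> ('a \<Rightarrow> real) \<Rightarrow> nat \<Rightarrow> 'a \<Rightarrow> real" where
  "birkhoff_sum T \<psi> n x = (\<Sum>i<n. \<psi> ((T ^^ i) x))"

text \<open>Only used for \<open>n \<ge> 1\<close>: for \<open>n = 0\<close> this is the unspecified maximum of the empty set.\<close>

definition bowen_dist :: "('a::metric_space \<Rightarrow> 'a) \<Rightarrow> nat \<Rightarrow> 'a \<Rightarrow> 'a \<Rightarrow> real" where
  "bowen_dist T n x y = Max ((\<lambda>i. dist ((T ^^ i) x) ((T ^^ i) y)) ` {..<n})"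

definition bowen_ball :: "('a::metric_space \<Rightarrow> 'a) \<Rightarrow> nat \<Rightarrow> 'a \<Rightarrow> real \<Rightarrow> 'a set" where
  "bowen_ball T n x \<epsilon> = {y. bowen_dist T n x y < \<epsilon>}"

definition irregular_set :: "('a \<Rightarrow> real) \<Rightarrow> ('a \<Rightarrow> 'a) \<Rightarrow> 'a set" where
  "irregular_set \<phi> T = {x. \<not> convergent (\<lambda>n. birkhoff_sum T \<phi> n x / real n)}"

text \<open>
  The function \<open>p\<close> is the time lag and \<open>K\<close> the full-measure set of points that can be shadowed.
  Invariance of \<open>K\<close> is taken in the weakest usual sense, forward invariance. In the shadowing
  clause the starting time of the \<open>i\<close>-th orbit segment is \<open>0\<close> for \<open>i = 1\<close> (empty sum).
\<close>

definition nonuniform_specification ::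
    "'a::metric_space measure \<Rightarrow> ('a \<Rightarrow> 'a) \<Rightarrow> 'a set \<Rightarrow> bool" where
  "nonuniform_specification m T K \<longleftrightarrow>
     K \<in> sets borel \<and> emeasure m K = 1 \<and> T ` K \<subseteq> K \<and>
     (\<exists>\<eta>>0. \<exists>p :: 'a \<Rightarrow> nat \<Rightarrow> real \<Rightarrow> nat.
        (\<forall>x\<in>K. \<forall>n\<ge>1. \<forall>\<epsilon>. 0 < \<epsilon> \<and> \<epsilon> < \<eta> \<longrightarrow> p x n \<epsilon> \<ge> 1) \<and>
        (\<forall>x\<in>K. \<forall>n\<ge>1. \<forall>\<epsilon>1 \<epsilon>2. 0 < \<epsilon>1 \<and> \<epsilon>1 < \<epsilon>2 \<and> \<epsilon>2 < \<eta> \<longrightarrow> p x n \<epsilon>1 \<ge> p x n \<epsilon>2) \<and>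
        (\<forall>x\<in>K. ((\<lambda>\<epsilon>. limsup (\<lambda>n. ereal (real (p x n \<epsilon>) / real n))) \<longlongrightarrow> 0) (at_right 0)) \<and>
        (\<forall>\<epsilon>. 0 < \<epsilon> \<and> \<epsilon> < \<eta> \<longrightarrow>
          (\<forall>k\<ge>1. \<forall>(x :: nat \<Rightarrow> 'a) (n :: nat \<Rightarrow> nat) (q :: nat \<Rightarrow> nat).
             (\<forall>i\<in>{1..k}. x i \<in> K \<and> n i \<ge> 1 \<and> q i \<ge> p (x i) (n i) \<epsilon>) \<longrightarrow>
             (\<exists>z. \<forall>i\<in>{1..k}.
                (T ^^ (\<Sum>j\<in>{1..<i}. n j + q j)) z \<in> bowen_ball T (n i) (x i) \<epsilon>))))"

definition invariant_measures :: "('a::topological_space \<Rightarrow> 'a) \<Rightarrow> 'a measure set" where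
  "invariant_measures T = {\<mu>. prob_space \<mu> \<and> sets \<mu> = sets borel \<and> distr \<mu> borel T = \<mu>}"

definition invariant_measures_on ::
    "'a::topological_space set \<Rightarrow> ('a \<Rightarrow> 'a) \<Rightarrow> 'a measure set" where
  "invariant_measures_on K T = {\<mu> \<in> invariant_measures T. emeasure \<mu> K = 1}"


text \<open>
  Kolmogorov--Sinai entropy, with natural logarithm. The term of a null cell vanishes, as it should.
\<close>

definition partition_entropy :: "'a measure \<Rightarrow> 'a set set \<Rightarrow> real" where
  "partition_entropy \<mu> P = - (\<Sum>A\<in>P. measure \<mu> A * ln (measure \<mu> A))"

definition iterated_join :: "('a \<Rightarrow> 'a) \<Rightarrow> nat \<Rightarrow> 'a set set \<Rightarrow> 'a set set" where
  "iterated_join T n P = {\<Inter>i\<in>{..<n}. (T ^^ i) -` (f i) | f. f \<in> {..<n} \<rightarrow> P} - {{}}"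

definition ks_entropy_partition :: "('a \<Rightarrow> 'a) \<Rightarrow> 'a measure \<Rightarrow> 'a set set \<Rightarrow> real" where
  "ks_entropy_partition T \<mu> P = lim (\<lambda>n. partition_entropy \<mu> (iterated_join T n P) / real n)"

definition ks_entropy :: "('a \<Rightarrow> 'a) \<Rightarrow> 'a measure \<Rightarrow> ereal" where
  "ks_entropy T \<mu> = (SUP P \<in> {P. finite P \<and> partition_on (space \<mu>) P \<and> P \<subseteq> sets \<mu>}.
     ereal (ks_entropy_partition T \<mu> P))"


text \<open>
  A cover by Bowen balls is given by the set of pairs (centre, length), because a Bowen ball as a
  set does not determine its length.
\<close>

definition bowen_covers ::
    "('a::metric_space \<Rightarrow> 'a) \<Rightarrow> 'a set \<Rightarrow> nat \<Rightarrow> real \<Rightarrow> ('a \<times> nat) set set" where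
  "bowen_covers T Z n \<epsilon> =
     {C. countable C \<and> (\<forall>(x, m)\<in>C. m \<ge> n) \<and> Z \<subseteq> (\<Union>(x, m)\<in>C. bowen_ball T m x \<epsilon>)}"

definition pressure_sum ::
    "('a::metric_space \<Rightarrow> 'a) \<Rightarrow> 'a set \<Rightarrow> real \<Rightarrow> ('a \<Rightarrow> real) \<Rightarrow> nat \<Rightarrow> real \<Rightarrow> ennreal" where
  "pressure_sum T Z t \<psi> n \<epsilon> =
     (INF C \<in> bowen_covers T Z n \<epsilon>. \<Sum>\<^sub>\<infinity>(x, m)\<in>C.
        ennreal (exp (- t * real m + (SUP y \<in> bowen_ball T m x \<epsilon>. birkhoff_sum T \<psi> m y))))"

definition pressure_lim ::
    "('a::metric_space \<Rightarrow> 'a) \<Rightarrow> 'a set \<Rightarrow> real \<Rightarrow> ('a \<Rightarrow> real) \<Rightarrow> real \<Rightarrow> ennreal" where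
  "pressure_lim T Z t \<psi> \<epsilon> = lim (\<lambda>n. pressure_sum T Z t \<psi> n \<epsilon>)"

definition pressure_at ::
    "('a::metric_space \<Rightarrow> 'a) \<Rightarrow> 'a set \<Rightarrow> ('a \<Rightarrow> real) \<Rightarrow> real \<Rightarrow> ereal" where
  "pressure_at T Z \<psi> \<epsilon> = Inf {ereal t | t. pressure_lim T Z t \<psi> \<epsilon> = 0}"

definition pressure ::
    "('a::metric_space \<Rightarrow> 'a) \<Rightarrow> 'a set \<Rightarrow> ('a \<Rightarrow> real) \<Rightarrow> ereal" where
  "pressure T Z \<psi> = Lim (at_right 0) (pressure_at T Z \<psi>)"

definition equilibrium_state ::
    "('a::metric_space \<Rightarrow> 'a) \<Rightarrow> ('a \<Rightarrow> real) \<Rightarrow> 'a measure \<Rightarrow> bool" where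
  "equilibrium_state T \<psi> \<mu> \<longleftrightarrow>
     \<mu> \<in> invariant_measures T \<and>
     ks_entropy T \<mu> + ereal (integral\<^sup>L \<mu> \<psi>) = pressure T UNIV \<psi>"

end

theory Submission
  imports Defs "HOL-Probability.Infinite_Product_Measure"
begin

text \<open>
  Fix an invariant measure \<open>\<mu>\<close> on \<open>K\<close> and a finite partition \<open>P\<close>. It suffices to find, for every
  \<open>e > 0\<close>, a set of irregular points whose pressure is at least \<open>h(P) + \<integral>\<psi> d\<mu> - e\<close>. Such points are
  produced by gluing orbit segments of one fixed length \<open>n\<close>, and \<open>n\<close>, the gap \<open>q\<close> and the tolerance
  stay the same along the whole orbit: convergence of averages has to fail, and for that small but
  fixed relative errors are harmless.

  \<^bold>\<open>Segments that carry the entropy.\<close> By subadditivity (\<open>entropy_rate_LIMSEQ\<close>) the entropy of the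
  itineraries of length \<open>n\<close> is about \<open>n h(P)\<close>. Lemma \<open>entropy_blocks_at\<close> groups the points by
  itinerary and by the rounded values of the two Birkhoff sums. If every pair of values were
  attained, on the points with small time lag, by fewer than \<open>exp (n (h(P) + \<integral>\<psi> d\<mu>) - S\<^sub>n \<psi>)\<close>
  itineraries, up to a small exponential factor, then weights inverse to these numbers would
  contradict Gibbs' inequality for entropy plus integral (\<open>entropy_plus_integral_le\<close>). So one pair
  of values is attained by many itineraries, and a set \<open>E\<close> of representatives has nearly constant
  sums \<open>S\<^sub>n \<phi>\<close> and \<open>S\<^sub>n \<psi>\<close>. This pigeonhole argument takes the place of the ergodic theorem and of the
  decomposition of \<open>\<mu>\<close> into ergodic measures. A Bowen ball holds only few elements of \<open>E\<close>: away from
  a rarely visited set, nearby points lie in the same cell (\<open>separated_core\<close>, \<open>rare_visits\<close>), so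
  the itineraries in a Bowen ball differ at few times, and there are few words within a small
  Hamming distance of a given one (\<open>card_words_near_le\<close>).

  \<^bold>\<open>Irregular points.\<close> One of two measures with different integrals of \<open>\<phi>\<close> supplies a point \<open>y\<close>,
  again with small time lag, whose average over time \<open>n\<close> differs from the average \<open>a\<close> common to \<open>E\<close>
  (\<open>point_with_large_sum\<close>). Let \<open>F\<close> be a set of positions of density at most \<open>1/D\<close> whose frequency
  in \<open>{..<N}\<close> oscillates as \<open>N\<close> grows (\<open>oscillating_sparse_set\<close>). Every sequence of segments that
  uses \<open>y\<close> at the positions in \<open>F\<close> and arbitrary elements of \<open>E\<close> elsewhere is shadowed by some
  point (\<open>shadow_sequence\<close>), and the averages of \<open>\<phi>\<close> along its orbit oscillate with the frequency of
  \<open>F\<close> (\<open>irregular_if_shadowing\<close>).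

  \<^bold>\<open>Pressure.\<close> Put the product of uniform measures on the space of these sequences. The sequences
  whose shadowing point lies in a given Bowen ball form a subset of a cylinder of explicitly bounded
  measure, and the cylinders of a cover have total measure at least one. Since almost all time is
  spent in segments from \<open>E\<close>, comparing these measures with the terms of the pressure sum bounds that
  sum from below (\<open>pressure_at_ge_shadowing\<close>).
\<close>

section \<open>Bowen balls and Birkhoff sums\<close>

lemma in_bowen_ball_iff:
  assumes "n \<ge> 1"
  shows "y \<in> bowen_ball T n x \<epsilon> \<longleftrightarrow> (\<forall>i<n. dist ((T ^^ i) x) ((T ^^ i) y) < \<epsilon>)"
proof -
  have "(\<lambda>i. dist ((T ^^ i) x) ((T ^^ i) y)) ` {..<n} \<noteq> {}"
    using assms by (auto simp: lessThan_empty_iff)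
  then show ?thesis
    by (auto simp: bowen_ball_def bowen_dist_def)
qed

lemma continuous_on_funpow:
  fixes T :: "'a::topological_space \<Rightarrow> 'a"
  assumes "continuous_on UNIV T"
  shows "continuous_on UNIV (T ^^ i)"
proof (induction i)
  case 0
  then show ?case by (simp add: id_def)
next
  case (Suc i)
  have "T ^^ Suc i = (\<lambda>x. T ((T ^^ i) x))" by auto
  then show ?case using continuous_on_compose2[OF assms Suc.IH] by simp
qed

lemma birkhoff_sum_add:
  "birkhoff_sum T \<psi> (m + n) x = birkhoff_sum T \<psi> m x + birkhoff_sum T \<psi> n ((T ^^ m) x)"
proof -
  have "birkhoff_sum T \<psi> (m + n) x
      = (\<Sum>i<m. \<psi> ((T ^^ i) x)) + (\<Sum>i=m..<m+n. \<psi> ((T ^^ i) x))"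
    unfolding birkhoff_sum_def
    by (metis atLeast0LessThan le_add1 sum.atLeastLessThan_concat zero_le)
  also have "(\<Sum>i=m..<m+n. \<psi> ((T ^^ i) x)) = (\<Sum>i<n. \<psi> ((T ^^ i) ((T ^^ m) x)))"
    using sum.shift_bounds_nat_ivl[of "\<lambda>i. \<psi> ((T ^^ i) x)" 0 m n]
    by (simp add: atLeast0LessThan add.commute funpow_add)
  finally show ?thesis by (simp add: birkhoff_sum_def)
qed

lemma birkhoff_sum_abs_le:
  assumes "\<And>x. \<bar>\<psi> x\<bar> \<le> B"
  shows "\<bar>birkhoff_sum T \<psi> n x\<bar> \<le> real n * B"
proof -
  have "\<bar>birkhoff_sum T \<psi> n x\<bar> \<le> (\<Sum>i<n. B)"
    unfolding birkhoff_sum_def by (rule order_trans[OF sum_abs sum_mono]) (rule assms)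
  then show ?thesis by simp
qed

lemma birkhoff_sum_diff_le:
  assumes "\<And>i. i < n \<Longrightarrow> \<bar>\<psi> ((T ^^ i) x) - \<psi> ((T ^^ i) y)\<bar> \<le> g"
  shows "\<bar>birkhoff_sum T \<psi> n x - birkhoff_sum T \<psi> n y\<bar> \<le> real n * g"
proof -
  have "\<bar>birkhoff_sum T \<psi> n x - birkhoff_sum T \<psi> n y\<bar>
      = \<bar>\<Sum>i<n. \<psi> ((T ^^ i) x) - \<psi> ((T ^^ i) y)\<bar>"
    by (simp add: birkhoff_sum_def sum_subtractf)
  also have "\<dots> \<le> (\<Sum>i<n. g)"
    by (rule order_trans[OF sum_abs sum_mono]) (use assms in auto)
  finally show ?thesis by simp
qed

lemma bounded_continuous_real:
  fixes \<psi> :: "'a::metric_space \<Rightarrow> real"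
  assumes "compact (UNIV :: 'a set)" and "continuous_on UNIV \<psi>"
  obtains B where "B \<ge> 1" "\<And>x. \<bar>\<psi> x\<bar> \<le> B"
proof -
  have "bounded (range \<psi>)"
    using assms compact_continuous_image compact_imp_bounded by blast
  then obtain B where "\<forall>x\<in>range \<psi>. norm x \<le> B" unfolding bounded_iff by blast
  then have "\<And>x. \<bar>\<psi> x\<bar> \<le> max 1 B" by (simp add: le_max_iff_disj)
  then show ?thesis using that[of "max 1 B"] by simp
qed

lemma uniform_modulus:
  fixes \<psi> :: "'a::metric_space \<Rightarrow> real"
  assumes "compact (UNIV :: 'a set)" and "continuous_on UNIV \<psi>" and "g > 0"
  obtains d where "d > 0" "\<And>x y. dist x y < d \<Longrightarrow> \<bar>\<psi> x - \<psi> y\<bar> \<le> g"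
proof -
  have "uniformly_continuous_on UNIV \<psi>"
    using assms compact_uniformly_continuous by blast
  then obtain d where "d > 0" "\<And>x y. dist y x < d \<Longrightarrow> dist (\<psi> y) (\<psi> x) < g"
    using \<open>g > 0\<close> unfolding uniformly_continuous_on_def by blast
  then show ?thesis using that[of d] by (force simp: dist_real_def)
qed

section \<open>Pressure of arbitrary sets\<close>

lemma pressure_sum_incseq: "incseq (\<lambda>n. pressure_sum T Z t \<psi> n \<epsilon>)"
proof (rule incseq_SucI)
  fix n
  show "pressure_sum T Z t \<psi> n \<epsilon> \<le> pressure_sum T Z t \<psi> (Suc n) \<epsilon>"
    unfolding pressure_sum_def
    by (rule INF_superset_mono) (auto simp: bowen_covers_def)
qed

text \<open>Admitting only longer balls leaves fewer covers, so the sums increase with the minimal length and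
  their limit is a supremum.\<close>

lemma pressure_lim_eq_0_iff:
  "pressure_lim T Z t \<psi> \<epsilon> = 0 \<longleftrightarrow> (\<forall>n. pressure_sum T Z t \<psi> n \<epsilon> = 0)"
proof -
  have "pressure_lim T Z t \<psi> \<epsilon> = (SUP n. pressure_sum T Z t \<psi> n \<epsilon>)"
    unfolding pressure_lim_def
    by (rule limI[OF LIMSEQ_SUP[OF pressure_sum_incseq]])
  then show ?thesis by (metis SUP_bot_conv(1) UNIV_I bot_ennreal)
qed

text \<open>The comparison behind every inequality between pressures: covers are carried over unchanged, as sets
  of centres and lengths, and the sums are compared term by term.\<close>

lemma pressure_sum_le:
  assumes "\<And>C. C \<in> bowen_covers T Z n \<epsilon> \<Longrightarrow> C \<in> bowen_covers T Z' n \<epsilon>'"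
    and "\<And>x m. m \<ge> n \<Longrightarrow> (SUP y \<in> bowen_ball T m x \<epsilon>'. birkhoff_sum T \<psi> m y)
        \<le> (SUP y \<in> bowen_ball T m x \<epsilon>. birkhoff_sum T \<psi> m y) + (t' - t) * real m"
  shows "pressure_sum T Z' t' \<psi> n \<epsilon>' \<le> pressure_sum T Z t \<psi> n \<epsilon>"
  unfolding pressure_sum_def
proof (rule INF_mono)
  fix C assume C: "C \<in> bowen_covers T Z n \<epsilon>"
  have "(\<Sum>\<^sub>\<infinity>(x, m)\<in>C. ennreal (exp (- t' * real m + (SUP y \<in> bowen_ball T m x \<epsilon>'. birkhoff_sum T \<psi> m y))))
     \<le> (\<Sum>\<^sub>\<infinity>(x, m)\<in>C. ennreal (exp (- t * real m + (SUP y \<in> bowen_ball T m x \<epsilon>. birkhoff_sum T \<psi> m y))))"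
  proof (rule infsum_mono[OF nonneg_summable_on_complete nonneg_summable_on_complete])
    fix c assume "c \<in> C"
    obtain x m where c: "c = (x, m)" by (cases c)
    with C \<open>c \<in> C\<close> have "m \<ge> n" by (auto simp: bowen_covers_def)
    from assms(2)[OF this, of x]
    show "(case c of (x, m) \<Rightarrow> ennreal (exp (- t' * real m + (SUP y \<in> bowen_ball T m x \<epsilon>'. birkhoff_sum T \<psi> m y))))
      \<le> (case c of (x, m) \<Rightarrow> ennreal (exp (- t * real m + (SUP y \<in> bowen_ball T m x \<epsilon>. birkhoff_sum T \<psi> m y))))"
      by (auto simp: c algebra_simps intro!: ennreal_leI)
  qed auto
  then show "\<exists>C'\<in>bowen_covers T Z' n \<epsilon>'.
      (\<Sum>\<^sub>\<infinity>(x, m)\<in>C'. ennreal (exp (- t' * real m + (SUP y \<in> bowen_ball T m x \<epsilon>'. birkhoff_sum T \<psi> m y))))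
     \<le> (\<Sum>\<^sub>\<infinity>(x, m)\<in>C. ennreal (exp (- t * real m + (SUP y \<in> bowen_ball T m x \<epsilon>. birkhoff_sum T \<psi> m y))))"
    using assms(1)[OF C] by blast
qed

lemma pressure_at_mono_set:
  assumes "Z \<subseteq> Z'"
  shows "pressure_at T Z \<psi> \<epsilon> \<le> pressure_at T Z' \<psi> \<epsilon>"
proof -
  have "pressure_sum T Z t \<psi> n \<epsilon> \<le> pressure_sum T Z' t \<psi> n \<epsilon>" for t n
    by (rule pressure_sum_le) (use assms in \<open>auto simp: bowen_covers_def\<close>)
  then have "pressure_lim T Z t \<psi> \<epsilon> = 0" if "pressure_lim T Z' t \<psi> \<epsilon> = 0" for t
    using that unfolding pressure_lim_eq_0_iff by (metis le_zero_eq)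
  then show ?thesis unfolding pressure_at_def by (intro Inf_superset_mono) auto
qed

text \<open>Enlarging the balls of a cover about the same centres gives a cover again, and only the suprema of
  the Birkhoff sums change, by at most the oscillation \<open>g\<close> of the potential per unit of time. As \<open>g\<close>
  tends to \<open>0\<close> with \<open>\<epsilon>\<close>, the pressure at radius \<open>\<epsilon>\<close> is monotone in \<open>\<epsilon>\<close> up to a vanishing error.\<close>

lemma pressure_at_radius_le:
  fixes T :: "'a::metric_space \<Rightarrow> 'a"
  assumes B: "\<And>x. \<bar>\<psi> x\<bar> \<le> B"
    and mod: "\<And>x y. dist x y < \<epsilon> \<Longrightarrow> \<bar>\<psi> x - \<psi> y\<bar> \<le> g"
    and \<epsilon>: "0 < \<epsilon>'" "\<epsilon>' \<le> \<epsilon>"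
  shows "pressure_at T Z \<psi> \<epsilon> \<le> pressure_at T Z \<psi> \<epsilon>' + ereal g"
proof -
  have covers: "C \<in> bowen_covers T Z n \<epsilon>" if "C \<in> bowen_covers T Z n \<epsilon>'" for C n
  proof -
    have "bowen_ball T m x \<epsilon>' \<subseteq> bowen_ball T m x \<epsilon>" for m x
      using \<epsilon> by (auto simp: bowen_ball_def)
    then have "(\<Union>(x, m)\<in>C. bowen_ball T m x \<epsilon>') \<subseteq> (\<Union>(x, m)\<in>C. bowen_ball T m x \<epsilon>)"
      by (intro UN_mono) auto
    then show ?thesis using that unfolding bowen_covers_def by blast
  qed
  have sup: "(SUP y \<in> bowen_ball T m x \<epsilon>. birkhoff_sum T \<psi> m y)
        \<le> (SUP y \<in> bowen_ball T m x \<epsilon>'. birkhoff_sum T \<psi> m y) + g * real m" if "m \<ge> 1" for m x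
  proof -
    have bdd: "bdd_above (birkhoff_sum T \<psi> m ` bowen_ball T m x \<epsilon>')"
      by (rule bdd_aboveI2[of _ _ "real m * B"])
        (use birkhoff_sum_abs_le[of \<psi>, OF B] in \<open>simp add: abs_le_iff\<close>)
    have xin: "x \<in> bowen_ball T m x r" if "r > 0" for r
      using that \<open>m \<ge> 1\<close> by (simp add: in_bowen_ball_iff)
    have "birkhoff_sum T \<psi> m y
        \<le> (SUP y \<in> bowen_ball T m x \<epsilon>'. birkhoff_sum T \<psi> m y) + g * real m"
      if "y \<in> bowen_ball T m x \<epsilon>" for y
    proof -
      have "\<bar>birkhoff_sum T \<psi> m x - birkhoff_sum T \<psi> m y\<bar> \<le> real m * g"
        using that \<open>m \<ge> 1\<close> by (intro birkhoff_sum_diff_le mod) (auto simp: in_bowen_ball_iff)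
      moreover have "birkhoff_sum T \<psi> m x \<le> (SUP y \<in> bowen_ball T m x \<epsilon>'. birkhoff_sum T \<psi> m y)"
        by (rule cSUP_upper[OF xin bdd]) (use \<epsilon> in auto)
      ultimately show ?thesis by (simp add: mult.commute)
    qed
    moreover have "bowen_ball T m x \<epsilon> \<noteq> {}" using xin[of \<epsilon>] \<epsilon> by auto
    ultimately show ?thesis by (intro cSUP_least) auto
  qed
  have "pressure_lim T Z (t + g) \<psi> \<epsilon> = 0" if "pressure_lim T Z t \<psi> \<epsilon>' = 0" for t
    unfolding pressure_lim_eq_0_iff
  proof
    fix n
    have "pressure_sum T Z (t + g) \<psi> n \<epsilon> \<le> pressure_sum T Z (t + g) \<psi> (Suc n) \<epsilon>"
      using pressure_sum_incseq by (rule incseq_SucD)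
    also have "\<dots> \<le> pressure_sum T Z t \<psi> (Suc n) \<epsilon>'"
      by (rule pressure_sum_le) (use covers sup in auto)
    also have "\<dots> = 0" using that by (simp add: pressure_lim_eq_0_iff)
    finally show "pressure_sum T Z (t + g) \<psi> n \<epsilon> = 0" by simp
  qed
  then have "pressure_at T Z \<psi> \<epsilon> \<le> ereal t + ereal g" if "pressure_lim T Z t \<psi> \<epsilon>' = 0" for t
    using that unfolding pressure_at_def by (auto intro!: Inf_lower)
  then have "pressure_at T Z \<psi> \<epsilon> - ereal g \<le> ereal t" if "pressure_lim T Z t \<psi> \<epsilon>' = 0" for t
    using that by (simp add: ereal_minus_le)
  then have "pressure_at T Z \<psi> \<epsilon> - ereal g \<le> pressure_at T Z \<psi> \<epsilon>'"
    unfolding pressure_at_def[of T Z \<psi> \<epsilon>'] by (auto intro!: Inf_greatest)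
  then show ?thesis by (simp add: ereal_minus_le)
qed

text \<open>The pressure is defined by an unspecified limit operator; near-monotonicity in the radius shows that
  lower and upper limit agree, so that the operator returns a true limit.\<close>

lemma pressure_at_tendsto:
  fixes T :: "'a::metric_space \<Rightarrow> 'a"
  assumes "compact (UNIV :: 'a set)" and "continuous_on UNIV \<psi>"
  shows "(pressure_at T Z \<psi> \<longlongrightarrow> pressure T Z \<psi>) (at_right 0)"
proof -
  let ?f = "pressure_at T Z \<psi>"
  let ?F = "at_right (0::real)"
  obtain B where B: "\<And>x. \<bar>\<psi> x\<bar> \<le> B" using bounded_continuous_real[OF assms] by metis
  have "Limsup ?F ?f \<le> Liminf ?F ?f + ereal g" if "g > 0" for g
  proof -
    obtain d where d: "d > 0" "\<And>x y. dist x y < d \<Longrightarrow> \<bar>\<psi> x - \<psi> y\<bar> \<le> g"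
      using uniform_modulus[OF assms \<open>g > 0\<close>] by metis
    have "?f \<epsilon> - ereal g \<le> Liminf ?F ?f" if "0 < \<epsilon>" "\<epsilon> < d" for \<epsilon>
    proof (rule Liminf_bounded)
      have "eventually (\<lambda>\<epsilon>'. \<epsilon>' < \<epsilon>) ?F" "eventually (\<lambda>\<epsilon>'::real. 0 < \<epsilon>') ?F"
        using \<open>0 < \<epsilon>\<close> by (auto intro: eventually_at_right_less eventually_at_rightI)
      then show "eventually (\<lambda>\<epsilon>'. ?f \<epsilon> - ereal g \<le> ?f \<epsilon>') ?F"
      proof eventually_elim
        case (elim \<epsilon>')
        then show ?case
          using pressure_at_radius_le[where T = T and Z = Z and \<epsilon> = \<epsilon> and \<epsilon>' = \<epsilon>', where g = g and \<psi> = \<psi>, OF B] d that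
          by (simp add: ereal_minus_le)
      qed
    qed
    then have *: "?f \<epsilon> \<le> Liminf ?F ?f + ereal g" if "0 < \<epsilon>" "\<epsilon> < d" for \<epsilon>
      using that by (simp add: ereal_minus_le)
    show ?thesis
    proof (rule Limsup_bounded)
      have "eventually (\<lambda>\<epsilon>'. \<epsilon>' < d) ?F" "eventually (\<lambda>\<epsilon>'::real. 0 < \<epsilon>') ?F"
        using \<open>0 < d\<close> by (auto intro: eventually_at_right_less eventually_at_rightI)
      then show "eventually (\<lambda>\<epsilon>. ?f \<epsilon> \<le> Liminf ?F ?f + ereal g) ?F"
        by eventually_elim (use * in auto)
    qed
  qed
  then have "Limsup ?F ?f \<le> Liminf ?F ?f" by (rule ereal_le_epsilon2[rule_format])
  then have "Liminf ?F ?f = Limsup ?F ?f"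
    by (intro antisym Liminf_le_Limsup) auto
  then have "(?f \<longlongrightarrow> Limsup ?F ?f) ?F" by (intro Liminf_eq_Limsup) auto
  then show ?thesis unfolding pressure_def by (simp add: tendsto_Lim)
qed

lemma pressure_mono_set:
  fixes T :: "'a::metric_space \<Rightarrow> 'a"
  assumes "compact (UNIV :: 'a set)" and "continuous_on UNIV \<psi>" and "Z \<subseteq> Z'"
  shows "pressure T Z \<psi> \<le> pressure T Z' \<psi>"
  by (rule tendsto_le[OF trivial_limit_at_right_real
        pressure_at_tendsto[OF assms(1,2)] pressure_at_tendsto[OF assms(1,2)]])
    (intro always_eventually allI pressure_at_mono_set[OF assms(3)])

lemma pressure_ge:
  fixes T :: "'a::metric_space \<Rightarrow> 'a"
  assumes "compact (UNIV :: 'a set)" and "continuous_on UNIV \<psi>" and "\<epsilon> > 0"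
    and "\<And>\<epsilon>'. 0 < \<epsilon>' \<Longrightarrow> \<epsilon>' < \<epsilon> \<Longrightarrow> c \<le> pressure_at T Z \<psi> \<epsilon>'"
  shows "c \<le> pressure T Z \<psi>"
proof (rule tendsto_lowerbound[OF pressure_at_tendsto[OF assms(1,2)]])
  show "eventually (\<lambda>\<epsilon>'. c \<le> pressure_at T Z \<psi> \<epsilon>') (at_right 0)"
    using assms(3,4) by (intro eventually_at_rightI[of 0 \<epsilon>]) auto
qed auto

lemma pressure_empty:
  fixes T :: "'a::metric_space \<Rightarrow> 'a"
  assumes "compact (UNIV :: 'a set)" and "continuous_on UNIV \<psi>"
  shows "pressure T {} \<psi> = -\<infinity>"
proof -
  have "pressure_sum T {} t \<psi> n \<epsilon> \<le> 0" for t n \<epsilon>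
    unfolding pressure_sum_def by (rule INF_lower2[of "{}"]) (auto simp: bowen_covers_def)
  then have "pressure_lim T {} t \<psi> \<epsilon> = 0" for t \<epsilon>
    unfolding pressure_lim_eq_0_iff by (metis le_zero_eq)
  then have "pressure_at T {} \<psi> \<epsilon> \<le> ereal t" for t \<epsilon>
    unfolding pressure_at_def by (auto intro!: Inf_lower)
  then have "pressure_at T {} \<psi> \<epsilon> = -\<infinity>" for \<epsilon>
    by (metis ereal_bot)
  then have "pressure_at T {} \<psi> = (\<lambda>_. -\<infinity>)" by blast
  then have "((\<lambda>_::real. -\<infinity>) \<longlongrightarrow> pressure T {} \<psi>) (at_right 0)"
    using pressure_at_tendsto[OF assms, of T "{}"] by simp
  then show ?thesis using tendsto_unique[OF _ _ tendsto_const] trivial_limit_at_right_real by blast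
qed

text \<open>A bound at a single minimal length suffices, as the sums increase with it. The bound is required for
  every \<open>t \<le> t0\<close> because the pressure is the infimum of all \<open>t\<close> at which the limit of the sums
  vanishes.\<close>

lemma pressure_at_ge:
  assumes "c > 0" and "\<And>C t. t \<le> t0 \<Longrightarrow> C \<in> bowen_covers T Z N \<epsilon> \<Longrightarrow>
     c \<le> (\<Sum>\<^sub>\<infinity>(x, m)\<in>C. ennreal (exp (- t * real m + (SUP y \<in> bowen_ball T m x \<epsilon>. birkhoff_sum T \<psi> m y))))"
  shows "ereal t0 \<le> pressure_at T Z \<psi> \<epsilon>"
  unfolding pressure_at_def
proof (rule Inf_greatest, clarify)
  fix t assume 0: "pressure_lim T Z t \<psi> \<epsilon> = 0"
  show "ereal t0 \<le> ereal t"
  proof (rule ccontr)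
    assume "\<not> ereal t0 \<le> ereal t"
    then have "c \<le> pressure_sum T Z t \<psi> N \<epsilon>"
      unfolding pressure_sum_def by (intro INF_greatest assms(2)) auto
    then show False using 0 \<open>c > 0\<close> by (simp add: pressure_lim_eq_0_iff)
  qed
qed

section \<open>Shadowing of infinite sequences of orbit segments\<close>

text \<open>The points that shadow one given segment up to and including the tolerance form a closed set. Finite
  intersections of these sets are nonempty by assumption, hence so is the intersection of all of them.
  The indices of the assumption start at \<open>1\<close>, those of the sequence at \<open>0\<close>.\<close>

lemma shadow_sequence:
  fixes T :: "'a::metric_space \<Rightarrow> 'a"
  assumes comp: "compact (UNIV :: 'a set)" and cont: "continuous_on UNIV T"
    and n: "n \<ge> 1"
    and spec: "\<And>k. k \<ge> 1 \<Longrightarrow> \<exists>z. \<forall>i\<in>{1..k}. (T ^^ (\<Sum>j\<in>{1..<i}. n + q)) z \<in> bowen_ball T n (\<omega> (i - 1)) \<epsilon>"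
  shows "\<exists>z. \<forall>j. \<forall>i<n. dist ((T ^^ (j * (n + q) + i)) z) ((T ^^ i) (\<omega> j)) \<le> \<epsilon>"
proof -
  define A where "A j = {z. \<forall>i<n. dist ((T ^^ (j * (n + q) + i)) z) ((T ^^ i) (\<omega> j)) \<le> \<epsilon>}" for j
  have closedA: "closed (A j)" for j
  proof -
    have "A j = (\<Inter>i\<in>{..<n}. {z. dist ((T ^^ (j * (n + q) + i)) z) ((T ^^ i) (\<omega> j)) \<le> \<epsilon>})"
      by (auto simp: A_def)
    then show ?thesis
      by (simp add: closed_INT closed_Collect_le continuous_on_dist continuous_on_funpow[OF cont])
  qed
  have fip: "\<Inter>F \<noteq> {}" if F: "finite F" "F \<subseteq> range A" for F
  proof -
    obtain J where J: "finite J" "F = A ` J" using finite_subset_image[OF F] by blast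
    define k where "k = Suc (Max (insert 0 J))"
    have Jk: "j < k" if "j \<in> J" for j
      using J(1) that by (simp add: k_def less_Suc_eq_le)
    obtain z where z: "\<forall>i\<in>{1..k}. (T ^^ (\<Sum>j\<in>{1..<i}. n + q)) z \<in> bowen_ball T n (\<omega> (i - 1)) \<epsilon>"
      using spec[of k] by (auto simp: k_def)
    have "z \<in> A j" if "j \<in> J" for j
    proof -
      have "(T ^^ (\<Sum>j\<in>{1..<Suc j}. n + q)) z \<in> bowen_ball T n (\<omega> (Suc j - 1)) \<epsilon>"
        using Jk[OF that] by (intro z[rule_format]) auto
      then have "\<forall>i<n. dist ((T ^^ i) (\<omega> j)) ((T ^^ i) ((T ^^ (j * (n + q))) z)) < \<epsilon>"
        using n by (simp add: in_bowen_ball_iff)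
      then show ?thesis
        by (auto simp: A_def dist_commute add.commute funpow_add less_imp_le)
    qed
    then show ?thesis using J by auto
  qed
  have "UNIV \<inter> \<Inter>(range A) \<noteq> {}"
    using comp[unfolded compact_fip, rule_format, of "range A"] closedA fip by auto
  then show ?thesis unfolding A_def by blast
qed

text \<open>A smaller tolerance has a larger lag, so the upper limit at \<open>\<epsilon>\<close> lies below the upper limits at all
  smaller tolerances, and these tend to \<open>0\<close>.\<close>

lemma sublinear_lag:
  assumes spec: "\<forall>x\<in>K. \<forall>n\<ge>1. \<forall>\<epsilon>1 \<epsilon>2. 0 < \<epsilon>1 \<and> \<epsilon>1 < \<epsilon>2 \<and> \<epsilon>2 < \<eta> \<longrightarrow> (p :: 'a \<Rightarrow> nat \<Rightarrow> real \<Rightarrow> nat) x n \<epsilon>1 \<ge> p x n \<epsilon>2"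
    and lim: "\<forall>x\<in>K. ((\<lambda>\<epsilon>. limsup (\<lambda>n. ereal (real (p x n \<epsilon>) / real n))) \<longlongrightarrow> 0) (at_right 0)"
    and x: "x \<in> K" and \<epsilon>: "0 < \<epsilon>" "\<epsilon> < \<eta>" and g: "g > 0"
  shows "eventually (\<lambda>n. real (p x n \<epsilon>) \<le> g * real n) sequentially"
proof -
  have "limsup (\<lambda>n. ereal (real (p x n \<epsilon>) / real n)) \<le> 0"
  proof (rule tendsto_lowerbound[OF lim[rule_format, OF x]])
    have "limsup (\<lambda>n. ereal (real (p x n \<epsilon>) / real n)) \<le> limsup (\<lambda>n. ereal (real (p x n \<epsilon>') / real n))"
      if "0 < \<epsilon>'" "\<epsilon>' < \<epsilon>" for \<epsilon>'
    proof (rule Limsup_mono)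
      show "eventually (\<lambda>n. ereal (real (p x n \<epsilon>) / real n) \<le> ereal (real (p x n \<epsilon>') / real n)) sequentially"
        using eventually_ge_at_top[of 1]
      proof eventually_elim
        case (elim n)
        then have "p x n \<epsilon> \<le> p x n \<epsilon>'" using spec x that \<epsilon> by blast
        then show ?case by (simp add: divide_right_mono)
      qed
    qed
    then show "eventually (\<lambda>\<epsilon>'. limsup (\<lambda>n. ereal (real (p x n \<epsilon>) / real n)) \<le> limsup (\<lambda>n. ereal (real (p x n \<epsilon>') / real n))) (at_right 0)"
      using \<epsilon> by (intro eventually_at_rightI[of 0 \<epsilon>]) auto
  qed auto
  also have "(0::ereal) < ereal g" using g by simp
  finally have "eventually (\<lambda>n. ereal (real (p x n \<epsilon>) / real n) < ereal g) sequentially"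
    by (rule Limsup_lessD)
  then show ?thesis
    using eventually_ge_at_top[of 1]
  proof eventually_elim
    case (elim n)
    then have "real (p x n \<epsilon>) / real n < g" by simp
    then show ?case using elim by (simp add: pos_divide_less_eq)
  qed
qed

section \<open>Entropy of finite codings\<close>

text \<open>Termwise this is \<open>ln x \<le> x - 1\<close> for \<open>x = q i / p i\<close>.\<close>

lemma gibbs_inequality:
  fixes p q :: "'i \<Rightarrow> real"
  assumes "\<And>i. i \<in> I \<Longrightarrow> 0 \<le> p i" and "\<And>i. i \<in> I \<Longrightarrow> 0 \<le> q i"
    and pos: "\<And>i. i \<in> I \<Longrightarrow> p i > 0 \<Longrightarrow> q i > 0"
    and "sum p I = 1" and "sum q I \<le> 1"
  shows "- (\<Sum>i\<in>I. p i * ln (p i)) \<le> - (\<Sum>i\<in>I. p i * ln (q i))"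
proof -
  have "(\<Sum>i\<in>I. p i * ln (q i) - p i * ln (p i)) \<le> (\<Sum>i\<in>I. q i - p i)"
  proof (rule sum_mono)
    fix i assume i: "i \<in> I"
    show "p i * ln (q i) - p i * ln (p i) \<le> q i - p i"
    proof (cases "p i = 0")
      case False
      with assms(1) i have p: "p i > 0" by (simp add: order_less_le)
      have "p i * ln (q i / p i) \<le> p i * (q i / p i - 1)"
        using p pos[OF i p] by (intro mult_left_mono ln_le_minus_one) auto
      then show ?thesis using p pos[OF i p] by (simp add: ln_div right_diff_distrib)
    qed (use assms(2) i in simp)
  qed
  also have "\<dots> \<le> 0" using assms(4,5) by (simp add: sum_subtractf)
  finally show ?thesis by (simp add: sum_subtractf)
qed

text \<open>A finite-valued map stands for the partition into its fibres. Joins of partitions become pairings of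
  maps, and two maps with the same fibres (\<open>fibers_cong\<close>) have literally the same entropy.\<close>

definition fibers :: "('a \<Rightarrow> 'b) \<Rightarrow> 'a set set" where
  "fibers f = range (\<lambda>x. f -` {f x})"

lemma fibers_cong:
  assumes "\<And>x y. f x = f y \<longleftrightarrow> g x = g y"
  shows "fibers f = fibers g"
  unfolding fibers_def vimage_def by (simp add: assms)

lemma partition_entropy_fibers:
  assumes "finite S" and "range f \<subseteq> S"
  shows "partition_entropy M (fibers f)
    = - (\<Sum>b\<in>S. measure M (f -` {b}) * ln (measure M (f -` {b})))"
proof -
  have "fibers f = (\<lambda>b. f -` {b}) ` range f" by (auto simp: fibers_def)
  moreover have "inj_on (\<lambda>b. f -` {b}) (range f)" by (auto simp: inj_on_def)
  ultimately have "(\<Sum>A\<in>fibers f. measure M A * ln (measure M A))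
      = (\<Sum>b\<in>range f. measure M (f -` {b}) * ln (measure M (f -` {b})))"
    by (simp only: sum.reindex o_def)
  also have "\<dots> = (\<Sum>b\<in>S. measure M (f -` {b}) * ln (measure M (f -` {b})))"
  proof (rule sum.mono_neutral_left[OF assms], rule ballI)
    fix b assume "b \<in> S - range f"
    then have "f -` {b} = {}" by auto
    then show "measure M (f -` {b}) * ln (measure M (f -` {b})) = 0" by simp
  qed
  finally show ?thesis by (simp add: partition_entropy_def)
qed

lemma sum_measure_fibers:
  assumes "prob_space M" "finite S" "range f \<subseteq> S" "\<And>b. f -` {b} \<in> sets M" "A \<in> sets M"
  shows "(\<Sum>b\<in>S. measure M (A \<inter> f -` {b})) = measure M A"
proof -
  interpret prob_space M by fact
  have "A = (\<Union>b\<in>S. A \<inter> f -` {b})" using assms(3) by auto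
  then have "measure M A = measure M (\<Union>b\<in>S. A \<inter> f -` {b})" by simp
  also have "\<dots> = (\<Sum>b\<in>S. measure M (A \<inter> f -` {b}))"
    using assms(2,4,5) by (intro finite_measure_finite_Union) (auto simp: disjoint_family_on_def)
  finally show ?thesis by simp
qed

text \<open>Gibbs' inequality for the joint distribution against the product of its marginals.\<close>

lemma entropy_subadditive:
  assumes M: "prob_space M" "space M = UNIV"
    and f: "finite S" "range f \<subseteq> S" "\<And>b. f -` {b} \<in> sets M"
    and g: "finite S'" "range g \<subseteq> S'" "\<And>b. g -` {b} \<in> sets M"
  shows "partition_entropy M (fibers (\<lambda>x. (f x, g x)))
      \<le> partition_entropy M (fibers f) + partition_entropy M (fibers g)"
proof -
  interpret prob_space M by fact
  define p where "p b = measure M (f -` {b})" for b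
  define q where "q c = measure M (g -` {c})" for c
  define r where "r b c = measure M (f -` {b} \<inter> g -` {c})" for b c
  have r0: "r b c \<ge> 0" "p b \<ge> 0" "q c \<ge> 0" for b c by (auto simp: r_def p_def q_def)
  have rp: "(\<Sum>c\<in>S'. r b c) = p b" for b
    unfolding r_def p_def by (rule sum_measure_fibers[OF M(1) g f(3)])
  have rq: "(\<Sum>b\<in>S. r b c) = q c" for c
    unfolding r_def q_def using sum_measure_fibers[OF M(1) f g(3)] by (simp add: Int_commute)
  have p1: "sum p S = 1"
    using sum_measure_fibers[OF M(1) f, of UNIV] M(2) sets.top[of M] prob_space
    by (simp add: p_def)
  have q1: "sum q S' = 1"
    using sum_measure_fibers[OF M(1) g, of UNIV] M(2) sets.top[of M] prob_space
    by (simp add: q_def)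
  have rle: "r b c \<le> p b" "r b c \<le> q c" for b c
    using f(3) g(3) unfolding r_def p_def q_def by (auto intro!: finite_measure_mono)
  have "partition_entropy M (fibers (\<lambda>x. (f x, g x)))
      = - (\<Sum>(b, c)\<in>S \<times> S'. r b c * ln (r b c))"
  proof -
    have "(\<lambda>x. (f x, g x)) -` {bc} = f -` {fst bc} \<inter> g -` {snd bc}" for bc
      by auto
    then show ?thesis
      using f(1,2) g(1,2)
      by (subst partition_entropy_fibers[of "S \<times> S'"]) (auto simp: r_def case_prod_beta)
  qed
  also have "\<dots> \<le> - (\<Sum>(b, c)\<in>S \<times> S'. r b c * ln (p b * q c))"
  proof -
    have "- (\<Sum>i\<in>S \<times> S'. case_prod r i * ln (case_prod r i))
       \<le> - (\<Sum>i\<in>S \<times> S'. case_prod r i * ln (p (fst i) * q (snd i)))"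
    proof (rule gibbs_inequality)
      show "sum (case_prod r) (S \<times> S') = 1"
        using rp p1 by (simp add: sum.cartesian_product[symmetric])
      have "(\<Sum>i\<in>S \<times> S'. p (fst i) * q (snd i)) = sum p S * sum q S'"
        by (simp add: sum_product sum.cartesian_product case_prod_beta)
      then show "(\<Sum>i\<in>S \<times> S'. p (fst i) * q (snd i)) \<le> 1" using p1 q1 by simp
      show "p (fst i) * q (snd i) > 0" if "case_prod r i > 0" for i
        using that rle(1)[of "fst i" "snd i"] rle(2)[of "fst i" "snd i"] by (auto simp: case_prod_beta intro!: mult_pos_pos)
    qed (auto simp: r0 case_prod_beta)
    then show ?thesis by (simp add: case_prod_beta)
  qed
  also have "(\<Sum>(b, c)\<in>S \<times> S'. r b c * ln (p b * q c))
      = (\<Sum>(b, c)\<in>S \<times> S'. r b c * ln (p b) + r b c * ln (q c))"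
  proof (rule sum.cong[OF refl], clarify)
    fix b c
    show "r b c * ln (p b * q c) = r b c * ln (p b) + r b c * ln (q c)"
    proof (cases "r b c = 0")
      case False
      then have "p b > 0" "q c > 0"
        using r0(1)[of b c] rle(1)[of b c] rle(2)[of b c] by auto
      then show ?thesis by (simp add: ln_mult distrib_left)
    qed simp
  qed
  also have "\<dots> = (\<Sum>b\<in>S. \<Sum>c\<in>S'. r b c * ln (p b)) + (\<Sum>c\<in>S'. \<Sum>b\<in>S. r b c * ln (q c))"
    by (subst (2) sum.swap) (simp add: sum.cartesian_product[symmetric] sum.distrib)
  also have "\<dots> = (\<Sum>b\<in>S. p b * ln (p b)) + (\<Sum>c\<in>S'. q c * ln (q c))"
    by (simp add: sum_distrib_right[symmetric] rp rq)
  finally show ?thesis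
    by (simp add: partition_entropy_fibers[OF f(1,2)] partition_entropy_fibers[OF g(1,2)] p_def q_def)
qed

lemma partition_entropy_nonneg:
  assumes "prob_space M"
  shows "partition_entropy M P \<ge> 0"
proof -
  interpret prob_space M by fact
  have "measure M A * ln (measure M A) \<le> 0" for A
    by (cases "measure M A = 0")
      (auto intro!: mult_nonneg_nonpos simp: zero_less_measure_iff)
  then show ?thesis unfolding partition_entropy_def by (simp add: sum_nonpos)
qed

text \<open>Writing \<open>n = m k + r\<close> with \<open>r < k\<close> shows that \<open>a n / n\<close> eventually stays below \<open>a k / k + e / 2\<close> for
  each fixed \<open>k\<close>, so the sequence converges to its infimum.\<close>

lemma fekete:
  fixes a :: "nat \<Rightarrow> real"
  assumes nonneg: "\<And>n. a n \<ge> 0" and sub: "\<And>m n. a (m + n) \<le> a m + a n"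
  shows "convergent (\<lambda>n. a n / real n)"
proof -
  define L where "L = (INF n\<in>{1..}. a n / real n)"
  have bdd: "bdd_below ((\<lambda>n. a n / real n) ` {1..})"
    using nonneg by (intro bdd_belowI2[of _ 0]) auto
  have low: "L \<le> a n / real n" if "n \<ge> 1" for n
    unfolding L_def using that by (intro cINF_lower[OF bdd]) auto
  have "(\<lambda>n. a n / real n) \<longlonglongrightarrow> L"
  proof (rule LIMSEQ_I)
    fix e :: real assume e: "e > 0"
    have "\<exists>k\<in>{1..}. a k / real k < L + e / 2"
      using e cINF_less_iff[OF _ bdd, of "L + e / 2"] by (simp add: L_def)
    then obtain k where k: "k \<ge> 1" "a k / real k < L + e / 2" by auto
    define C where "C = (\<Sum>r<k. a r)"
    have C: "a r \<le> C" if "r < k" for r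
      unfolding C_def using that nonneg by (intro member_le_sum) auto
    have mult: "a (m * k + r) \<le> real m * a k + a r" for m r
    proof (induction m)
      case (Suc m)
      have "a (Suc m * k + r) \<le> a k + a (m * k + r)"
        using sub[of k "m * k + r"] by (simp add: add.assoc)
      then show ?case using Suc.IH by (simp add: algebra_simps)
    qed simp
    have up: "a n / real n \<le> a k / real k + C / real n" if "n \<ge> 1" for n
    proof -
      have "a n \<le> real (n div k) * a k + C"
        using mult[of "n div k" "n mod k"] C[of "n mod k"] k(1) by simp
      also have "real (n div k) * a k \<le> (real n / real k) * a k"
        using nonneg k(1)
        by (intro mult_right_mono) (simp_all add: le_divide_eq flip: of_nat_mult)
      finally have "a n \<le> real n * (a k / real k) + C" by simp
      then have "a n / real n \<le> (real n * (a k / real k) + C) / real n"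
        by (rule divide_right_mono) simp
      also have "\<dots> = a k / real k + C / real n"
        using that by (simp add: add_divide_distrib)
      finally show ?thesis .
    qed
    obtain N where N: "N \<ge> 1" "C / (e / 2) < real N"
      by (metis reals_Archimedean2 max.cobounded1 max.cobounded2 of_nat_le_iff order_less_le_trans)
    have "norm (a n / real n - L) < e" if "n \<ge> N" for n
    proof -
      have "C / (e / 2) < real n" using N that by linarith
      then have "C / real n < e / 2"
        using e N that by (simp add: field_simps)
      moreover have "a n / real n \<le> a k / real k + C / real n" "L \<le> a n / real n"
        using up low N that by auto
      ultimately show ?thesis using k(2) e unfolding real_norm_def abs_less_iff by linarith
    qed
    then show "\<exists>N. \<forall>n\<ge>N. norm (a n / real n - L) < e" by blast
  qed
  then show ?thesis by (rule convergentI)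
qed

definition cell :: "'a set set \<Rightarrow> 'a \<Rightarrow> 'a set" where
  "cell P x = (THE A. A \<in> P \<and> x \<in> A)"

definition itinerary :: "('a \<Rightarrow> 'a) \<Rightarrow> 'a set set \<Rightarrow> nat \<Rightarrow> 'a \<Rightarrow> nat \<Rightarrow> 'a set" where
  "itinerary T P n x = (\<lambda>i\<in>{..<n}. cell P ((T ^^ i) x))"

lemma cell_eqI:
  assumes "partition_on UNIV P" "A \<in> P" "x \<in> A"
  shows "cell P x = A"
  unfolding cell_def
proof (rule the_equality)
  fix B assume "B \<in> P \<and> x \<in> B"
  then show "B = A" using assms disjointD[OF partition_onD2[OF assms(1)], of B A] by blast
qed (use assms in simp)

lemma cell_in:
  assumes "partition_on UNIV P"
  shows "cell P x \<in> P" "x \<in> cell P x"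
proof -
  have "x \<in> \<Union>P" using partition_onD1[OF assms] by simp
  then obtain A where "A \<in> P" "x \<in> A" by blast
  with cell_eqI[OF assms this] show "cell P x \<in> P" "x \<in> cell P x" by auto
qed

lemma itinerary_eq_iff:
  "itinerary T P n x = itinerary T P n y \<longleftrightarrow> (\<forall>i<n. cell P ((T ^^ i) x) = cell P ((T ^^ i) y))"
proof
  assume eq: "itinerary T P n x = itinerary T P n y"
  show "\<forall>i<n. cell P ((T ^^ i) x) = cell P ((T ^^ i) y)"
  proof (intro allI impI)
    fix i assume "i < n"
    then show "cell P ((T ^^ i) x) = cell P ((T ^^ i) y)"
      using fun_cong[OF eq, of i] by (simp add: itinerary_def)
  qed
qed (simp add: itinerary_def restrict_def fun_eq_iff)

lemma itinerary_PiE: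
  assumes "partition_on UNIV P"
  shows "range (itinerary T P n) \<subseteq> {..<n} \<rightarrow>\<^sub>E P"
proof (rule image_subsetI)
  fix x
  show "itinerary T P n x \<in> {..<n} \<rightarrow>\<^sub>E P"
    using cell_in(1)[OF assms] by (simp add: itinerary_def)
qed

lemma itinerary_measurable:
  fixes T :: "'a::topological_space \<Rightarrow> 'a"
  assumes P: "partition_on UNIV P" "P \<subseteq> sets borel" and T: "continuous_on UNIV T"
  shows "itinerary T P n -` {w} \<in> sets borel"
proof (cases "w \<in> {..<n} \<rightarrow>\<^sub>E P")
  case True
  have "itinerary T P n -` {w} = {x \<in> space borel. \<forall>i\<in>{..<n}. (T ^^ i) x \<in> w i}"
  proof (rule set_eqI)
    fix x
    have "itinerary T P n x = w \<longleftrightarrow> (\<forall>i<n. cell P ((T ^^ i) x) = w i)"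
    proof
      assume *: "\<forall>i<n. cell P ((T ^^ i) x) = w i"
      show "itinerary T P n x = w"
      proof
        fix i show "itinerary T P n x i = w i"
          using * True by (cases "i < n") (auto simp: itinerary_def PiE_def extensional_def)
      qed
    qed (auto simp: itinerary_def)
    also have "\<dots> \<longleftrightarrow> (\<forall>i<n. (T ^^ i) x \<in> w i)"
    proof -
      have "cell P ((T ^^ i) x) = w i \<longleftrightarrow> (T ^^ i) x \<in> w i" if "i < n" for i
      proof -
        have "w i \<in> P" using True that by auto
        then show ?thesis using cell_in(2)[OF P(1)] cell_eqI[OF P(1)] by metis
      qed
      then show ?thesis by simp
    qed
    finally show "x \<in> itinerary T P n -` {w}
        \<longleftrightarrow> x \<in> {x \<in> space borel. \<forall>i\<in>{..<n}. (T ^^ i) x \<in> w i}"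
      by auto
  qed
  also have "\<dots> \<in> sets borel"
  proof (rule sets.sets_Collect_finite_All)
    fix i assume "i \<in> {..<n}"
    then have "w i \<in> sets borel" using P(2) True by auto
    then have "(T ^^ i) -` w i \<inter> space borel \<in> sets borel"
      using borel_measurable_continuous_onI[OF continuous_on_funpow[OF T]] by (rule measurable_sets[rotated])
    also have "(T ^^ i) -` w i \<inter> space borel = {x \<in> space borel. (T ^^ i) x \<in> w i}" by auto
    finally show "{x \<in> space borel. (T ^^ i) x \<in> w i} \<in> sets borel" .
  qed simp
  finally show ?thesis .
next
  case False
  then have "itinerary T P n -` {w} = {}" using itinerary_PiE[OF P(1)] by fast
  then show ?thesis by simp
qed

text \<open>Both sides omit the words that no orbit realises.\<close>

lemma iterated_join_eq_fibers:
  assumes "partition_on UNIV P"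
  shows "iterated_join T n P = fibers (itinerary T P n)"
proof -
  have key: "(\<Inter>i\<in>{..<n}. (T ^^ i) -` (f i)) = itinerary T P n -` {itinerary T P n x}"
    if f: "f \<in> {..<n} \<rightarrow> P" and x: "x \<in> (\<Inter>i\<in>{..<n}. (T ^^ i) -` (f i))" for f x
  proof -
    have fi: "f i = cell P ((T ^^ i) x)" if "i < n" for i
    proof -
      have "f i \<in> P" "(T ^^ i) x \<in> f i" using that f x by auto
      then show ?thesis by (rule cell_eqI[OF assms, symmetric])
    qed
    have "(T ^^ i) y \<in> f i \<longleftrightarrow> cell P ((T ^^ i) y) = cell P ((T ^^ i) x)" if "i < n" for i y
      unfolding fi[OF that] using cell_in[OF assms] cell_eqI[OF assms] by metis
    then show ?thesis by (auto simp: itinerary_eq_iff)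
  qed
  have "A \<in> fibers (itinerary T P n)" if "A \<in> iterated_join T n P" for A
  proof -
    from that obtain f x where "f \<in> {..<n} \<rightarrow> P" "A = (\<Inter>i\<in>{..<n}. (T ^^ i) -` (f i))" "x \<in> A"
      by (auto simp: iterated_join_def)
    with key[of f x] show ?thesis by (auto simp: fibers_def)
  qed
  moreover have "A \<in> iterated_join T n P" if "A \<in> fibers (itinerary T P n)" for A
  proof -
    from that obtain x where A: "A = itinerary T P n -` {itinerary T P n x}"
      by (auto simp: fibers_def)
    define f where "f i = cell P ((T ^^ i) x)" for i
    have f: "f \<in> {..<n} \<rightarrow> P" "x \<in> (\<Inter>i\<in>{..<n}. (T ^^ i) -` (f i))"
      using cell_in[OF assms] by (auto simp: f_def)
    have "A = (\<Inter>i\<in>{..<n}. (T ^^ i) -` (f i))" using key[OF f] A by simp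
    moreover have "A \<noteq> {}" using A by auto
    ultimately show ?thesis using f(1) by (auto simp: iterated_join_def)
  qed
  ultimately show ?thesis by blast
qed

section \<open>Invariant measures\<close>

lemma invariant_measures_D:
  assumes "\<mu> \<in> invariant_measures T"
  shows "prob_space \<mu>" "sets \<mu> = sets borel" "space \<mu> = UNIV" "distr \<mu> borel T = \<mu>"
proof -
  show "prob_space \<mu>" "sets \<mu> = sets borel" "distr \<mu> borel T = \<mu>"
    using assms by (auto simp only: invariant_measures_def mem_Collect_eq)
  then show "space \<mu> = UNIV" using sets_eq_imp_space_eq[of \<mu> borel] by simp
qed

lemma distr_funpow:
  fixes T :: "'a::topological_space \<Rightarrow> 'a"
  assumes "\<mu> \<in> invariant_measures T" and T: "T \<in> borel_measurable borel"
  shows "T ^^ i \<in> borel_measurable borel" "distr \<mu> borel (T ^^ i) = \<mu>"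
proof -
  note \<mu> = invariant_measures_D[OF assms(1)]
  show meas: "T ^^ i \<in> borel_measurable borel" for i
  proof (induction i)
    case (Suc i)
    then show ?case using measurable_comp[OF Suc T] by (simp only: funpow.simps)
  qed (simp add: id_def)
  show "distr \<mu> borel (T ^^ i) = \<mu>"
  proof (induction i)
    case 0
    then show ?case using \<mu>(2) by (simp add: id_def distr_id2)
  next
    case (Suc i)
    have "T ^^ Suc i = T \<circ> (T ^^ i)" by simp
    then have "distr \<mu> borel (T ^^ Suc i) = distr (distr \<mu> borel (T ^^ i)) borel T"
      using distr_distr[OF T, of "T ^^ i" \<mu>] meas by (simp add: measurable_cong_sets[OF \<mu>(2) refl])
    then show ?case using Suc.IH \<mu>(4) by (simp only:)
  qed
qed

lemma measure_funpow_vimage: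
  fixes T :: "'a::topological_space \<Rightarrow> 'a"
  assumes "\<mu> \<in> invariant_measures T" and T: "T \<in> borel_measurable borel" and A: "A \<in> sets borel"
  shows "measure \<mu> ((T ^^ i) -` A) = measure \<mu> A"
proof -
  note \<mu> = invariant_measures_D[OF assms(1)]
  have "measure \<mu> A = measure (distr \<mu> borel (T ^^ i)) A"
    by (simp add: distr_funpow[OF assms(1,2)])
  also have "\<dots> = measure \<mu> ((T ^^ i) -` A \<inter> space \<mu>)"
    using distr_funpow(1)[OF assms(1,2), of i] A measurable_cong_sets[OF \<mu>(2) refl]
    by (intro measure_distr) auto
  finally show ?thesis using \<mu>(3) by simp
qed

lemma integral_birkhoff_sum:
  fixes T :: "'a::topological_space \<Rightarrow> 'a" and \<psi> :: "'a \<Rightarrow> real"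
  assumes inv: "\<mu> \<in> invariant_measures T" and T: "T \<in> borel_measurable borel"
    and \<psi>: "\<psi> \<in> borel_measurable borel" and B: "\<And>x. \<bar>\<psi> x\<bar> \<le> B"
  shows "birkhoff_sum T \<psi> n \<in> borel_measurable borel"
    and "integrable \<mu> (birkhoff_sum T \<psi> n)"
    and "integral\<^sup>L \<mu> (birkhoff_sum T \<psi> n) = real n * integral\<^sup>L \<mu> \<psi>"
proof -
  note \<mu> = invariant_measures_D[OF inv]
  interpret prob_space \<mu> by fact
  note [measurable] = distr_funpow(1)[OF inv T] \<psi>
  have m: "(\<lambda>x. \<psi> ((T ^^ i) x)) \<in> borel_measurable borel" for i by measurable
  have int: "integrable \<mu> (\<lambda>x. \<psi> ((T ^^ i) x))" for i
    using m[of i] B by (intro integrable_const_bound[of _ B]) (auto simp: measurable_cong_sets[OF \<mu>(2) refl])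
  show "birkhoff_sum T \<psi> n \<in> borel_measurable borel"
    unfolding birkhoff_sum_def[abs_def] by measurable
  show "integrable \<mu> (birkhoff_sum T \<psi> n)"
    unfolding birkhoff_sum_def[abs_def] using int by auto
  have "(\<integral>x. \<psi> ((T ^^ i) x) \<partial>\<mu>) = integral\<^sup>L \<mu> \<psi>" for i
    using integral_distr[of "T ^^ i" \<mu> borel \<psi>] distr_funpow[OF inv T, of i] \<psi>
    by (simp add: measurable_cong_sets[OF \<mu>(2) refl])
  then show "integral\<^sup>L \<mu> (birkhoff_sum T \<psi> n) = real n * integral\<^sup>L \<mu> \<psi>"
    unfolding birkhoff_sum_def[abs_def] using int by (subst Bochner_Integration.integral_sum) auto
qed

text \<open>The mean of the Birkhoff sum is \<open>n \<integral>\<phi> d\<nu>\<close>. If the sum were smaller by \<open>n \<sigma>\<close> throughout \<open>G\<close>, it would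
  be so on a measurable set of measure at least \<open>1 - \<tau>\<close>, and the remaining mass \<open>\<tau>\<close> is too small to
  make up for it.\<close>

lemma point_with_large_sum:
  fixes T :: "'a::topological_space \<Rightarrow> 'a" and \<phi> :: "'a \<Rightarrow> real"
  assumes inv: "\<nu> \<in> invariant_measures T" and T: "T \<in> borel_measurable borel"
    and \<phi>: "\<phi> \<in> borel_measurable borel" and B: "\<And>x. \<bar>\<phi> x\<bar> \<le> B"
    and G: "\<And>V. V \<in> sets borel \<Longrightarrow> G \<subseteq> V \<Longrightarrow> measure \<nu> V \<ge> 1 - \<tau>"
    and \<sigma>: "\<sigma> > 0" "(2 * B + \<sigma>) * \<tau> < \<sigma>" and n: "n \<ge> 1"
  shows "\<exists>y\<in>G. birkhoff_sum T \<phi> n y \<ge> real n * (integral\<^sup>L \<nu> \<phi> - \<sigma>)"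
proof (rule ccontr)
  note \<nu> = invariant_measures_D[OF inv]
  interpret prob_space \<nu> by fact
  note ib = integral_birkhoff_sum[OF inv T \<phi> B, of n]
  let ?b = "integral\<^sup>L \<nu> \<phi>" and ?S = "birkhoff_sum T \<phi> n"
  assume "\<not> (\<exists>y\<in>G. ?S y \<ge> real n * (?b - \<sigma>))"
  then have small: "?S y < real n * (?b - \<sigma>)" if "y \<in> G" for y using that by (meson not_le)
  define V where "V = {x \<in> space borel. ?S x < real n * (?b - \<sigma>)}"
  have V: "V \<in> sets borel" unfolding V_def using ib(1) by (intro borel_measurable_less) auto
  have B0: "B \<ge> 0" using B[of undefined] by linarith
  have "measure \<nu> V \<ge> 1 - \<tau>" using small by (intro G V) (auto simp: V_def)
  then have mV: "measure \<nu> (- V) \<le> \<tau>"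
    using prob_compl[of V] V \<nu>(2,3) by (simp add: Compl_eq_Diff_UNIV[symmetric])
  have b: "?b \<ge> - B"
  proof -
    have "- B = (\<integral>x. - B \<partial>\<nu>)" by (simp add: prob_space)
    also have "\<dots> \<le> ?b"
    proof (rule integral_mono)
      show "integrable \<nu> \<phi>"
        using \<phi> B by (intro integrable_const_bound[of _ B]) (auto simp: measurable_cong_sets[OF \<nu>(2) refl])
      show "- B \<le> \<phi> x" for x using B[of x] by linarith
    qed simp
    finally show ?thesis .
  qed
  have "real n * ?b = integral\<^sup>L \<nu> ?S" by (rule ib(3)[symmetric])
  also have "\<dots> \<le> (\<integral>x. real n * (?b - \<sigma>) + real n * (2 * B + \<sigma>) * indicator (- V) x \<partial>\<nu>)"
  proof (rule integral_mono)
    show "integrable \<nu> ?S" by (rule ib(2))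
    show "integrable \<nu> (\<lambda>x. real n * (?b - \<sigma>) + real n * (2 * B + \<sigma>) * indicator (- V) x)"
      using V \<nu>(2) by (intro Bochner_Integration.integrable_add integrable_mult_right) (auto simp: emeasure_eq_measure)
    fix x
    (* 2 B + \<sigma> is the largest possible excess of the average over integral minus \<sigma>. *)
    have "?S x \<le> real n * B" using birkhoff_sum_abs_le[of \<phi> B T n x, OF B] by linarith
    also have "\<dots> \<le> real n * ((?b - \<sigma>) + (2 * B + \<sigma>))" using b by (intro mult_left_mono) auto
    finally show "?S x \<le> real n * (?b - \<sigma>) + real n * (2 * B + \<sigma>) * indicator (- V) x"
      by (cases "x \<in> V") (auto simp: V_def algebra_simps)
  qed
  also have "\<dots> = real n * (?b - \<sigma>) + real n * (2 * B + \<sigma>) * measure \<nu> (- V)"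
    using V \<nu>(2) by (simp add: emeasure_eq_measure prob_space)
  also have "\<dots> \<le> real n * (?b - \<sigma>) + real n * (2 * B + \<sigma>) * \<tau>"
    using mV B0 \<sigma> by (intro add_left_mono mult_left_mono) auto
  also have "\<dots> = real n * (?b - \<sigma> + (2 * B + \<sigma>) * \<tau>)" by (simp add: algebra_simps)
  finally have "?b \<le> ?b - \<sigma> + (2 * B + \<sigma>) * \<tau>" using n by (simp only: mult_le_cancel_left_pos of_nat_0_less_iff)
  then show False using \<sigma>(2) by linarith
qed

section \<open>Entropy rates and a bound for entropy plus integral\<close>

text \<open>An itinerary of length \<open>m + n\<close> is the pair of an itinerary of length \<open>m\<close> and one of length \<open>n\<close> read
  along the shifted orbit; invariance removes the shift, and Fekete's lemma applies.\<close>

lemma entropy_rate_LIMSEQ: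
  fixes T :: "'a::topological_space \<Rightarrow> 'a"
  assumes inv: "\<mu> \<in> invariant_measures T" and T: "continuous_on UNIV T"
    and P: "finite P" "partition_on UNIV P" "P \<subseteq> sets borel"
  shows "(\<lambda>n. partition_entropy \<mu> (fibers (itinerary T P n)) / real n)
    \<longlonglongrightarrow> ks_entropy_partition T \<mu> P"
proof -
  note \<mu> = invariant_measures_D[OF inv]
  have Tm: "T \<in> borel_measurable borel" using T by (rule borel_measurable_continuous_onI)
  let ?a = "\<lambda>n. partition_entropy \<mu> (fibers (itinerary T P n))"
  have fin: "finite ({..<n} \<rightarrow>\<^sub>E P)" for n :: nat using P(1) by (intro finite_PiE) auto
  have "?a (m + n) \<le> ?a m + ?a n" for m n
  proof -
    let ?g = "\<lambda>x. itinerary T P n ((T ^^ m) x)"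
    have "fibers (itinerary T P (m + n)) = fibers (\<lambda>x. (itinerary T P m x, ?g x))"
    proof (rule fibers_cong)
      fix x y
      have "(\<forall>i<m+n. cell P ((T ^^ i) x) = cell P ((T ^^ i) y)) \<longleftrightarrow>
        (\<forall>i<m. cell P ((T ^^ i) x) = cell P ((T ^^ i) y)) \<and>
        (\<forall>i<n. cell P ((T ^^ (m + i)) x) = cell P ((T ^^ (m + i)) y))"
        (is "?l \<longleftrightarrow> ?r1 \<and> ?r2")
      proof
        assume r: "?r1 \<and> ?r2"
        show ?l
        proof (intro allI impI)
          fix i assume "i < m + n"
          then consider "i < m" | "i - m < n" "i = m + (i - m)" by linarith
          then show "cell P ((T ^^ i) x) = cell P ((T ^^ i) y)"
            using r by cases (simp, metis)
        qed
      qed auto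
      then show "itinerary T P (m + n) x = itinerary T P (m + n) y \<longleftrightarrow>
        (itinerary T P m x, ?g x) = (itinerary T P m y, ?g y)"
        by (simp add: itinerary_eq_iff funpow_add add.commute[of m])
    qed
    moreover have g_meas: "?g -` {b} \<in> sets borel" for b
    proof -
      have "?g -` {b} = (T ^^ m) -` (itinerary T P n -` {b}) \<inter> space borel" by auto
      then show ?thesis
        using measurable_sets[OF distr_funpow(1)[OF inv Tm] itinerary_measurable[OF P(2,3) T]]
        by simp
    qed
    moreover have "partition_entropy \<mu> (fibers ?g) = ?a n"
    proof -
      have "measure \<mu> (?g -` {b}) = measure \<mu> (itinerary T P n -` {b})" for b
        using measure_funpow_vimage[OF inv Tm itinerary_measurable[OF P(2,3) T], of m n b]
        by (simp add: vimage_def)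
      then show ?thesis
        using itinerary_PiE[OF P(2), of T n]
        by (subst (1 2) partition_entropy_fibers[OF fin[of n]]) auto
    qed
    moreover have "partition_entropy \<mu> (fibers (\<lambda>x. (itinerary T P m x, ?g x)))
        \<le> ?a m + partition_entropy \<mu> (fibers ?g)"
      using itinerary_PiE[OF P(2), of T] itinerary_measurable[OF P(2,3) T] g_meas
      by (intro entropy_subadditive[OF \<mu>(1,3) fin[of m] _ _ fin[of n]]) (auto simp: \<mu>(2))
    ultimately show ?thesis by simp
  qed
  then have "convergent (\<lambda>n. ?a n / real n)"
    using partition_entropy_nonneg[OF \<mu>(1)] by (intro fekete) auto
  then show ?thesis
    by (simp add: ks_entropy_partition_def iterated_join_eq_fibers[OF P(2)] convergent_LIMSEQ_iff)
qed

text \<open>By Gibbs' inequality the entropy of the coding \<open>f\<close> is at most the mean of \<open>- ln (Q (f x))\<close> for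
  any subprobability weights \<open>Q\<close>, so a pointwise bound on
  \<open>F x - ln (Q (f x))\<close> integrates to a bound on entropy plus integral. The set \<open>bad\<close> allows a weaker
  pointwise bound where little mass lives.\<close>

lemma entropy_plus_integral_le:
  assumes M: "prob_space M" "space M = UNIV"
    and f: "finite W" "range f \<subseteq> W" "\<And>b. f -` {b} \<in> sets M"
    and Q: "\<And>w. w \<in> W \<Longrightarrow> Q w > 0" "sum Q W \<le> 1"
    and F: "integrable M F" and bad: "bad \<in> sets M"
    and le: "\<And>x. F x - ln (Q (f x)) \<le> C1 + C2 * indicator bad x"
  shows "partition_entropy M (fibers f) + integral\<^sup>L M F \<le> C1 + C2 * measure M bad"
proof -
  interpret prob_space M by fact
  let ?p = "\<lambda>w. measure M (f -` {w})"
  have "sum ?p W = 1"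
    using sum_measure_fibers[OF M(1) f, of UNIV] M(2) sets.top[of M] prob_space by simp
  then have "partition_entropy M (fibers f) \<le> - (\<Sum>w\<in>W. ?p w * ln (Q w))"
    unfolding partition_entropy_fibers[OF f(1,2)]
    using Q by (intro gibbs_inequality) (auto intro: less_imp_le)
  also have lnQ: "(\<lambda>x. ln (Q (f x))) = (\<lambda>x. \<Sum>w\<in>W. ln (Q w) * indicator (f -` {w}) x)"
  proof
    fix x
    have "(\<Sum>w\<in>W. ln (Q w) * indicator (f -` {w}) x) = (\<Sum>w\<in>W. if w = f x then ln (Q w) else 0)"
      by (intro sum.cong) (auto simp: indicator_def)
    then show "ln (Q (f x)) = (\<Sum>w\<in>W. ln (Q w) * indicator (f -` {w}) x)"
      using f(1,2) by auto
  qed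
  have int: "integrable M (\<lambda>x. ln (Q w) * indicator (f -` {w}) x)" for w
    using f(3) by (intro integrable_mult_right) (simp add: emeasure_eq_measure)
  have intQ: "integrable M (\<lambda>x. ln (Q (f x)))" unfolding lnQ using int by auto
  have "(\<Sum>w\<in>W. ?p w * ln (Q w)) = (\<integral>x. ln (Q (f x)) \<partial>M)"
    unfolding lnQ using int f(3)
    by (subst Bochner_Integration.integral_sum) (auto simp: emeasure_eq_measure mult.commute)
  finally have "partition_entropy M (fibers f) + integral\<^sup>L M F \<le> (\<integral>x. F x - ln (Q (f x)) \<partial>M)"
    using F intQ by simp
  also have "\<dots> \<le> (\<integral>x. C1 + C2 * indicator bad x \<partial>M)"
    using F intQ bad le by (intro integral_mono) (auto simp: emeasure_eq_measure)
  also have "\<dots> = C1 + C2 * measure M bad"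
    using bad by (simp add: emeasure_eq_measure prob_space)
  finally show ?thesis .
qed

section \<open>Approximation of Borel sets and of nonmeasurable exhaustions\<close>

lemma open_approx_closed:
  fixes M :: "'a::metric_space measure"
  assumes M: "finite_measure M" "sets M = sets borel" and U: "open U" and e: "e > 0"
  shows "\<exists>C. closed C \<and> C \<subseteq> U \<and> measure M (U - C) < e"
proof (cases "U = UNIV")
  case True
  then show ?thesis using e by (intro exI[of _ UNIV]) auto
next
  case False
  interpret finite_measure M by fact
  define V where "V n = {x. infdist x (- U) < inverse (real (Suc n))}" for n
  have V: "open (V n)" for n unfolding V_def by (intro open_Collect_less continuous_intros)
  have "U \<inter> V (Suc n) \<subseteq> U \<inter> V n" for n
  proof -
    have "inverse (real (Suc (Suc n))) \<le> inverse (real (Suc n))" by (simp add: field_simps)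
    then have "V (Suc n) \<subseteq> V n" unfolding V_def Collect_mono_iff by (meson order_less_le_trans)
    then show ?thesis by blast
  qed
  then have dec: "decseq (\<lambda>n. U \<inter> V n)" by (rule decseq_SucI)
  have "x \<notin> U" if x: "\<And>n. x \<in> V n" for x
  proof -
    have "infdist x (- U) \<le> 0"
    proof (rule ccontr)
      assume "\<not> infdist x (- U) \<le> 0"
      then obtain n where "inverse (real (Suc n)) < infdist x (- U)"
        using reals_Archimedean by (metis not_le)
      then show False using x[of n] by (simp add: V_def)
    qed
    then have "infdist x (- U) = 0" using infdist_nonneg[of x "- U"] by linarith
    then have "x \<in> - U"
      using U False in_closed_iff_infdist_zero[of "- U" x] by auto
    then show ?thesis by simp
  qed
  then have emp: "(\<Inter>n. U \<inter> V n) = {}" by blast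
  have "(\<lambda>n. measure M (U \<inter> V n)) \<longlonglongrightarrow> measure M (\<Inter>n. U \<inter> V n)"
    using U V by (intro finite_Lim_measure_decseq[OF _ dec]) (auto simp: M(2))
  then have "eventually (\<lambda>n. measure M (U \<inter> V n) < e) sequentially"
    using e emp by (intro order_tendstoD(2)) auto
  then obtain n where n: "measure M (U \<inter> V n) < e" by (auto dest: eventually_happens)
  have "x \<in> V n" if "x \<notin> U" for x using that by (simp add: V_def)
  then have "- V n \<subseteq> U" by blast
  moreover have "closed (- V n)" using V[of n] by (simp add: closed_Compl)
  moreover have "U - (- V n) = U \<inter> V n" by auto
  ultimately show ?thesis using n by metis
qed

text \<open>The sets that can be squeezed between a closed and an open set up to a small measure form a
  \<open>\<sigma>\<close>-algebra containing the open sets.\<close>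

lemma borel_between_closed_open:
  fixes M :: "'a::metric_space measure"
  assumes M: "finite_measure M" "sets M = sets borel" and A: "A \<in> sets borel" and e: "e > 0"
  shows "\<exists>C U. closed C \<and> open U \<and> C \<subseteq> A \<and> A \<subseteq> U \<and> measure M (U - C) < e"
proof -
  interpret finite_measure M by fact
  have A': "A \<in> sigma_sets UNIV (Collect open)" using A by (simp add: borel_def)
  have closed_sets: "closed C \<Longrightarrow> C \<in> sets M" and open_sets: "open U \<Longrightarrow> U \<in> sets M" for C U
    by (auto simp: M(2))
  show ?thesis
    using A' e
  proof (induction arbitrary: e rule: sigma_sets.induct)
    case (Basic U)
    then have "open U" by simp
    then show ?case using open_approx_closed[OF M _ Basic(2), of U] by (metis order_refl)
  next
    case Empty
    then show ?case by (intro exI[of _ "{}"]) auto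
  next
    case (Compl A)
    obtain C U where *: "closed C" "open U" "C \<subseteq> A" "A \<subseteq> U" "measure M (U - C) < e"
      using Compl.IH[OF Compl.prems] by blast
    moreover have "- C - (- U) = U - C" by auto
    ultimately show ?case by (intro exI[of _ "- U"] exI[of _ "- C"]) auto
  next
    case (Union A)
    then have e: "e > 0" by simp
    have "\<forall>i::nat. \<exists>C U. closed C \<and> open U \<and> C \<subseteq> A i \<and> A i \<subseteq> U \<and> measure M (U - C) < (e / 2) * (1 / 2) ^ Suc i"
      by (intro allI Union.IH) (use e in simp)
    then obtain C U where CU: "\<And>i. closed (C i)" "\<And>i. open (U i)" "\<And>i. C i \<subseteq> A i" "\<And>i. A i \<subseteq> U i"
      "\<And>i. measure M (U i - C i) < (e / 2) * (1 / 2) ^ Suc i" by metis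
    define V where "V = (\<Union>i. U i)"
    define D where "D n = (\<Union>i\<le>n. C i)" for n
    have D_sets: "D n \<in> sets M" for n using CU(1) by (auto simp: D_def intro: closed_sets)
    have V_sets: "V \<in> sets M" using CU(2) by (auto simp: V_def intro: open_sets)
    have sm: "summable (\<lambda>i. (e / 2) * (1 / 2 :: real) ^ Suc i)"
      using power_half_series by (intro summable_mult) (auto simp: sums_iff)
    have si: "(\<Sum>i. (e / 2) * (1 / 2 :: real) ^ Suc i) = e / 2"
      using power_half_series by (subst suminf_mult) (auto simp: sums_iff)
    have UC_sets: "U i - C i \<in> sets M" for i
      using CU(1,2) by (intro sets.Diff) (auto intro: open_sets closed_sets)
    have smm: "summable (\<lambda>i. measure M (U i - C i))"
      using CU(5) by (intro summable_comparison_test_ev[OF _ sm] always_eventually)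
        (auto intro: less_imp_le)
    have "measure M (\<Union>i. U i - C i) \<le> (\<Sum>i. measure M (U i - C i))"
      using UC_sets smm by (intro finite_measure_subadditive_countably) auto
    also have "\<dots> \<le> (\<Sum>i. (e / 2) * (1 / 2 :: real) ^ Suc i)"
      using CU(5) by (intro suminf_le smm sm) (rule less_imp_le)
    also have "\<dots> = e / 2" by (rule si)
    finally have 1: "measure M (V - (\<Union>i. C i)) \<le> e / 2"
      using UC_sets by (elim order_trans[rotated], intro finite_measure_mono) (auto simp: V_def)
    have "(\<lambda>n. measure M (V - D n)) \<longlonglongrightarrow> measure M (\<Inter>n. V - D n)"
      using V_sets D_sets
      by (intro finite_Lim_measure_decseq) (force simp: decseq_def D_def)+
    moreover have "(\<Inter>n. V - D n) = V - (\<Union>i. C i)" by (auto simp: D_def)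
    ultimately have "eventually (\<lambda>n. measure M (V - D n) < e) sequentially"
      using 1 e by (intro order_tendstoD(2)[of _ "measure M (V - (\<Union>i. C i))"]) auto
    then obtain n where "measure M (V - D n) < e" by (auto dest: eventually_happens)
    moreover have "closed (D n)" "open V" using CU(1,2) by (auto simp: D_def V_def)
    moreover have "D n \<subseteq> (\<Union>i. A i)" "(\<Union>i. A i) \<subseteq> V" using CU(3,4) by (fastforce simp: D_def V_def)+
    ultimately show ?case by blast
  qed
qed

text \<open>Nothing makes the sets \<open>G n\<close>, on which the time lag is small, measurable. Their size is therefore
  expressed through their measurable supersets. If some supersets \<open>V n\<close> all had measure less than
  \<open>1 - \<tau>\<close>, then the increasing intersections of the \<open>V i\<close> with \<open>i \<ge> n\<close>, and hence their union, which
  contains \<open>K\<close>, would have measure at most \<open>1 - \<tau>\<close>.\<close>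

lemma exhaustion_outer_measure:
  assumes "prob_space M" and "incseq G" and "K \<subseteq> (\<Union>n. G n)" and "emeasure M K = 1" and "\<tau> > 0"
  shows "\<exists>n. \<forall>V\<in>sets M. G n \<subseteq> V \<longrightarrow> measure M V \<ge> 1 - \<tau>"
proof (rule ccontr)
  interpret prob_space M by fact
  assume "\<not> (\<exists>n. \<forall>V\<in>sets M. G n \<subseteq> V \<longrightarrow> measure M V \<ge> 1 - \<tau>)"
  then obtain V where V: "\<And>n. V n \<in> sets M" "\<And>n. G n \<subseteq> V n" "\<And>n. measure M (V n) < 1 - \<tau>"
    by (metis not_le)
  define W where "W n = (\<Inter>i\<in>{n..}. V i)" for n
  have W: "W n \<in> sets M" for n unfolding W_def using V(1) by (intro sets.countable_INT') auto
  have "incseq W" by (force simp: incseq_def W_def)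
  have GW: "G n \<subseteq> W n" for n
    using V(2) incseqD[OF assms(2)] by (fastforce simp: W_def)
  have "measure M (W n) \<le> 1 - \<tau>" for n
  proof -
    have "measure M (W n) \<le> measure M (V n)" using V(1) by (intro finite_measure_mono) (auto simp: W_def)
    then show ?thesis using V(3)[of n] by linarith
  qed
  moreover have "(\<lambda>n. measure M (W n)) \<longlonglongrightarrow> measure M (\<Union>n. W n)"
    using W \<open>incseq W\<close> by (intro finite_Lim_measure_incseq) auto
  ultimately have "measure M (\<Union>n. W n) \<le> 1 - \<tau>"
    by (intro LIMSEQ_le_const2) auto
  moreover have "measure M K \<le> measure M (\<Union>n. W n)"
  proof (rule finite_measure_mono)
    show "K \<subseteq> (\<Union>n. W n)" using assms(3) GW by blast
    show "(\<Union>n. W n) \<in> sets M" using W by auto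
  qed
  moreover have "measure M K = 1" using assms(4) by (simp add: measure_def)
  ultimately show False using \<open>\<tau> > 0\<close> by linarith
qed

lemma compact_disjoint_separated:
  fixes S S' :: "'a::metric_space set"
  assumes "compact S" "compact S'" "S \<inter> S' = {}"
  obtains d where "d > 0" "\<And>x y. x \<in> S \<Longrightarrow> y \<in> S' \<Longrightarrow> d \<le> dist x y"
proof (cases "S \<times> S' = {}")
  case True
  then show ?thesis using that[of 1] by auto
next
  case False
  have "continuous_on (S \<times> S') (\<lambda>p. dist (fst p) (snd p))" by (intro continuous_intros)
  then obtain p where p: "p \<in> S \<times> S'" "\<And>q. q \<in> S \<times> S' \<Longrightarrow> dist (fst p) (snd p) \<le> dist (fst q) (snd q)"
    using continuous_attains_inf[OF compact_Times[OF assms(1,2)] False] by blast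
  have "fst p \<noteq> snd p" using p(1) assms(3) by auto
  then show ?thesis using that[of "dist (fst p) (snd p)"] p(2)[of "(_, _)"] by auto
qed

text \<open>Each cell contains a closed set of almost the same measure, and finitely many disjoint compact sets
  lie at positive distance from each other. On the union \<open>Y\<close> of these sets, proximity thus determines
  the cell, however irregular the cells are.\<close>

lemma separated_core:
  fixes \<mu> :: "'a::metric_space measure"
  assumes comp: "compact (UNIV :: 'a set)" and \<mu>: "prob_space \<mu>" "sets \<mu> = sets borel"
    and P: "finite P" "partition_on UNIV P" "P \<subseteq> sets borel" and e: "e > 0"
  obtains Y d where "Y \<in> sets borel" "d > 0" "measure \<mu> (- Y) \<le> e"
    "\<And>x y. x \<in> Y \<Longrightarrow> y \<in> Y \<Longrightarrow> dist x y < d \<Longrightarrow> cell P x = cell P y"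
proof -
  interpret prob_space \<mu> by fact
  have "P \<noteq> {}" using partition_onD1[OF P(2)] by auto
  then have k: "card P > 0" using P(1) by (simp add: card_gt_0_iff)
  have "\<forall>A\<in>P. \<exists>C. closed C \<and> C \<subseteq> A \<and> measure \<mu> (A - C) \<le> e / card P"
  proof
    fix A assume "A \<in> P"
    then have A: "A \<in> sets borel" using P(3) by auto
    have ek: "e / real (card P) > 0" using e k by simp
    obtain C U where CU: "closed C" "open U" "C \<subseteq> A" "A \<subseteq> U" "measure \<mu> (U - C) < e / card P"
      using borel_between_closed_open[OF finite_measure_axioms \<mu>(2) A ek] by blast
    have "measure \<mu> (A - C) \<le> measure \<mu> (U - C)"
      using CU \<mu>(2) by (intro finite_measure_mono) auto
    then show "\<exists>C. closed C \<and> C \<subseteq> A \<and> measure \<mu> (A - C) \<le> e / card P"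
      using CU by (intro exI[of _ C]) auto
  qed
  then obtain C where C: "\<And>A. A \<in> P \<Longrightarrow> closed (C A)" "\<And>A. A \<in> P \<Longrightarrow> C A \<subseteq> A"
    "\<And>A. A \<in> P \<Longrightarrow> measure \<mu> (A - C A) \<le> e / card P" by metis
  define Y where "Y = (\<Union>A\<in>P. C A)"
  have Y: "Y \<in> sets borel" unfolding Y_def using C(1) P(1) by (intro sets.finite_UN) auto
  have AC: "A - C A \<in> sets \<mu>" if "A \<in> P" for A using that C(1) P(3) \<mu>(2) by auto
  have "- Y \<subseteq> (\<Union>A\<in>P. A - C A)"
    using partition_onD1[OF P(2)] by (auto simp: Y_def)
  then have "measure \<mu> (- Y) \<le> measure \<mu> (\<Union>A\<in>P. A - C A)"
    using AC P(1) by (intro finite_measure_mono) auto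
  also have "\<dots> \<le> (\<Sum>A\<in>P. measure \<mu> (A - C A))"
    using AC P(1) by (intro finite_measure_subadditive_finite) auto
  also have "\<dots> \<le> (\<Sum>A\<in>P. e / card P)" using C(3) by (rule sum_mono)
  finally have mY: "measure \<mu> (- Y) \<le> e" using k by simp
  have "\<forall>AA'\<in>P \<times> P. eventually (\<lambda>d. \<forall>x\<in>C (fst AA'). \<forall>y\<in>C (snd AA'). dist x y < d \<longrightarrow> fst AA' = snd AA') (at_right 0)"
  proof
    fix AA' assume "AA' \<in> P \<times> P"
    then obtain A A' where AA': "AA' = (A, A')" "A \<in> P" "A' \<in> P" by auto
    have "\<exists>d>0. \<forall>x\<in>C A. \<forall>y\<in>C A'. dist x y < d \<longrightarrow> A = A'"
    proof (cases "A = A'")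
      case False
      then have "A \<inter> A' = {}" using AA' disjointD[OF partition_onD2[OF P(2)]] by blast
      then have "C A \<inter> C A' = {}" using C(2) AA' by blast
      moreover have "compact (C A)" using comp C(1)[OF AA'(2)] closed_Int_compact by fastforce
      moreover have "compact (C A')" using comp C(1)[OF AA'(3)] closed_Int_compact by fastforce
      ultimately obtain d where "d > 0" "\<And>x y. x \<in> C A \<Longrightarrow> y \<in> C A' \<Longrightarrow> d \<le> dist x y"
        using compact_disjoint_separated by metis
      then show ?thesis by (intro exI[of _ d]) force
    qed (auto intro: exI[of _ 1])
    then obtain d where "d > 0" "\<forall>x\<in>C A. \<forall>y\<in>C A'. dist x y < d \<longrightarrow> A = A'" by blast
    then show "eventually (\<lambda>d. \<forall>x\<in>C (fst AA'). \<forall>y\<in>C (snd AA'). dist x y < d \<longrightarrow> fst AA' = snd AA') (at_right 0)"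
    proof (intro eventually_at_rightI[of 0 d] ballI impI)
      fix e x y assume "e \<in> {0<..<d}" "x \<in> C (fst AA')" "y \<in> C (snd AA')" "dist x y < e"
      then show "fst AA' = snd AA'"
        using \<open>\<forall>x\<in>C A. \<forall>y\<in>C A'. dist x y < d \<longrightarrow> A = A'\<close> unfolding AA'(1) by force
    qed
  qed
  then have "eventually (\<lambda>d. \<forall>AA'\<in>P \<times> P. \<forall>x\<in>C (fst AA'). \<forall>y\<in>C (snd AA'). dist x y < d \<longrightarrow> fst AA' = snd AA') (at_right 0)"
    using P(1) by (intro eventually_ball_finite) auto
  then have "eventually (\<lambda>d. 0 < d \<and> (\<forall>AA'\<in>P \<times> P. \<forall>x\<in>C (fst AA'). \<forall>y\<in>C (snd AA'). dist x y < d \<longrightarrow> fst AA' = snd AA')) (at_right (0::real))"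
    by (intro eventually_conj eventually_at_right_less)
  then obtain d where "d > 0" and
    d: "\<forall>AA'\<in>P \<times> P. \<forall>x\<in>C (fst AA'). \<forall>y\<in>C (snd AA'). dist x y < d \<longrightarrow> fst AA' = snd AA'"
    using eventually_happens trivial_limit_at_right_real by blast
  have "cell P x = cell P y" if xy: "x \<in> Y" "y \<in> Y" "dist x y < d" for x y
  proof -
    obtain A A' where A: "A \<in> P" "x \<in> C A" "A' \<in> P" "y \<in> C A'" using xy by (auto simp: Y_def)
    then have "A = A'" using d[rule_format, of "(A, A')" x y] xy(3) by simp
    moreover have "x \<in> A" "y \<in> A'" using A C(2) by auto
    ultimately show ?thesis using cell_eqI[OF P(2)] A by metis
  qed
  then show ?thesis using that Y \<open>d > 0\<close> mY by blast
qed

text \<open>The expected number of visits to the complement of \<open>Y\<close> is at most \<open>n \<tau>\<^sup>2\<close>, so Markov's inequality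
  applies with the threshold \<open>n \<tau>\<close>.\<close>

lemma rare_visits:
  fixes T :: "'a::topological_space \<Rightarrow> 'a"
  assumes inv: "\<mu> \<in> invariant_measures T" and T: "T \<in> borel_measurable borel"
    and Y: "Y \<in> sets borel" "measure \<mu> (- Y) \<le> \<tau> ^ 2" and "\<tau> > 0" and n: "n \<ge> 1"
  defines "Q \<equiv> {x. real (card {i\<in>{..<n}. (T ^^ i) x \<notin> Y}) \<le> \<tau> * real n}"
  shows "Q \<in> sets borel" "measure \<mu> (- Q) \<le> \<tau>"
proof -
  note \<mu> = invariant_measures_D[OF inv]
  interpret prob_space \<mu> by fact
  have mY: "indicator (- Y) \<in> borel_measurable borel" using Y(1) by simp
  have "\<bar>indicator (- Y) x :: real\<bar> \<le> 1" for x by (simp add: indicator_def)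
  note ib = integral_birkhoff_sum[OF inv T mY this, of n]
  have cnt: "birkhoff_sum T (indicator (- Y)) n x = real (card {i\<in>{..<n}. (T ^^ i) x \<notin> Y})" for x
    by (simp add: birkhoff_sum_def indicator_def sum.If_cases Int_def conj_commute)
  have Q: "Q = {x \<in> space borel. birkhoff_sum T (indicator (- Y)) n x \<le> \<tau> * real n}"
    by (auto simp: Q_def cnt)
  show "Q \<in> sets borel" unfolding Q using ib(1) by (intro borel_measurable_le) auto
  then have Qm: "- Q \<in> sets \<mu>" using \<mu>(2) by auto
  have "(\<integral>x. \<tau> * real n * indicator (- Q) x \<partial>\<mu>) \<le> integral\<^sup>L \<mu> (birkhoff_sum T (indicator (- Y)) n)"
  proof (rule integral_mono)
    fix x
    show "\<tau> * real n * indicator (- Q) x \<le> birkhoff_sum T (indicator (- Y)) n x"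
      unfolding cnt by (auto simp: indicator_def Q_def)
  qed (use Qm ib(2) in \<open>auto simp: emeasure_eq_measure\<close>)
  also have "\<dots> = real n * measure \<mu> (- Y)"
    using ib(3) Y(1) \<mu>(2) by simp
  also have "\<dots> \<le> real n * \<tau> ^ 2" using Y(2) by (intro mult_left_mono) auto
  finally have "\<tau> * real n * measure \<mu> (- Q) \<le> \<tau> * real n * \<tau>"
    using Qm by (simp add: power2_eq_square mult_ac)
  then show "measure \<mu> (- Q) \<le> \<tau>" using \<open>\<tau> > 0\<close> n by simp
qed

section \<open>Orbit segments that carry the entropy\<close>

text \<open>Give each word the weight \<open>l\<close> to the number of places where it differs from \<open>v\<close>. The total weight of
  all words factorises over the places, and a word with at most \<open>r\<close> differences weighs at least
  \<open>l ^ r\<close>.\<close>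

lemma card_hamming_ball_le:
  fixes l :: real
  assumes "finite P" and "0 < l" "l \<le> 1"
  shows "real (card {w \<in> {..<n} \<rightarrow>\<^sub>E P. card {i\<in>{..<n}. w i \<noteq> v i} \<le> r}) * l ^ r \<le> (1 + real (card P) * l) ^ n"
proof -
  let ?h = "\<lambda>i a. if a = v i then 1 else l"
  let ?B = "{w \<in> {..<n} \<rightarrow>\<^sub>E P. card {i\<in>{..<n}. w i \<noteq> v i} \<le> r}"
  have fin: "finite ({..<n} \<rightarrow>\<^sub>E P)" using assms(1) by (intro finite_PiE) auto
  have wt: "(\<Prod>i<n. ?h i (w i)) = l ^ card {i\<in>{..<n}. w i \<noteq> v i}" for w
  proof -
    have "(\<Prod>i<n. ?h i (w i)) = (\<Prod>i<n. if w i \<noteq> v i then l else 1)"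
      by (intro prod.cong) auto
    also have "\<dots> = (\<Prod>i\<in>{i\<in>{..<n}. w i \<noteq> v i}. l)"
      by (subst prod.inter_filter) auto
    finally show ?thesis by simp
  qed
  have "real (card ?B) * l ^ r = (\<Sum>w\<in>?B. l ^ r)" by simp
  also have "\<dots> \<le> (\<Sum>w\<in>?B. \<Prod>i<n. ?h i (w i))"
    unfolding wt using assms by (intro sum_mono power_decreasing) auto
  also have "\<dots> \<le> (\<Sum>w\<in>{..<n} \<rightarrow>\<^sub>E P. \<Prod>i<n. ?h i (w i))"
    using assms(2) by (intro sum_mono2[OF fin] prod_nonneg) auto
  also have "\<dots> = (\<Prod>i<n. \<Sum>a\<in>P. ?h i a)"
    using assms(1) by (intro prod_sum_PiE[symmetric]) auto
  also have "\<dots> \<le> (\<Prod>i<n. 1 + real (card P) * l)"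
  proof (intro prod_mono conjI)
    fix i
    show "0 \<le> (\<Sum>a\<in>P. ?h i a)" using assms by (intro sum_nonneg) auto
    have "(\<Sum>a\<in>P. ?h i a) \<le> (\<Sum>a\<in>P. (if a = v i then 1 else 0) + l)"
      using assms by (intro sum_mono) auto
    also have "\<dots> \<le> 1 + real (card P) * l"
      using assms(1) by (simp add: sum.distrib)
    finally show "(\<Sum>a\<in>P. ?h i a) \<le> 1 + real (card P) * l" .
  qed
  finally show ?thesis by simp
qed

text \<open>The two conditions split the exponent \<open>g\<close> evenly: \<open>l\<close> is small enough for the total weight, and then
  \<open>\<tau>\<close> is small enough for the weight of a single word.\<close>

lemma card_words_near_le:
  fixes g \<tau> l :: real
  assumes "finite P" and l: "0 < l" "l \<le> 1" "real (card P) * l \<le> g / 2"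
    and \<tau>: "2 * \<tau> * (- ln l) \<le> g / 2" "\<tau> \<ge> 0"
  shows "real (card {w \<in> {..<n} \<rightarrow>\<^sub>E P. real (card {i\<in>{..<n}. w i \<noteq> v i}) \<le> 2 * \<tau> * real n})
    \<le> exp (real n * g)"
proof -
  define r where "r = nat \<lfloor>2 * \<tau> * real n\<rfloor>"
  have r_iff: "real j \<le> 2 * \<tau> * real n \<longleftrightarrow> j \<le> r" for j
    unfolding r_def using \<tau>(2) by (simp add: le_nat_floor nat_le_eq_zle le_nat_iff le_floor_iff)
  have r: "real r \<le> 2 * \<tau> * real n" using r_iff[of r] by simp
  let ?N = "real (card {w \<in> {..<n} \<rightarrow>\<^sub>E P. card {i\<in>{..<n}. w i \<noteq> v i} \<le> r})"
  have "?N * l ^ r \<le> (1 + real (card P) * l) ^ n"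
    by (rule card_hamming_ball_le[OF assms(1) l(1,2)])
  also have "\<dots> \<le> exp (real (card P) * l) ^ n"
    using l(1) by (intro power_mono exp_ge_add_one_self) auto
  also have "\<dots> = exp (real n * (real (card P) * l))" by (simp add: exp_of_nat_mult)
  also have "\<dots> \<le> exp (real n * (g / 2))" using l(3) by (intro exp_le_cancel_iff[THEN iffD2] mult_left_mono) auto
  finally have 1: "?N * l ^ r \<le> exp (real n * (g / 2))" .
  have "l ^ r = exp (real r * ln l)" using l(1) by (simp add: exp_of_nat_mult)
  moreover have "real r * (- ln l) \<le> (2 * \<tau> * real n) * (- ln l)"
    using r l by (intro mult_right_mono) auto
  moreover have "(2 * \<tau> * real n) * (- ln l) \<le> real n * (g / 2)"
    using mult_left_mono[OF \<tau>(1), of "real n"] by (simp add: mult_ac)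
  ultimately have "exp (- (real n * (g / 2))) \<le> l ^ r" by simp
  then have "?N * exp (- (real n * (g / 2))) \<le> ?N * l ^ r" by (rule mult_left_mono) simp
  with 1 have "?N * exp (- (real n * (g / 2))) \<le> exp (real n * (g / 2))" by linarith
  then have "?N * exp (- (real n * (g / 2))) * exp (real n * (g / 2)) \<le> exp (real n * (g / 2)) * exp (real n * (g / 2))"
    by (rule mult_right_mono) simp
  moreover have "exp (- (real n * (g / 2))) * exp (real n * (g / 2)) = 1" by (simp flip: exp_add)
  moreover have "exp (real n * (g / 2)) * exp (real n * (g / 2)) = exp (real n * g)" by (simp flip: exp_add)
  ultimately have "?N \<le> exp (real n * g)" by (simp only: mult.assoc mult_1_right)
  then show ?thesis by (simp only: r_iff)
qed

text \<open>The points are sorted by itinerary \<open>w\<close> and by the levels \<open>u\<close>, \<open>v\<close>, which are the Birkhoff sums of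
  \<open>\<phi>\<close> and \<open>\<psi>\<close> rounded to multiples of \<open>n g\<close>. If all pairs \<open>(u, v)\<close> were realised in \<open>G\<close> by few
  itineraries, a word could be given a weight of order \<open>exp (n (v g - c))\<close> whenever a point of \<open>G\<close>
  realises it together with the level \<open>v\<close>. Entropy plus integral would then be at most
  \<open>n (c + 3 g)\<close>, whereas it is at least \<open>n (c + 4 g)\<close>.\<close>

lemma entropy_blocks_at:
  fixes T :: "'a::metric_space \<Rightarrow> 'a" and \<phi> \<psi> :: "'a \<Rightarrow> real"
  assumes inv: "\<mu> \<in> invariant_measures T" and T: "continuous_on UNIV T"
    and P: "finite P" "partition_on UNIV P" "P \<subseteq> sets borel"
    and \<phi>: "continuous_on UNIV \<phi>" "\<And>x. \<bar>\<phi> x\<bar> \<le> B"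
    and \<psi>: "continuous_on UNIV \<psi>" "\<And>x. \<bar>\<psi> x\<bar> \<le> B"
    and g: "g > 0" and n: "n \<ge> 1"
    and H: "partition_entropy \<mu> (fibers (itinerary T P n)) \<ge> real n * (h - g)"
    and G: "\<And>V. V \<in> sets borel \<Longrightarrow> G \<subseteq> V \<Longrightarrow> measure \<mu> V \<ge> 1 - \<sigma>"
    and \<sigma>: "\<sigma> * (ln (real (card P)) + B + \<bar>h + integral\<^sup>L \<mu> \<psi> - 5 * g\<bar>) \<le> g"
    and R: "B / g + 1 \<le> real_of_int R" "ln (2 * (2 * real_of_int R + 1)\<^sup>2) \<le> g * real n"
  shows "\<exists>E a s. finite E \<and> E \<subseteq> G \<and> inj_on (itinerary T P n) E \<and>
    (\<forall>x\<in>E. \<bar>birkhoff_sum T \<phi> n x - real n * a\<bar> \<le> real n * g \<and>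
           \<bar>birkhoff_sum T \<psi> n x - real n * s\<bar> \<le> real n * g) \<and>
    real (card E) \<ge> exp (real n * (h + integral\<^sup>L \<mu> \<psi> - s - 5 * g))"
proof -
  note \<mu> = invariant_measures_D[OF inv]
  interpret prob_space \<mu> by fact
  have Tm: "T \<in> borel_measurable borel" using T by (rule borel_measurable_continuous_onI)
  have \<phi>m: "\<phi> \<in> borel_measurable borel" by (rule borel_measurable_continuous_onI[OF \<phi>(1)])
  have \<psi>m: "\<psi> \<in> borel_measurable borel" by (rule borel_measurable_continuous_onI[OF \<psi>(1)])
  note ib\<phi> = integral_birkhoff_sum[OF inv Tm \<phi>m \<phi>(2), of n]
  note ib\<psi> = integral_birkhoff_sum[OF inv Tm \<psi>m \<psi>(2), of n]
  have B0: "B \<ge> 0" using \<phi>(2)[of undefined] by linarith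
  have ng: "real n * g > 0" using n g by simp
  define c where "c = h + integral\<^sup>L \<mu> \<psi> - 5 * g"
  define lev where "lev F x = \<lfloor>birkhoff_sum T F n x / (real n * g)\<rfloor>" for F x
  define L where "L = {- R..R}"
  define it where "it = itinerary T P n"
  define W where "W = ({..<n} \<rightarrow>\<^sub>E P)"
  define key where "key x = (it x, lev \<phi> x, lev \<psi> x)" for x
  define R2 where "R2 = (2 * real_of_int R + 1)\<^sup>2"
  have R0: "R \<ge> 1" using R(1) B0 g by (smt (verit) divide_nonneg_pos of_int_less_1_iff)
  have cardL: "real (card L) = 2 * real_of_int R + 1" using R0 by (simp add: L_def)
  have L0: "real (card L) > 0" using R0 by (simp add: cardL)
  have R2_card: "R2 = real (card L) * real (card L)" by (simp add: R2_def cardL power2_eq_square)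
  have R2: "R2 \<ge> 1" unfolding R2_def by (rule one_le_power) (use R0 in simp)
  have finW: "finite W" unfolding W_def using P(1) by (intro finite_PiE) auto
  have finL: "finite L" by (simp add: L_def)
  have itW: "it x \<in> W" for x using itinerary_PiE[OF P(2), of T n] unfolding it_def W_def by blast
  have "P \<noteq> {}" using partition_onD1[OF P(2)] by auto
  then have k: "real (card P) \<ge> 1" using P(1) by (simp add: Suc_le_eq card_gt_0_iff)
  then have kp: "real (card P) > 0" by simp
  have cardW: "real (card W) = real (card P) ^ n" by (simp add: W_def card_PiE)
  have lev_bounds: "real n * g * real_of_int (lev F x) \<le> birkhoff_sum T F n x"
    "birkhoff_sum T F n x \<le> real n * g * (real_of_int (lev F x) + 1)" for F x
  proof -
    let ?y = "birkhoff_sum T F n x / (real n * g)"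
    have S: "real n * g * ?y = birkhoff_sum T F n x" using n g by simp
    have "real_of_int (lev F x) \<le> ?y" unfolding lev_def by (rule of_int_floor_le)
    from mult_left_mono[OF this less_imp_le[OF ng]]
    show "real n * g * real_of_int (lev F x) \<le> birkhoff_sum T F n x" unfolding S .
    have "?y \<le> real_of_int (lev F x) + 1" unfolding lev_def by (rule real_of_int_floor_add_one_ge)
    from mult_left_mono[OF this less_imp_le[OF ng]]
    show "birkhoff_sum T F n x \<le> real n * g * (real_of_int (lev F x) + 1)" unfolding S .
  qed
  have levL: "lev F x \<in> L" if F: "\<And>x. \<bar>F x\<bar> \<le> B" for F x
  proof -
    have "\<bar>birkhoff_sum T F n x\<bar> / (real n * g) \<le> real n * B / (real n * g)"
      by (rule divide_right_mono[OF birkhoff_sum_abs_le[of F B T n x, OF F] less_imp_le[OF ng]])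
    also have "\<dots> = B / g" using n by simp
    finally have "\<bar>birkhoff_sum T F n x / (real n * g)\<bar> \<le> B / g" by (simp only: abs_divide abs_of_pos[OF ng])
    with R(1) have "real_of_int (- R) \<le> birkhoff_sum T F n x / (real n * g)"
      "birkhoff_sum T F n x / (real n * g) < real_of_int R + 1" unfolding abs_le_iff of_int_minus by linarith+
    then show ?thesis by (simp add: lev_def L_def le_floor_iff floor_le_iff)
  qed
  have key_meas: "key -` {(w, u, v)} \<in> sets borel" for w u v
  proof -
    have lev_sets: "lev F -` {j} \<inter> space borel \<in> sets borel"
      if "birkhoff_sum T F n \<in> borel_measurable borel" for F j
    proof (rule measurable_sets)
      have "(\<lambda>x. birkhoff_sum T F n x / (real n * g)) \<in> borel_measurable borel"
        using that by (rule borel_measurable_divide) (rule borel_measurable_const)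
      from measurable_compose[OF this measurable_real_floor]
      show "lev F \<in> measurable borel (count_space UNIV)" by (simp only: lev_def[abs_def])
    qed simp
    note lev_sets[OF ib\<phi>(1), of u] lev_sets[OF ib\<psi>(1), of v]
    moreover have "it -` {w} \<in> sets borel" unfolding it_def by (rule itinerary_measurable[OF P(2,3) T])
    moreover have "key -` {(w, u, v)} = it -` {w} \<inter> (lev \<phi> -` {u} \<inter> lev \<psi> -` {v})" by (auto simp: key_def)
    ultimately show ?thesis by simp
  qed
  define Gd where "Gd = key ` G"
  have GdW: "Gd \<subseteq> W \<times> L \<times> L" using itW levL \<phi>(2) \<psi>(2) by (auto simp: Gd_def key_def)
  then have finGd: "finite Gd" using finW finL by (meson finite_SigmaI finite_subset)
  define good where "good = (\<Union>wuv\<in>Gd. key -` {wuv})"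
  have good: "good \<in> sets borel" unfolding good_def
  proof (rule sets.finite_UN[OF finGd])
    show "key -` {wuv} \<in> sets borel" for wuv by (cases wuv) (simp only: key_meas)
  qed
  have good_iff: "x \<in> good \<longleftrightarrow> key x \<in> Gd" for x by (auto simp: good_def)
  have "measure \<mu> good \<ge> 1 - \<sigma>" using good by (rule G) (auto simp: good_iff Gd_def)
  then have bad: "measure \<mu> (- good) \<le> \<sigma>"
    using prob_compl[of good] good \<mu>(2,3) by (simp add: Compl_eq_Diff_UNIV[symmetric])
  define N where "N u v = {w. (w, u, v) \<in> Gd}" for u v
  have finN: "finite (N u v)" "N u v \<subseteq> W" for u v
  proof -
    show "N u v \<subseteq> W" using GdW by (auto simp: N_def)
    then show "finite (N u v)" using finW by (rule finite_subset)
  qed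
  have "\<exists>u\<in>L. \<exists>v\<in>L. real (card (N u v)) \<ge> exp (real n * (c - real_of_int v * g))"
  proof (rule ccontr)
    assume "\<not> ?thesis"
    then have small: "real (card (N u v)) \<le> exp (real n * (c - real_of_int v * g))"
      if "u \<in> L" "v \<in> L" for u v using that by (meson linear)
    define q where "q v = exp (real n * (real_of_int v * g - c)) / (2 * R2)" for v
    (* The second summand of Q keeps the weight positive, at an exponential price, on words that occur only
       outside G; each of the two summands contributes at most 1/2 to the total weight. *)
    define Q where "Q w = (\<Sum>p\<in>L \<times> L. if w \<in> N (fst p) (snd p) then q (snd p) else 0) + 1 / (2 * real (card P) ^ n)" for w
    have q0: "q v > 0" for v using R2 by (simp add: q_def)
    have Q_sum0: "(\<Sum>p\<in>L \<times> L. if w \<in> N (fst p) (snd p) then q (snd p) else 0) \<ge> 0" for w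
      by (rule sum_nonneg) (simp add: less_imp_le[OF q0])
    have Qpos: "Q w > 0" for w
      unfolding Q_def by (rule add_nonneg_pos[OF Q_sum0]) (use kp in simp)
    have "sum Q W = (\<Sum>p\<in>L \<times> L. \<Sum>w\<in>W. if w \<in> N (fst p) (snd p) then q (snd p) else 0)
        + real (card W) / (2 * real (card P) ^ n)"
      unfolding Q_def sum.distrib by (subst sum.swap) simp
    also have "(\<Sum>p\<in>L \<times> L. \<Sum>w\<in>W. if w \<in> N (fst p) (snd p) then q (snd p) else 0)
        \<le> (\<Sum>p\<in>L \<times> L. 1 / (2 * R2))"
    proof (rule sum_mono)
      fix p assume "p \<in> L \<times> L"
      then have uv: "fst p \<in> L" "snd p \<in> L" by auto
      let ?N = "N (fst p) (snd p)" and ?a = "real n * (c - real_of_int (snd p) * g)"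
      have "(\<Sum>w\<in>W. if w \<in> ?N then q (snd p) else 0) = real (card ?N) * q (snd p)"
        by (simp add: sum.If_cases[OF finW] Int_absorb1[OF finN(2)])
      also have "\<dots> \<le> exp ?a * q (snd p)"
        by (rule mult_right_mono[OF small[OF uv] less_imp_le[OF q0]])
      also have "\<dots> = 1 / (2 * R2)"
      proof -
        have "real n * (real_of_int (snd p) * g - c) = - ?a" by (simp add: algebra_simps)
        then show ?thesis by (simp add: q_def exp_minus)
      qed
      finally show "(\<Sum>w\<in>W. if w \<in> ?N then q (snd p) else 0) \<le> 1 / (2 * R2)" .
    qed
    also have "(\<Sum>p\<in>L \<times> L. 1 / (2 * R2)) = 1 / 2"
      using L0 by (simp add: card_cartesian_product R2_card)
    also have "real (card W) / (2 * real (card P) ^ n) = 1 / 2" using kp by (simp add: cardW)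
    finally have Q1: "sum Q W \<le> 1" by simp
    have pw: "birkhoff_sum T \<psi> n x - ln (Q (it x)) \<le>
        (ln (2 * R2) + real n * c + real n * g)
        + real n * (ln (real (card P)) + B + \<bar>c\<bar>) * indicator (- good) x" for x
    proof (cases "x \<in> good")
      case True
      let ?u = "lev \<phi> x" and ?v = "lev \<psi> x"
      have uv: "(?u, ?v) \<in> L \<times> L" "it x \<in> N ?u ?v"
        using True levL[of \<phi> x, OF \<phi>(2)] levL[of \<psi> x, OF \<psi>(2)]
        by (simp_all add: good_iff key_def N_def)
      let ?t = "\<lambda>p. if it x \<in> N (fst p) (snd p) then q (snd p) else 0"
      have "?t (?u, ?v) \<le> sum ?t (L \<times> L)"
        by (rule member_le_sum[OF uv(1)]) (use finL in \<open>auto simp: less_imp_le[OF q0]\<close>)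
      then have "q ?v \<le> sum ?t (L \<times> L)" using uv by simp
      also have "\<dots> \<le> Q (it x)" using kp by (simp add: Q_def)
      finally have "ln (q ?v) \<le> ln (Q (it x))" using q0 Qpos by simp
      moreover have "ln (q ?v) = real n * (real_of_int ?v * g - c) - ln (2 * R2)"
        using R2 by (simp add: q_def ln_div)
      moreover have "birkhoff_sum T \<psi> n x \<le> real n * g * (real_of_int ?v + 1)" by (rule lev_bounds)
      ultimately show ?thesis using True by (simp add: algebra_simps)
    next
      case False
      have "1 / (2 * real (card P) ^ n) \<le> Q (it x)" using Q_sum0 by (simp add: Q_def)
      then have "ln (1 / (2 * real (card P) ^ n)) \<le> ln (Q (it x))" using kp Qpos by (subst ln_le_cancel_iff) auto
      moreover have "ln (1 / (2 * real (card P) ^ n)) = - ln 2 - real n * ln (real (card P))"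
        using kp by (simp add: ln_div ln_mult ln_realpow)
      moreover have "birkhoff_sum T \<psi> n x \<le> real n * B"
        using birkhoff_sum_abs_le[of \<psi> B T n x, OF \<psi>(2)] by linarith
      moreover have "ln 2 \<le> ln (2 * R2)" using R2 by simp
      moreover have "real n * (c + \<bar>c\<bar>) \<ge> 0" by (rule mult_nonneg_nonneg) auto
      moreover have "real n * g \<ge> 0" using ng by simp
      ultimately show ?thesis using False by (simp add: algebra_simps)
    qed
    have "partition_entropy \<mu> (fibers it) + integral\<^sup>L \<mu> (birkhoff_sum T \<psi> n)
        \<le> (ln (2 * R2) + real n * c + real n * g)
         + real n * (ln (real (card P)) + B + \<bar>c\<bar>) * measure \<mu> (- good)"
    proof (rule entropy_plus_integral_le[where Q = Q and W = W, OF \<mu>(1,3) finW])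
      show "range it \<subseteq> W" using itW by auto
      show "it -` {b} \<in> events" for b
        unfolding it_def \<mu>(2) by (rule itinerary_measurable[OF P(2,3) T])
      show "- good \<in> events" using good \<mu>(2) by auto
    qed (rule Qpos Q1 ib\<psi>(2) pw)+
    also have "\<dots> \<le> (ln (2 * R2) + real n * c + real n * g)
         + real n * (ln (real (card P)) + B + \<bar>c\<bar>) * \<sigma>"
      using bad k B0 by (intro add_left_mono mult_left_mono) auto
    also have "\<dots> = (ln (2 * R2) + real n * c + real n * g)
         + real n * (\<sigma> * (ln (real (card P)) + B + \<bar>c\<bar>))" by simp
    also have "\<dots> \<le> (g * real n + real n * c + real n * g) + real n * g"
      using R(2) \<sigma> by (intro add_mono mult_left_mono) (auto simp: R2_def c_def)
    finally have "real n * (h - g) + real n * integral\<^sup>L \<mu> \<psi> \<le> real n * (c + 3 * g)"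
      using H ib\<psi>(3) by (simp add: it_def algebra_simps)
    then have "h - g + integral\<^sup>L \<mu> \<psi> \<le> c + 3 * g"
      using n by (simp flip: distrib_left)
    then show False using g by (simp add: c_def)
  qed
  then obtain u v where uv: "real (card (N u v)) \<ge> exp (real n * (c - real_of_int v * g))" by blast
  have "\<forall>w\<in>N u v. \<exists>x. x \<in> G \<and> key x = (w, u, v)" by (auto simp: N_def Gd_def)
  then obtain rep where rep: "\<And>w. w \<in> N u v \<Longrightarrow> rep w \<in> G" "\<And>w. w \<in> N u v \<Longrightarrow> key (rep w) = (w, u, v)"
    by metis
  define E where "E = rep ` N u v"
  have inj: "inj_on rep (N u v)" by (rule inj_on_inverseI[of _ "fst \<circ> key"]) (simp add: rep)
  have "inj_on it E" using rep(2) by (fastforce simp: E_def inj_on_def key_def)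
  moreover have "\<bar>birkhoff_sum T \<phi> n x - real n * (g * real_of_int u)\<bar> \<le> real n * g \<and>
        \<bar>birkhoff_sum T \<psi> n x - real n * (g * real_of_int v)\<bar> \<le> real n * g" if "x \<in> E" for x
  proof -
    have "lev \<phi> x = u" "lev \<psi> x = v" using that rep(2) by (auto simp: E_def key_def)
    then show ?thesis
      using lev_bounds[of \<phi> x] lev_bounds[of \<psi> x] by (simp add: algebra_simps abs_le_iff)
  qed
  moreover have "real (card E) \<ge> exp (real n * (h + integral\<^sup>L \<mu> \<psi> - g * real_of_int v - 5 * g))"
    using uv card_image[OF inj] by (simp add: E_def c_def algebra_simps)
  moreover have "finite E" "E \<subseteq> G" using finN rep(1) by (auto simp: E_def)
  ultimately show ?thesis unfolding it_def by blast
qed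

text \<open>Lemma \<open>entropy_blocks_at\<close> is applied inside the set of points that rarely leave the core of \<open>P\<close>. Two such
  points that stay close for time \<open>n\<close> have itineraries that differ only when one of them is outside the
  core, hence at most at \<open>2 \<tau> n\<close> times.\<close>

lemma entropy_blocks:
  fixes T :: "'a::metric_space \<Rightarrow> 'a" and \<phi> \<psi> :: "'a \<Rightarrow> real"
  assumes comp: "compact (UNIV :: 'a set)" and inv: "\<mu> \<in> invariant_measures T" and T: "continuous_on UNIV T"
    and P: "finite P" "partition_on UNIV P" "P \<subseteq> sets borel"
    and \<phi>: "continuous_on UNIV \<phi>" "\<And>x. \<bar>\<phi> x\<bar> \<le> B"
    and \<psi>: "continuous_on UNIV \<psi>" "\<And>x. \<bar>\<psi> x\<bar> \<le> B"
    and g: "g > 0"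
  shows "\<exists>\<tau>>0. \<exists>d>0. \<exists>N. \<forall>n\<ge>N. \<forall>G. (\<forall>V\<in>sets borel. G \<subseteq> V \<longrightarrow> measure \<mu> V \<ge> 1 - \<tau>) \<longrightarrow>
    (\<exists>E a s. finite E \<and> E \<subseteq> G \<and>
      (\<forall>x\<in>E. \<bar>birkhoff_sum T \<phi> n x - real n * a\<bar> \<le> real n * g \<and>
             \<bar>birkhoff_sum T \<psi> n x - real n * s\<bar> \<le> real n * g) \<and>
      (\<forall>E'\<subseteq>E. (\<forall>x\<in>E'. \<forall>y\<in>E'. \<forall>i<n. dist ((T ^^ i) x) ((T ^^ i) y) < d)
          \<longrightarrow> real (card E') \<le> exp (real n * g)) \<and>
      real (card E) \<ge> exp (real n * (ks_entropy_partition T \<mu> P + integral\<^sup>L \<mu> \<psi> - s - 5 * g)))"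
proof -
  note \<mu> = invariant_measures_D[OF inv]
  interpret prob_space \<mu> by fact
  have Tm: "T \<in> borel_measurable borel" using T by (rule borel_measurable_continuous_onI)
  define h where "h = ks_entropy_partition T \<mu> P"
  have B0: "B \<ge> 0" using \<phi>(2)[of undefined] by linarith
  have "P \<noteq> {}" using partition_onD1[OF P(2)] by auto
  then have k: "real (card P) \<ge> 1" using P(1) by (simp add: Suc_le_eq card_gt_0_iff)
  define l where "l = min 1 (g / (2 * real (card P)))"
  have l: "0 < l" "l \<le> 1" using g k by (auto simp: l_def)
  have "real (card P) * l \<le> real (card P) * (g / (2 * real (card P)))"
    by (rule mult_left_mono) (simp_all add: l_def)
  then have kl: "real (card P) * l \<le> g / 2" using k by simp
  define C where "C = ln (real (card P)) + B + \<bar>h + integral\<^sup>L \<mu> \<psi> - 5 * g\<bar>"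
  have C: "C \<ge> 0" using k B0 by (simp add: C_def)
  (* Z + 1 makes both requirements on \<tau> hold at once: the Hamming bound needs 2 \<tau> (- ln l) \<le> g / 2, the
     exceptional set of measure 2 \<tau> must contribute at most g. *)
  define Z where "Z = 4 * (- ln l) + 2 * C"
  have lnl: "- ln l \<ge> 0" using l by simp
  have Z: "Z \<ge> 0" using C lnl by (simp add: Z_def)
  define \<tau> where "\<tau> = g / (Z + 1)"
  have \<tau>: "\<tau> > 0" using g Z by (simp add: \<tau>_def)
  have "\<tau> * (Z + 1) = g" using Z by (simp add: \<tau>_def)
  then have "4 * (\<tau> * (- ln l)) + 2 * (\<tau> * C) + \<tau> = g" by (simp add: Z_def algebra_simps)
  moreover have "\<tau> * (- ln l) \<ge> 0" by (rule mult_nonneg_nonneg[OF less_imp_le[OF \<tau>] lnl])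
  moreover have "\<tau> * C \<ge> 0" by (rule mult_nonneg_nonneg[OF less_imp_le[OF \<tau>] C])
  ultimately have \<tau>l: "2 * \<tau> * (- ln l) \<le> g / 2" and \<tau>C: "(2 * \<tau>) * C \<le> g"
    using \<tau> by (simp_all add: algebra_simps)
  have "\<tau>\<^sup>2 > 0" using \<tau> by simp
  from separated_core[OF comp \<mu>(1,2) P this]
  obtain Y d where Y: "Y \<in> sets borel" "d > 0" "measure \<mu> (- Y) \<le> \<tau>\<^sup>2"
    "\<And>x y. x \<in> Y \<Longrightarrow> y \<in> Y \<Longrightarrow> dist x y < d \<Longrightarrow> cell P x = cell P y" by blast
  define R where "R = \<lceil>B / g + 1\<rceil>"
  have R: "B / g + 1 \<le> real_of_int R" by (simp add: R_def)
  let ?a = "\<lambda>n. partition_entropy \<mu> (fibers (itinerary T P n))"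
  have "eventually (\<lambda>n. h - g < ?a n / real n) sequentially"
    using order_tendstoD(1)[OF entropy_rate_LIMSEQ[OF inv T P], of "h - g"] g by (simp add: h_def)
  moreover have "eventually (\<lambda>n. ln (2 * (2 * real_of_int R + 1)\<^sup>2) \<le> g * real n) sequentially"
  proof -
    obtain N where "ln (2 * (2 * real_of_int R + 1)\<^sup>2) / g \<le> real N" using real_arch_simple by blast
    then have "ln (2 * (2 * real_of_int R + 1)\<^sup>2) \<le> g * real n" if "n \<ge> N" for n
    proof -
      have "ln (2 * (2 * real_of_int R + 1)\<^sup>2) / g \<le> real n"
        using \<open>_ \<le> real N\<close> that by linarith
      then show ?thesis using g by (simp add: pos_divide_le_eq mult.commute)
    qed
    then show ?thesis by (auto simp: eventually_sequentially)
  qed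
  moreover have "eventually (\<lambda>n::nat. n \<ge> 1) sequentially" by (rule eventually_ge_at_top)
  ultimately have "eventually (\<lambda>n. real n * (h - g) \<le> ?a n \<and> ln (2 * (2 * real_of_int R + 1)\<^sup>2) \<le> g * real n \<and> n \<ge> 1) sequentially"
  proof eventually_elim
    case (elim n)
    then have "(h - g) * real n \<le> ?a n" by (simp add: pos_less_divide_eq)
    then show ?case using elim by (simp add: mult.commute)
  qed
  then obtain N where N: "\<And>n. n \<ge> N \<Longrightarrow> real n * (h - g) \<le> ?a n \<and> ln (2 * (2 * real_of_int R + 1)\<^sup>2) \<le> g * real n \<and> n \<ge> 1"
    by (auto simp: eventually_sequentially)
  have main: "\<exists>E a s. finite E \<and> E \<subseteq> G \<and>
      (\<forall>x\<in>E. \<bar>birkhoff_sum T \<phi> n x - real n * a\<bar> \<le> real n * g \<and>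
             \<bar>birkhoff_sum T \<psi> n x - real n * s\<bar> \<le> real n * g) \<and>
      (\<forall>E'\<subseteq>E. (\<forall>x\<in>E'. \<forall>y\<in>E'. \<forall>i<n. dist ((T ^^ i) x) ((T ^^ i) y) < d)
          \<longrightarrow> real (card E') \<le> exp (real n * g)) \<and>
      real (card E) \<ge> exp (real n * (h + integral\<^sup>L \<mu> \<psi> - s - 5 * g))"
    if "n \<ge> N" and G: "\<forall>V\<in>sets borel. G \<subseteq> V \<longrightarrow> measure \<mu> V \<ge> 1 - \<tau>" for n G
  proof -
    define Q where "Q = {x. real (card {i\<in>{..<n}. (T ^^ i) x \<notin> Y}) \<le> \<tau> * real n}"
    have n1: "n \<ge> 1" using N that(1) by blast
    have Q: "Q \<in> sets borel" "measure \<mu> (- Q) \<le> \<tau>"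
      unfolding Q_def by (rule rare_visits[OF inv Tm Y(1,3) \<tau> n1])+
    have GQ: "measure \<mu> V \<ge> 1 - 2 * \<tau>" if V: "V \<in> sets borel" "G \<inter> Q \<subseteq> V" for V
    proof -
      have "1 - \<tau> \<le> measure \<mu> (V \<union> - Q)" using V Q(1) by (intro G[rule_format]) auto
      also have "\<dots> \<le> measure \<mu> V + measure \<mu> (- Q)"
        using V Q(1) \<mu>(2) by (intro measure_Un_le) auto
      finally show ?thesis using Q(2) by linarith
    qed
    have H: "real n * (h - g) \<le> ?a n" and lnR: "ln (2 * (2 * real_of_int R + 1)\<^sup>2) \<le> g * real n"
      using N that(1) by blast+
    have "\<exists>E a s. finite E \<and> E \<subseteq> G \<inter> Q \<and> inj_on (itinerary T P n) E \<and>
      (\<forall>x\<in>E. \<bar>birkhoff_sum T \<phi> n x - real n * a\<bar> \<le> real n * g \<and>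
             \<bar>birkhoff_sum T \<psi> n x - real n * s\<bar> \<le> real n * g) \<and>
      real (card E) \<ge> exp (real n * (h + integral\<^sup>L \<mu> \<psi> - s - 5 * g))"
      by (rule entropy_blocks_at[where \<sigma> = "2 * \<tau>",
            OF inv T P \<phi> \<psi> g n1 H _ \<tau>C[unfolded C_def] R lnR]) (rule GQ)
    then obtain E a s where E_all: "finite E \<and> E \<subseteq> G \<inter> Q \<and> inj_on (itinerary T P n) E \<and>
      (\<forall>x\<in>E. \<bar>birkhoff_sum T \<phi> n x - real n * a\<bar> \<le> real n * g \<and>
             \<bar>birkhoff_sum T \<psi> n x - real n * s\<bar> \<le> real n * g) \<and>
      real (card E) \<ge> exp (real n * (h + integral\<^sup>L \<mu> \<psi> - s - 5 * g))"
      by (elim exE)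
    then have E: "finite E" "E \<subseteq> G \<inter> Q" "inj_on (itinerary T P n) E" by simp_all
    have mult: "real (card E') \<le> exp (real n * g)"
      if E': "E' \<subseteq> E" "\<forall>x\<in>E'. \<forall>y\<in>E'. \<forall>i<n. dist ((T ^^ i) x) ((T ^^ i) y) < d" for E'
    proof (cases "E' = {}")
      case False
      then obtain x0 where x0: "x0 \<in> E'" by blast
      let ?it = "itinerary T P n"
      let ?W = "{w \<in> {..<n} \<rightarrow>\<^sub>E P. real (card {i\<in>{..<n}. w i \<noteq> ?it x0 i}) \<le> 2 * \<tau> * real n}"
      have "?it x \<in> ?W" if x: "x \<in> E'" for x
      proof -
        have "{i\<in>{..<n}. ?it x i \<noteq> ?it x0 i}
            \<subseteq> {i\<in>{..<n}. (T ^^ i) x \<notin> Y} \<union> {i\<in>{..<n}. (T ^^ i) x0 \<notin> Y}"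
        proof (rule subsetI, rule ccontr)
          fix i assume i0: "i \<in> {i\<in>{..<n}. ?it x i \<noteq> ?it x0 i}"
            "i \<notin> {i\<in>{..<n}. (T ^^ i) x \<notin> Y} \<union> {i\<in>{..<n}. (T ^^ i) x0 \<notin> Y}"
          then have i: "i < n" "?it x i \<noteq> ?it x0 i" and TY: "(T ^^ i) x \<in> Y" "(T ^^ i) x0 \<in> Y" by auto
          have "cell P ((T ^^ i) x) = cell P ((T ^^ i) x0)"
            using E'(2) x x0 i(1) by (intro Y(4)[OF TY]) blast
          then show False using i by (simp add: itinerary_def)
        qed
        then have "card {i\<in>{..<n}. ?it x i \<noteq> ?it x0 i}
            \<le> card ({i\<in>{..<n}. (T ^^ i) x \<notin> Y} \<union> {i\<in>{..<n}. (T ^^ i) x0 \<notin> Y})"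
          by (intro card_mono) auto
        also have "\<dots> \<le> card {i\<in>{..<n}. (T ^^ i) x \<notin> Y} + card {i\<in>{..<n}. (T ^^ i) x0 \<notin> Y}"
          by (rule card_Un_le)
        finally have "real (card {i\<in>{..<n}. ?it x i \<noteq> ?it x0 i})
            \<le> real (card {i\<in>{..<n}. (T ^^ i) x \<notin> Y}) + real (card {i\<in>{..<n}. (T ^^ i) x0 \<notin> Y})"
          by (simp flip: of_nat_add)
        moreover have "x \<in> Q" "x0 \<in> Q" using x x0 E'(1) E(2) by auto
        ultimately have "real (card {i\<in>{..<n}. ?it x i \<noteq> ?it x0 i}) \<le> 2 * \<tau> * real n"
          unfolding Q_def by simp
        moreover have "?it x \<in> {..<n} \<rightarrow>\<^sub>E P" using itinerary_PiE[OF P(2), of T n] by blast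
        ultimately show ?thesis by blast
      qed
      then have "?it ` E' \<subseteq> ?W" by blast
      moreover have "finite ?W"
      proof (rule finite_subset)
        show "finite ({..<n} \<rightarrow>\<^sub>E P)" using P(1) by (intro finite_PiE) auto
      qed blast
      ultimately have "card (?it ` E') \<le> card ?W" by (intro card_mono)
      moreover have "card (?it ` E') = card E'"
        using inj_on_subset[OF E(3) E'(1)] by (rule card_image)
      ultimately have "real (card E') \<le> real (card ?W)" by simp
      also have "\<dots> \<le> exp (real n * g)"
        by (rule card_words_near_le[OF P(1) l kl \<tau>l less_imp_le[OF \<tau>]])
      finally show ?thesis .
    qed simp
    show ?thesis
    proof (rule exI[of _ E], rule exI[of _ a], rule exI[of _ s], intro conjI allI impI)
      show "finite E" "E \<subseteq> G" using E by auto
    qed (use E_all mult in simp_all)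
  qed
  show ?thesis
    unfolding h_def[symmetric]
    by (intro exI[of _ \<tau>] conjI \<tau> exI[of _ d] Y(2) exI[of _ N] allI impI) (rule main)
qed

section \<open>Oscillation along a sparse set of forced segments\<close>

lemma card_multiples_less:
  assumes "D \<ge> 1"
  shows "D * card {j\<in>{..<N}. D dvd j} \<le> N + D"
proof -
  have "{j\<in>{..<N}. D dvd j} \<subseteq> (\<lambda>t. D * t) ` {..N div D}"
  proof
    fix j assume "j \<in> {j\<in>{..<N}. D dvd j}"
    then obtain t where "j = D * t" "D * t < N" by (auto elim: dvdE)
    then have "t \<le> N div D" using assms by (simp add: less_eq_div_iff_mult_less_eq mult.commute)
    then show "j \<in> (\<lambda>t. D * t) ` {..N div D}" using \<open>j = D * t\<close> by auto
  qed
  then have "card {j\<in>{..<N}. D dvd j} \<le> card ((\<lambda>t. D * t) ` {..N div D})"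
    by (intro card_mono) auto
  also have "\<dots> \<le> card {..N div D}" by (rule card_image_le) simp
  finally have "card {j\<in>{..<N}. D dvd j} \<le> Suc (N div D)" by simp
  then have "D * card {j\<in>{..<N}. D dvd j} \<le> D * Suc (N div D)" by (rule mult_le_mono2)
  also have "\<dots> \<le> N + D" by simp
  finally show ?thesis .
qed

text \<open>Take the multiples of \<open>D\<close> in the intervals between odd powers of \<open>C = 8 D\<close> and the following even
  powers. At the end of such an interval most of \<open>{..<N}\<close> belongs to it, and the frequency is about
  \<open>1/D\<close>; after the following gap it has dropped by the factor \<open>C\<close>.\<close>

lemma oscillating_sparse_set:
  fixes D :: nat
  assumes D: "D \<ge> 1"
  obtains F where "\<And>N. D * card (F \<inter> {..<N}) \<le> N + D"
    and "\<And>M. \<exists>N\<ge>M. N \<ge> 1 \<and> 8 * D * card (F \<inter> {..<N}) \<le> N"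
    and "\<And>M. \<exists>N\<ge>M. N \<ge> 1 \<and> N \<le> 2 * D * card (F \<inter> {..<N})"
proof -
  define C where "C = 8 * D"
  have C: "C \<ge> 8" using D by (simp add: C_def)
  define F where "F = {j. D dvd j \<and> (\<exists>i. C ^ (2 * i + 1) \<le> j \<and> j < C ^ (2 * i + 2))}"
  have pow_ge: "M \<le> C ^ M" for M
    using C less_exp[of M] power_mono[of 2 C M] by linarith
  have upper: "D * card (F \<inter> {..<N}) \<le> N + D" for N
  proof -
    have "card (F \<inter> {..<N}) \<le> card {j\<in>{..<N}. D dvd j}"
      by (intro card_mono) (auto simp: F_def)
    then have "D * card (F \<inter> {..<N}) \<le> D * card {j\<in>{..<N}. D dvd j}" by (rule mult_le_mono2)
    then show ?thesis using card_multiples_less[OF D, of N] by linarith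
  qed
  have sparse: "\<exists>N\<ge>M. N \<ge> 1 \<and> 8 * D * card (F \<inter> {..<N}) \<le> N" for M
  proof (intro exI[of _ "C ^ (2 * M + 1)"] conjI)
    have "M \<le> C ^ M" by (rule pow_ge)
    also have "\<dots> \<le> C ^ (2 * M + 1)" using C by (intro power_increasing) auto
    finally show "M \<le> C ^ (2 * M + 1)" .
    show "1 \<le> C ^ (2 * M + 1)" using C by (intro one_le_power) simp
    have "F \<inter> {..<C ^ (2 * M + 1)} \<subseteq> {..<C ^ (2 * M)}"
    proof
      fix j assume "j \<in> F \<inter> {..<C ^ (2 * M + 1)}"
      then obtain i where i: "C ^ (2 * i + 1) \<le> j" "j < C ^ (2 * i + 2)" "j < C ^ (2 * M + 1)"
        by (auto simp: F_def)
      then have "C ^ (2 * i + 1) < C ^ (2 * M + 1)" by linarith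
      then have "2 * i + 1 < 2 * M + 1" using C by (simp only: power_strict_increasing_iff)
      then have "C ^ (2 * i + 2) \<le> C ^ (2 * M)" using C by (intro power_increasing) auto
      then show "j \<in> {..<C ^ (2 * M)}" using i by simp
    qed
    then have "card (F \<inter> {..<C ^ (2 * M + 1)}) \<le> C ^ (2 * M)"
      using card_mono[of "{..<C ^ (2 * M)}"] by fastforce
    then have "8 * D * card (F \<inter> {..<C ^ (2 * M + 1)}) \<le> 8 * D * C ^ (2 * M)" by (rule mult_le_mono2)
    then show "8 * D * card (F \<inter> {..<C ^ (2 * M + 1)}) \<le> C ^ (2 * M + 1)" by (simp add: C_def)
  qed
  have dense: "\<exists>N\<ge>M. N \<ge> 1 \<and> N \<le> 2 * D * card (F \<inter> {..<N})" for M
  proof (intro exI[of _ "C ^ (2 * M + 2)"] conjI)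
    have "M \<le> C ^ M" by (rule pow_ge)
    also have "\<dots> \<le> C ^ (2 * M + 2)" using C by (intro power_increasing) auto
    finally show "M \<le> C ^ (2 * M + 2)" .
    show "1 \<le> C ^ (2 * M + 2)" using C by (intro one_le_power) simp
    (* D times this interval is exactly the last interval of multiples of D below C ^ (2 M + 2). *)
    let ?I = "{8 * C ^ (2 * M)..<8 * C ^ (2 * M + 1)}"
    have "(\<lambda>t. D * t) ` ?I \<subseteq> F \<inter> {..<C ^ (2 * M + 2)}"
    proof
      fix j assume "j \<in> (\<lambda>t. D * t) ` ?I"
      then obtain t where t: "j = D * t" "t \<in> ?I" by blast
      from t(2) have t': "8 * C ^ (2 * M) \<le> t" "t < 8 * C ^ (2 * M + 1)"
        unfolding atLeastLessThan_iff by blast+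
      have "C ^ (2 * M + 1) = D * (8 * C ^ (2 * M))" by (simp add: C_def)
      also have "\<dots> \<le> j" unfolding t(1) using t'(1) by (rule mult_le_mono2)
      finally have 1: "C ^ (2 * M + 1) \<le> j" .
      have "j < D * (8 * C ^ (2 * M + 1))" unfolding t(1) by (rule mult_strict_left_mono[OF t'(2)]) (use D in simp)
      also have "\<dots> = C ^ (2 * M + 2)" by (simp add: C_def)
      finally show "j \<in> F \<inter> {..<C ^ (2 * M + 2)}" using 1 t(1) by (auto simp: F_def)
    qed
    then have "card ((\<lambda>t. D * t) ` ?I) \<le> card (F \<inter> {..<C ^ (2 * M + 2)})" by (intro card_mono) auto
    moreover have "card ((\<lambda>t. D * t) ` ?I) = card ?I"
      using D by (intro card_image) (auto simp: inj_on_def)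
    ultimately have "8 * C ^ (2 * M + 1) - 8 * C ^ (2 * M) \<le> card (F \<inter> {..<C ^ (2 * M + 2)})" by simp
    then have "2 * D * (8 * C ^ (2 * M + 1) - 8 * C ^ (2 * M)) \<le> 2 * D * card (F \<inter> {..<C ^ (2 * M + 2)})"
      by (rule mult_le_mono2)
    moreover have "C ^ (2 * M + 2) \<le> 2 * D * (8 * C ^ (2 * M + 1) - 8 * C ^ (2 * M))"
    proof -
      have "C ^ (2 * M + 1) = C * C ^ (2 * M)" by simp
      moreover have "8 * C ^ (2 * M) \<le> C * C ^ (2 * M)" using C by (rule mult_le_mono1)
      ultimately have "4 * C ^ (2 * M + 1) \<le> 8 * C ^ (2 * M + 1) - 8 * C ^ (2 * M)" by linarith
      then have "2 * D * (4 * C ^ (2 * M + 1)) \<le> 2 * D * (8 * C ^ (2 * M + 1) - 8 * C ^ (2 * M))"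
        by (rule mult_le_mono2)
      moreover have "2 * D * (4 * C ^ (2 * M + 1)) = C ^ (2 * M + 2)" by (simp add: C_def)
      ultimately show ?thesis by linarith
    qed
    ultimately show "C ^ (2 * M + 2) \<le> 2 * D * card (F \<inter> {..<C ^ (2 * M + 2)})" by linarith
  qed
  show ?thesis by (rule that[of F]) (fact upper sparse dense)+
qed

lemma birkhoff_sum_segments_diff:
  assumes B: "\<And>x. \<bar>\<phi> x\<bar> \<le> B"
    and block: "\<And>j. \<bar>birkhoff_sum T \<phi> n ((T ^^ (j * (n + q))) z) - v j\<bar> \<le> b"
  shows "\<bar>birkhoff_sum T \<phi> (N * (n + q)) z - (\<Sum>j<N. v j)\<bar> \<le> real N * (b + real q * B)"
proof (induction N)
  case 0
  then show ?case by (simp add: birkhoff_sum_def)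
next
  case (Suc N)
  let ?w = "(T ^^ (N * (n + q))) z"
  have "birkhoff_sum T \<phi> (Suc N * (n + q)) z
      = birkhoff_sum T \<phi> (N * (n + q)) z + (birkhoff_sum T \<phi> n ?w + birkhoff_sum T \<phi> q ((T ^^ n) ?w))"
    using birkhoff_sum_add[of T \<phi> "N * (n + q)" "n + q" z] birkhoff_sum_add[of T \<phi> n q ?w]
    by (simp add: add.commute)
  moreover have "\<bar>birkhoff_sum T \<phi> q ((T ^^ n) ?w)\<bar> \<le> real q * B"
    using birkhoff_sum_abs_le[of \<phi> B, OF B] by blast
  moreover have "real (Suc N) * (b + real q * B) = real N * (b + real q * B) + (b + real q * B)"
    by (simp add: algebra_simps)
  ultimately show ?case using Suc.IH block[of N] unfolding sum.lessThan_Suc abs_le_iff by linarith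
qed

text \<open>At multiples of the length \<open>n + q\<close> the average of the shadowing point is, up to scaling and a small
  error, the affine function \<open>a + f (b - a)\<close> of the frequency \<open>f\<close> of positions in \<open>F\<close>, so it inherits
  the oscillation of \<open>f\<close>.\<close>

lemma irregular_if_shadowing:
  fixes T :: "'a::metric_space \<Rightarrow> 'a" and \<phi> :: "'a \<Rightarrow> real" and \<omega> :: "nat \<Rightarrow> 'a"
  assumes n: "n \<ge> 1" and B: "\<And>x. \<bar>\<phi> x\<bar> \<le> B"
    and mod: "\<And>x y. dist x y \<le> \<epsilon> \<Longrightarrow> \<bar>\<phi> x - \<phi> y\<bar> \<le> g"
    and shadow: "\<And>j i. i < n \<Longrightarrow> dist ((T ^^ (j * (n + q) + i)) z) ((T ^^ i) (\<omega> j)) \<le> \<epsilon>"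
    and forced: "\<And>j. j \<in> F \<Longrightarrow> \<bar>birkhoff_sum T \<phi> n (\<omega> j) - real n * b\<bar> \<le> real n * g"
    and free: "\<And>j. j \<notin> F \<Longrightarrow> \<bar>birkhoff_sum T \<phi> n (\<omega> j) - real n * a\<bar> \<le> real n * g"
    and q: "real q \<le> g * real n" and D: "D \<ge> 1"
    and sparse: "\<And>M. \<exists>N\<ge>M. N \<ge> 1 \<and> 8 * D * card (F \<inter> {..<N}) \<le> N"
    and dense: "\<And>M. \<exists>N\<ge>M. N \<ge> 1 \<and> N \<le> 2 * D * card (F \<inter> {..<N})"
    and gap: "8 * real D * (g * (2 + B)) < \<bar>b - a\<bar>"
  shows "z \<in> irregular_set \<phi> T"
proof (rule ccontr)
  assume "z \<notin> irregular_set \<phi> T"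
  then have conv: "convergent (\<lambda>N. birkhoff_sum T \<phi> N z / real N)" by (simp add: irregular_set_def)
  have B0: "B \<ge> 0" using B[of undefined] by linarith
  have L: "n + q \<ge> 1" using n by simp
  define v where "v j = real n * (if j \<in> F then b else a)" for j
  define f where "f N = real (card (F \<inter> {..<N})) / real N" for N
  (* Normalised by N n instead of the true length N (n + q), which removes q from the comparison with
     a + f N (b - a) and only rescales the limit. *)
  define A where "A N = birkhoff_sum T \<phi> (N * (n + q)) z / (real N * real n)" for N
  have block: "\<bar>birkhoff_sum T \<phi> n ((T ^^ (j * (n + q))) z) - v j\<bar> \<le> real n * (2 * g)" for j
  proof -
    have "\<bar>birkhoff_sum T \<phi> n ((T ^^ (j * (n + q))) z) - birkhoff_sum T \<phi> n (\<omega> j)\<bar> \<le> real n * g"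
    proof (rule birkhoff_sum_diff_le, rule mod)
      fix i assume "i < n"
      then show "dist ((T ^^ i) ((T ^^ (j * (n + q))) z)) ((T ^^ i) (\<omega> j)) \<le> \<epsilon>"
        using shadow[of i j] by (simp add: funpow_add add.commute)
    qed
    moreover have "\<bar>birkhoff_sum T \<phi> n (\<omega> j) - v j\<bar> \<le> real n * g"
      using forced[of j] free[of j] by (simp add: v_def)
    ultimately show ?thesis by linarith
  qed
  have sumv: "(\<Sum>j<N. v j) = real n * (real N * a + real (card (F \<inter> {..<N})) * (b - a))" for N
  proof (induction N)
    case (Suc N)
    have "card (F \<inter> {..<Suc N}) = card (F \<inter> {..<N}) + (if N \<in> F then 1 else 0)"
      by (simp add: lessThan_Suc)
    then show ?case using Suc by (simp add: v_def algebra_simps)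
  qed simp
  have A: "\<bar>A N - (a + f N * (b - a))\<bar> \<le> g * (2 + B)" if N: "N \<ge> 1" for N
  proof -
    have Nn: "real N * real n > 0" using n N by simp
    have "A N - (a + f N * (b - a)) = (birkhoff_sum T \<phi> (N * (n + q)) z - (\<Sum>j<N. v j)) / (real N * real n)"
      using n N by (simp add: A_def f_def sumv field_simps)
    then have "\<bar>A N - (a + f N * (b - a))\<bar> = \<bar>birkhoff_sum T \<phi> (N * (n + q)) z - (\<Sum>j<N. v j)\<bar> / (real N * real n)"
      by (simp only: abs_divide abs_of_pos[OF Nn])
    also have "\<dots> \<le> real N * (real n * (2 * g) + real q * B) / (real N * real n)"
      by (rule divide_right_mono[OF birkhoff_sum_segments_diff[of \<phi> B, OF B block] less_imp_le[OF Nn]])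
    also have "\<dots> \<le> real N * (real n * (2 * g) + (g * real n) * B) / (real N * real n)"
      by (intro divide_right_mono less_imp_le[OF Nn] mult_left_mono add_left_mono mult_right_mono q B0) simp
    also have "\<dots> = g * (2 + B)" using n N by (simp add: field_simps)
    finally show ?thesis .
  qed
  have "convergent (\<lambda>N. birkhoff_sum T \<phi> (N * (n + q)) z / real (N * (n + q)))"
  proof -
    obtain l where "(\<lambda>N. birkhoff_sum T \<phi> N z / real N) \<longlonglongrightarrow> l" using conv by (auto simp: convergent_def)
    moreover have "strict_mono (\<lambda>N. N * (n + q))" using L by (auto simp: strict_mono_def)
    ultimately have "((\<lambda>N. birkhoff_sum T \<phi> N z / real N) \<circ> (\<lambda>N. N * (n + q))) \<longlonglongrightarrow> l"
      by (rule LIMSEQ_subseq_LIMSEQ)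
    then show ?thesis by (auto simp: convergent_def o_def)
  qed
  then have "convergent (\<lambda>N. birkhoff_sum T \<phi> (N * (n + q)) z / real (N * (n + q)) * (real (n + q) / real n))"
    by (rule convergent_mult[OF _ convergent_const])
  moreover have "(\<lambda>N. birkhoff_sum T \<phi> (N * (n + q)) z / real (N * (n + q)) * (real (n + q) / real n)) = A"
  proof
    fix N
    have "real (n + q) \<noteq> 0" using L by linarith
    then show "birkhoff_sum T \<phi> (N * (n + q)) z / real (N * (n + q)) * (real (n + q) / real n) = A N"
      by (simp add: A_def)
  qed
  ultimately have "Cauchy A" by (simp add: convergent_Cauchy)
  have ba: "\<bar>b - a\<bar> > 0" and "\<bar>b - a\<bar> / real D > 0"
  proof -
    have "g \<ge> 0" using q n by (metis of_nat_0_le_iff order_trans zero_le_mult_iff of_nat_le_0_iff not_one_le_zero)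
    then have "8 * real D * (g * (2 + B)) \<ge> 0" using B0 by simp
    then show "\<bar>b - a\<bar> > 0" using gap by linarith
    then show "\<bar>b - a\<bar> / real D > 0" using D by simp
  qed
  (* Up to two errors below \<bar>b - a\<bar> / (8 D) each, A at a dense and A at a sparse time differ by at least
     three times this threshold. *)
  then have "\<bar>b - a\<bar> / (8 * real D) > 0" using D by simp
  with \<open>Cauchy A\<close> obtain M where M: "\<And>N N'. N \<ge> M \<Longrightarrow> N' \<ge> M \<Longrightarrow> \<bar>A N - A N'\<bar> < \<bar>b - a\<bar> / (8 * real D)"
    unfolding Cauchy_def dist_real_def by meson
  obtain N where N: "N \<ge> M" "N \<ge> 1" "8 * D * card (F \<inter> {..<N}) \<le> N" using sparse by blast
  obtain N' where N': "N' \<ge> M" "N' \<ge> 1" "N' \<le> 2 * D * card (F \<inter> {..<N'})" using dense by blast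
  have "f N \<le> 1 / (8 * real D)"
  proof -
    have "real (8 * D * card (F \<inter> {..<N})) \<le> real N" using N(3) by (simp only: of_nat_le_iff)
    then show ?thesis using N(2) D by (simp add: f_def field_simps)
  qed
  moreover have "f N' \<ge> 1 / (2 * real D)"
  proof -
    have "real N' \<le> real (2 * D * card (F \<inter> {..<N'}))" using N'(3) by (simp only: of_nat_le_iff)
    then show ?thesis using N'(2) D by (simp add: f_def field_simps)
  qed
  moreover have "1 / (2 * real D) = 4 * (1 / (8 * real D))" by simp
  ultimately have "3 * (1 / (8 * real D)) \<le> f N' - f N" by linarith
  then have "3 * (1 / (8 * real D)) * \<bar>b - a\<bar> \<le> (f N' - f N) * \<bar>b - a\<bar>" by (rule mult_right_mono) simp
  moreover have "(f N' - f N) * \<bar>b - a\<bar> = \<bar>(a + f N' * (b - a)) - (a + f N * (b - a))\<bar>"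
  proof -
    have "f N' - f N \<ge> 0" using \<open>3 * (1 / (8 * real D)) \<le> f N' - f N\<close> by (smt (verit) divide_nonneg_nonneg of_nat_0_le_iff)
    then show ?thesis by (simp add: abs_mult flip: left_diff_distrib)
  qed
  moreover have "\<bar>(a + f N' * (b - a)) - (a + f N * (b - a))\<bar> \<le> \<bar>A N - A N'\<bar> + 2 * (g * (2 + B))"
    using A[OF N(2)] A[OF N'(2)] by linarith
  moreover have "3 * (1 / (8 * real D)) * \<bar>b - a\<bar> = 3 * (\<bar>b - a\<bar> / (8 * real D))" by simp
  ultimately have "3 * (\<bar>b - a\<bar> / (8 * real D)) \<le> \<bar>A N - A N'\<bar> + 2 * (g * (2 + B))"
    by linarith
  moreover have "g * (2 + B) < \<bar>b - a\<bar> / (8 * real D)"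
    using gap D by (simp add: pos_less_divide_eq mult.commute mult.left_commute)
  ultimately show False using M[OF N(1) N'(1)] by linarith
qed

section \<open>Pressure of a set that shadows all sequences of segments\<close>

text \<open>The terms of a pressure sum are indexed by an unordered countable set of pairs, and they dominate the
  measures of the cylinders only up to a constant factor, here \<open>k\<close>.\<close>

lemma emeasure_UN_le_mult_infsum:
  fixes f :: "'c \<Rightarrow> ennreal" and k :: ennreal
  assumes "countable C" and "\<And>c. c \<in> C \<Longrightarrow> A c \<in> sets M"
    and "\<And>c. c \<in> C \<Longrightarrow> emeasure M (A c) \<le> k * f c"
  shows "emeasure M (\<Union>c\<in>C. A c) \<le> k * infsum f C"
proof (cases "C = {}")
  case False
  define e where "e = from_nat_into C"
  have e: "range e = C" using assms(1) False by (simp add: e_def)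
  define U where "U n = (\<Union>i\<le>n. A (e i))" for n
  have "range U \<subseteq> sets M" using e assms(2) by (auto simp: U_def)
  moreover have "incseq U" by (force simp: incseq_def U_def)
  moreover have "(\<Union>n. U n) = (\<Union>c\<in>C. A c)" unfolding e[symmetric] by (auto simp: U_def)
  ultimately have "emeasure M (\<Union>c\<in>C. A c) = (SUP n. emeasure M (U n))"
    using SUP_emeasure_incseq by metis
  also have "\<dots> \<le> k * infsum f C"
  proof (rule SUP_least)
    fix n
    have "U n = (\<Union>c\<in>e ` {..n}. A c)" by (auto simp: U_def)
    also have "emeasure M \<dots> \<le> (\<Sum>c\<in>e ` {..n}. emeasure M (A c))"
      using e assms(2) by (intro emeasure_subadditive_finite) auto
    also have "\<dots> \<le> (\<Sum>c\<in>e ` {..n}. k * f c)"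
      using e assms(3) by (intro sum_mono) auto
    also have "\<dots> = k * (\<Sum>c\<in>e ` {..n}. f c)" by (simp add: sum_distrib_left)
    also have "(\<Sum>c\<in>e ` {..n}. f c) \<le> (SUP F\<in>{F. finite F \<and> F \<subseteq> C}. sum f F)"
      using e by (intro SUP_upper) auto
    also have "\<dots> = infsum f C" by (subst nonneg_infsum_complete) auto
    finally show "emeasure M (U n) \<le> k * infsum f C" by (simp add: mult_left_mono)
  qed
  finally show ?thesis .
qed simp

lemma card_free_ge:
  assumes "D * card (F \<inter> {..<k}) \<le> k + D" and "D \<ge> 1"
  shows "real (card {j\<in>{..<k}. j \<notin> F}) \<ge> real k - (real k / real D + 1)"
proof -
  have "{..<k} = {j\<in>{..<k}. j \<notin> F} \<union> (F \<inter> {..<k})" by auto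
  then have "card {..<k} = card ({j\<in>{..<k}. j \<notin> F} \<union> (F \<inter> {..<k}))" by simp
  also have "\<dots> = card {j\<in>{..<k}. j \<notin> F} + card (F \<inter> {..<k})" by (rule card_Un_disjoint) auto
  finally have 1: "real k = real (card {j\<in>{..<k}. j \<notin> F}) + real (card (F \<inter> {..<k}))" by simp
  have "real (D * card (F \<inter> {..<k})) \<le> real (k + D)" using assms(1) by (simp only: of_nat_le_iff)
  then have "real (card (F \<inter> {..<k})) * real D \<le> real k + real D" by (simp add: mult.commute)
  then have "real (card (F \<inter> {..<k})) \<le> (real k + real D) / real D"
    using assms(2) by (simp add: pos_le_divide_eq)
  also have "\<dots> = real k / real D + 1" using assms(2) by (simp add: add_divide_distrib)
  finally show ?thesis using 1 by linarith
qed

lemma birkhoff_sum_segments_ge: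
  assumes B: "\<And>x. \<bar>\<psi> x\<bar> \<le> B"
    and block: "\<And>j. j \<notin> F \<Longrightarrow> birkhoff_sum T \<psi> n ((T ^^ (j * (n + q))) z) \<ge> real n * s"
  shows "birkhoff_sum T \<psi> (k * (n + q)) z
    \<ge> real (card {j\<in>{..<k}. j \<notin> F}) * real n * (s + B) - real (k * (n + q)) * B"
proof (induction k)
  case 0
  then show ?case by (simp add: birkhoff_sum_def)
next
  case (Suc k)
  let ?w = "(T ^^ (k * (n + q))) z"
  have add: "birkhoff_sum T \<psi> (Suc k * (n + q)) z
      = birkhoff_sum T \<psi> (k * (n + q)) z + (birkhoff_sum T \<psi> n ?w + birkhoff_sum T \<psi> q ((T ^^ n) ?w))"
    using birkhoff_sum_add[of T \<psi> "k * (n + q)" "n + q" z] birkhoff_sum_add[of T \<psi> n q ?w]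
    by (simp add: add.commute)
  have "\<bar>birkhoff_sum T \<psi> q ((T ^^ n) ?w)\<bar> \<le> real q * B" "\<bar>birkhoff_sum T \<psi> n ?w\<bar> \<le> real n * B"
    using birkhoff_sum_abs_le[of \<psi> B, OF B] by blast+
  note bounds = abs_le_D2[OF this(1)] abs_le_D2[OF this(2)]
  have len: "real (Suc k * (n + q)) * B = real (k * (n + q)) * B + (real n * B + real q * B)"
    by (simp add: algebra_simps)
  show ?case
  proof (cases "k \<in> F")
    case True
    then have "{j\<in>{..<Suc k}. j \<notin> F} = {j\<in>{..<k}. j \<notin> F}" by (auto simp: less_Suc_eq)
    then show ?thesis using Suc.IH bounds unfolding add len by simp
  next
    case False
    then have "{j\<in>{..<Suc k}. j \<notin> F} = insert k {j\<in>{..<k}. j \<notin> F}" by (auto simp: less_Suc_eq)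
    then have "real (card {j\<in>{..<Suc k}. j \<notin> F}) = real (card {j\<in>{..<k}. j \<notin> F}) + 1" by simp
    then have "real (card {j\<in>{..<Suc k}. j \<notin> F}) * real n * (s + B)
        = real (card {j\<in>{..<k}. j \<notin> F}) * real n * (s + B) + (real n * s + real n * B)"
      by (simp add: algebra_simps)
    then show ?thesis using Suc.IH bounds(1) block[OF False] unfolding add len by linarith
  qed
qed

text \<open>Up to time \<open>m\<close> the orbit completes \<open>k\<close> rounds of length \<open>n + q\<close>. The time outside the free segments
  consists of the gaps, the forced segments and one incomplete round at the end; the additive constant
  in the density bound for \<open>F\<close> accounts for one further forced segment.\<close>

lemma free_time_ge:
  fixes g :: real
  assumes k: "k = m div (n + q)" and n: "n \<ge> 1" and q: "real q \<le> g * real n"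
    and D: "D \<ge> 1" "D * card (F \<inter> {..<k}) \<le> k + D" and g: "g \<ge> 0"
  defines "w \<equiv> real (card {j\<in>{..<k}. j \<notin> F}) * real n"
  shows "w \<le> real m" and "real m - w \<le> (g + 1 / real D) * real m + 2 * real (n + q)"
proof -
  have kL: "real k * real (n + q) \<le> real m"
  proof -
    have "k * (n + q) \<le> m" by (simp add: k)
    then have "real (k * (n + q)) \<le> real m" by (simp only: of_nat_le_iff)
    then show ?thesis by (simp only: of_nat_mult)
  qed
  have kL': "real m < (real k + 1) * real (n + q)"
  proof -
    have "m < (k + 1) * (n + q)" using dividend_less_div_times[of "n + q" m] n by (simp add: k add.commute)
    then have "real m < real ((k + 1) * (n + q))" by (simp only: of_nat_less_iff)
    then show ?thesis by (simp add: algebra_simps)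
  qed
  have nL: "real n \<le> real (n + q)" by simp
  have kn: "real k * real n \<le> real m"
    using kL mult_left_mono[OF nL, of "real k"] by simp
  have "card {j\<in>{..<k}. j \<notin> F} \<le> card {..<k}" by (intro card_mono) auto
  then have "w \<le> real k * real n" unfolding w_def by (intro mult_right_mono) auto
  then show "w \<le> real m" using kn by linarith
  have "(real k - (real k / real D + 1)) * real n \<le> w"
    unfolding w_def using card_free_ge[OF D(2,1)] by (intro mult_right_mono) auto
  then have 1: "real k * real n - (real k * real n) / real D - real n \<le> w" by (simp add: algebra_simps)
  have 2: "(real k * real n) / real D \<le> real m / real D" using kn by (intro divide_right_mono) auto
  have 3: "real k * real q \<le> g * real m"
  proof -
    have "real k * real q \<le> real k * (g * real n)" using q by (intro mult_left_mono) auto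
    also have "\<dots> = g * (real k * real n)" by simp
    also have "\<dots> \<le> g * real m" using kn g by (rule mult_left_mono)
    finally show ?thesis .
  qed
  have 4: "(real k + 1) * real (n + q) = real k * real n + real k * real q + real (n + q)"
    by (simp add: algebra_simps)
  have 5: "(g + 1 / real D) * real m = g * real m + real m / real D" by (simp add: algebra_simps)
  have "m' - w' \<le> b + p' + 2 * l" if "m' < a + b + l" "a - p - n' \<le> w'" "p \<le> p'" "n' \<le> l"
    for m' a b l p n' w' p' :: real
    using that by linarith
  from this[OF kL'[unfolded 4] 1 2 nL] 3
  show "real m - w \<le> (g + 1 / real D) * real m + 2 * real (n + q)"
    unfolding 5 by linarith
qed

text \<open>A sequence whose shadowing point lies in a ball \<open>B\<^sub>m(x, \<epsilon>')\<close> has, at each of the \<open>u\<close> free positions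
  completed before \<open>m\<close>, one of at most \<open>exp (n g)\<close> entries. The product measure of such sequences is
  at most \<open>(exp (n g) / card E) ^ u \<le> exp (- n u (c - g - s))\<close>, while the Birkhoff sum of \<open>\<psi>\<close> at the
  shadowing point is about \<open>n u s\<close>. As \<open>n u\<close> is nearly \<open>m\<close>, the term of the ball in the pressure sum
  exceeds this measure up to a constant factor for all \<open>t\<close> slightly below \<open>c\<close>.\<close>

lemma pressure_at_ge_shadowing:
  fixes T :: "'a::metric_space \<Rightarrow> 'a" and \<psi> :: "'a \<Rightarrow> real"
  assumes n: "n \<ge> 1" and q: "real q \<le> g * real n" and g: "g > 0"
    and \<epsilon>: "0 < \<epsilon>'" "\<epsilon>' \<le> \<epsilon>" "4 * \<epsilon> \<le> d"
    and B: "\<And>x. \<bar>\<psi> x\<bar> \<le> B"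
    and mod: "\<And>x y. dist x y \<le> \<epsilon> \<Longrightarrow> \<bar>\<psi> x - \<psi> y\<bar> \<le> g"
    and E: "finite E" "\<And>x. x \<in> E \<Longrightarrow> \<bar>birkhoff_sum T \<psi> n x - real n * s\<bar> \<le> real n * g"
      "\<And>E'. E' \<subseteq> E \<Longrightarrow> \<forall>x\<in>E'. \<forall>y\<in>E'. \<forall>i<n. dist ((T ^^ i) x) ((T ^^ i) y) < d
          \<Longrightarrow> real (card E') \<le> exp (real n * g)"
      "real (card E) \<ge> exp (real n * (c - s))"
    and shadow: "\<And>\<omega>. (\<And>j. \<omega> j \<in> (if j \<in> F then {y} else E)) \<Longrightarrow>
       \<exists>z\<in>Z. \<forall>j. \<forall>i<n. dist ((T ^^ (j * (n + q) + i)) z) ((T ^^ i) (\<omega> j)) \<le> \<epsilon>"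
    and D: "D \<ge> 1" "\<And>N. D * card (F \<inter> {..<N}) \<le> N + D"
    and t0: "t0 \<le> c - 3 * g - (g + 1 / real D) * (\<bar>c\<bar> + 3 * g + B)"
  shows "ereal t0 \<le> pressure_at T Z \<psi> \<epsilon>'"
proof -
  define L where "L = n + q"
  (* The exponent of the constant factor: it absorbs the incomplete round and the additive constant in
     the density of F. *)
  define \<kappa> where "\<kappa> = 2 * real L * (\<bar>c\<bar> + 3 * g + B)"
  define Ej where "Ej j = (if j \<in> F then {y} else E)" for j
  have B0: "B \<ge> 0" using B[of undefined] by linarith
  have cardE: "real (card E) > 0" using E(4) by (meson exp_gt_zero order_less_le_trans)
  have Ene: "E \<noteq> {}" using cardE by auto
  have Ej: "finite (Ej j)" "Ej j \<noteq> {}" for j using E(1) Ene by (auto simp: Ej_def)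
  define M where "M j = uniform_count_measure (Ej j)" for j
  have PS: "prob_space (M j)" for j
    unfolding M_def using Ej by (intro prob_space_uniform_count_measure)
  interpret product_prob_space M UNIV
    by (intro product_prob_spaceI PS)
  let ?PM = "PiM UNIV M"
  have space: "space ?PM = {\<omega>. \<forall>j. \<omega> j \<in> Ej j}"
    by (auto simp: space_PiM M_def space_uniform_count_measure PiE_def)
  define good where "good z \<omega> \<longleftrightarrow> z \<in> Z \<and> (\<forall>j. \<forall>i<n. dist ((T ^^ (j * L + i)) z) ((T ^^ i) (\<omega> j)) \<le> \<epsilon>)" for z \<omega>
  have "\<exists>z. good z \<omega>" if "\<omega> \<in> space ?PM" for \<omega>
    using shadow[of \<omega>] that unfolding space Ej_def good_def L_def by blast
  then obtain \<pi> where \<pi>: "\<And>\<omega>. \<omega> \<in> space ?PM \<Longrightarrow> good (\<pi> \<omega>) \<omega>" by metis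
  define X where "X x j = {e \<in> Ej j. \<forall>i<n. dist ((T ^^ (j * L + i)) x) ((T ^^ i) e) < 2 * \<epsilon>}" for x j
  define meets where "meets x m \<longleftrightarrow> (\<exists>\<omega>\<in>space ?PM. \<pi> \<omega> \<in> bowen_ball T m x \<epsilon>')" for x m
  (* Balls that contain no shadowing point get the empty set, so that the bound on the measure of A x m
     below always has a shadowing point in the ball at which to evaluate the Birkhoff sum. *)
  define A where "A x m = (if meets x m then {\<omega> \<in> space ?PM. \<forall>j\<in>{..<m div L}. \<omega> j \<in> X x j} else {})" for x m
  have X_sets: "X x j \<in> sets (M j)" for x j
    by (auto simp: M_def sets_uniform_count_measure X_def)
  have XE: "emeasure (M j) (X x j) \<le> ennreal (if j \<in> F then 1 else exp (real n * g) / real (card E))" for x j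
  proof (cases "j \<in> F")
    case True
    then show ?thesis using prob_space.emeasure_le_1[OF PS] by simp
  next
    case False
    have sub: "X x j \<subseteq> E" using False by (auto simp: X_def Ej_def)
    have "\<forall>a\<in>X x j. \<forall>b\<in>X x j. \<forall>i<n. dist ((T ^^ i) a) ((T ^^ i) b) < d"
    proof (intro ballI allI impI)
      fix a b i assume ab: "a \<in> X x j" "b \<in> X x j" "i < n"
      let ?x = "(T ^^ (j * L + i)) x"
      have "dist ((T ^^ i) a) ((T ^^ i) b) \<le> dist ?x ((T ^^ i) a) + dist ?x ((T ^^ i) b)"
        by (rule dist_triangle3)
      moreover have "dist ?x ((T ^^ i) a) < 2 * \<epsilon>" "dist ?x ((T ^^ i) b) < 2 * \<epsilon>"
        using ab by (auto simp: X_def)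
      ultimately show "dist ((T ^^ i) a) ((T ^^ i) b) < d" using \<epsilon>(3) by linarith
    qed
    then have "real (card (X x j)) \<le> exp (real n * g)" using E(3)[OF sub] by blast
    then have "real (card (X x j)) / real (card E) \<le> exp (real n * g) / real (card E)"
      by (rule divide_right_mono) simp
    moreover have "emeasure (M j) (X x j) = ennreal (real (card (X x j)) / real (card E))"
      using False sub E(1) by (simp add: M_def Ej_def emeasure_uniform_count_measure)
    ultimately show ?thesis using False by (simp add: ennreal_leI)
  qed
  have A_sets: "A x m \<in> sets ?PM" for x m
  proof -
    have "{\<omega> \<in> space ?PM. \<forall>j\<in>{..<m div L}. \<omega> j \<in> X x j} \<in> sets ?PM"
    proof (rule sets.sets_Collect_finite_All)
      show "{\<omega> \<in> space ?PM. \<omega> j \<in> X x j} \<in> sets ?PM" for j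
        using X_sets by (intro measurable_sets_Collect[of "\<lambda>\<omega>. \<omega> j" ?PM "M j"] measurable_component_singleton) auto
    qed simp
    then show ?thesis by (simp add: A_def)
  qed
  have A_le: "emeasure ?PM (A x m) \<le> ennreal (exp \<kappa>) *
      ennreal (exp (- t * real m + (SUP y \<in> bowen_ball T m x \<epsilon>'. birkhoff_sum T \<psi> m y)))"
    if m: "m \<ge> 1" and t: "t \<le> t0" for x m t
  proof (cases "meets x m")
    case False
    then show ?thesis by (simp add: A_def)
  next
    case True
    then obtain \<omega> where \<omega>: "\<omega> \<in> space ?PM" "\<pi> \<omega> \<in> bowen_ball T m x \<epsilon>'" by (auto simp: meets_def)
    define z where "z = \<pi> \<omega>"
    define k where "k = m div L"
    define u where "u = card {j\<in>{..<k}. j \<notin> F}"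
    (* The total length of the free segments. *)
    define w where "w = real u * real n"
    (* The bound for the measure of one free coordinate. *)
    define \<beta> where "\<beta> = exp (real n * g) / real (card E)"
    have \<beta>: "0 < \<beta>" "\<beta> \<le> exp (- (real n * (c - g - s)))"
    proof -
      show "0 < \<beta>" using cardE by (simp add: \<beta>_def)
      have "\<beta> \<le> exp (real n * g) / exp (real n * (c - s))"
        unfolding \<beta>_def using E(4) cardE by (intro divide_left_mono) auto
      also have "\<dots> = exp (- (real n * (c - g - s)))" by (simp add: algebra_simps flip: exp_diff)
      finally show "\<beta> \<le> exp (- (real n * (c - g - s)))" .
    qed
    have "emeasure ?PM (A x m) = (\<Prod>j\<in>{..<k}. emeasure (M j) (X x j))"
      using True X_sets by (simp add: A_def k_def emeasure_PiM_Collect)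
    also have "\<dots> \<le> (\<Prod>j\<in>{..<k}. ennreal (if j \<in> F then 1 else \<beta>))"
      unfolding \<beta>_def by (intro prod_mono_ennreal XE)
    also have "\<dots> = ennreal (\<Prod>j\<in>{..<k}. if j \<in> F then 1 else \<beta>)"
      using \<beta>(1) by (intro prod_ennreal) auto
    also have "(\<Prod>j\<in>{..<k}. if j \<in> F then 1 else \<beta>) = \<beta> ^ u"
    proof -
      have "(\<Prod>j\<in>{..<k}. if j \<in> F then 1 else \<beta>) = (\<Prod>j\<in>{..<k}. if j \<notin> F then \<beta> else 1)"
        by (intro prod.cong) auto
      also have "\<dots> = (\<Prod>j\<in>{j\<in>{..<k}. j \<notin> F}. \<beta>)" by (subst prod.inter_filter) auto
      finally show ?thesis by (simp add: u_def)
    qed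
    finally have 1: "emeasure ?PM (A x m) \<le> ennreal (\<beta> ^ u)" .
    have "\<beta> ^ u \<le> exp (- (real n * (c - g - s))) ^ u" using \<beta> by (intro power_mono) auto
    also have "\<dots> = exp (real u * (- (real n * (c - g - s))))" by (rule exp_of_nat_mult[symmetric])
    also have "real u * (- (real n * (c - g - s))) = - (w * (c - g - s))" by (simp add: w_def)
    finally have 2: "\<beta> ^ u \<le> exp (- (w * (c - g - s)))" .
    have gz: "\<And>j i. i < n \<Longrightarrow> dist ((T ^^ (j * L + i)) z) ((T ^^ i) (\<omega> j)) \<le> \<epsilon>"
      using \<pi>[OF \<omega>(1)] by (simp add: good_def z_def)
    have "birkhoff_sum T \<psi> (k * L) z \<ge> real u * real n * ((s - 2 * g) + B) - real (k * L) * B"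
      unfolding u_def L_def
    proof (rule birkhoff_sum_segments_ge[of \<psi> B, OF B])
      fix j assume j: "j \<notin> F"
      have "\<bar>birkhoff_sum T \<psi> n ((T ^^ (j * (n + q))) z) - birkhoff_sum T \<psi> n (\<omega> j)\<bar> \<le> real n * g"
      proof (rule birkhoff_sum_diff_le, rule mod)
        fix i assume "i < n"
        then show "dist ((T ^^ i) ((T ^^ (j * (n + q))) z)) ((T ^^ i) (\<omega> j)) \<le> \<epsilon>"
          using gz[of i j] by (simp add: funpow_add add.commute L_def)
      qed
      moreover have "\<omega> j \<in> E" using \<omega>(1) j by (auto simp: space Ej_def split: if_splits)
      then have "\<bar>birkhoff_sum T \<psi> n (\<omega> j) - real n * s\<bar> \<le> real n * g" by (rule E(2))
      moreover have "real n * (s - 2 * g) = real n * s - real n * g - real n * g" by (simp add: algebra_simps)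
      ultimately show "birkhoff_sum T \<psi> n ((T ^^ (j * (n + q))) z) \<ge> real n * (s - 2 * g)" by linarith
    qed
    moreover have "birkhoff_sum T \<psi> m z
        = birkhoff_sum T \<psi> (k * L) z + birkhoff_sum T \<psi> (m - k * L) ((T ^^ (k * L)) z)"
      using birkhoff_sum_add[of T \<psi> "k * L" "m - k * L" z] by (simp add: k_def)
    moreover have "- birkhoff_sum T \<psi> (m - k * L) ((T ^^ (k * L)) z) \<le> real (m - k * L) * B"
      by (rule abs_le_D2[OF birkhoff_sum_abs_le[of \<psi> B, OF B]])
    ultimately have "birkhoff_sum T \<psi> m z
        \<ge> real u * real n * ((s - 2 * g) + B) - real (k * L) * B - real (m - k * L) * B"
      by linarith
    also have "real (m - k * L) = real m - real (k * L)" by (simp add: k_def of_nat_diff)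
    also have "real u * real n * ((s - 2 * g) + B) - real (k * L) * B - (real m - real (k * L)) * B
        = w * (s - 2 * g) - (real m - w) * B"
      by (simp add: w_def algebra_simps)
    finally have S: "birkhoff_sum T \<psi> m z \<ge> w * (s - 2 * g) - (real m - w) * B" .
    have r: "w \<le> real m" "real m - w \<le> (g + 1 / real D) * real m + 2 * real L"
      using free_time_ge[OF k_def[unfolded L_def] n q D(1) D(2) less_imp_le[OF g]]
      unfolding w_def u_def L_def by blast+
    have "- (w * (c - g - s)) \<le> \<kappa> + (- t * real m + birkhoff_sum T \<psi> m z)"
    proof -
      let ?C = "\<bar>c\<bar> + 3 * g + B"
      have "(real m - w) * (c - 3 * g + B) \<le> (real m - w) * ?C"
        using r(1) g by (intro mult_left_mono) auto
      also have "\<dots> \<le> ((g + 1 / real D) * real m + 2 * real L) * ?C"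
        using r(2) g B0 by (intro mult_right_mono) auto
      also have "\<dots> = (g + 1 / real D) * ?C * real m + \<kappa>" by (simp add: \<kappa>_def algebra_simps)
      finally have "(real m - w) * (c - 3 * g + B) \<le> (g + 1 / real D) * ?C * real m + \<kappa>" .
      moreover have "t * real m \<le> (c - 3 * g - (g + 1 / real D) * ?C) * real m"
        using t t0 by (intro mult_right_mono) auto
      ultimately show ?thesis using S by (simp add: algebra_simps)
    qed
    moreover have "birkhoff_sum T \<psi> m z \<le> (SUP y \<in> bowen_ball T m x \<epsilon>'. birkhoff_sum T \<psi> m y)"
    proof (rule cSUP_upper)
      show "z \<in> bowen_ball T m x \<epsilon>'" using \<omega>(2) by (simp add: z_def)
      show "bdd_above (birkhoff_sum T \<psi> m ` bowen_ball T m x \<epsilon>')"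
        by (rule bdd_aboveI2[of _ _ "real m * B"])
          (use birkhoff_sum_abs_le[of \<psi> B, OF B] in \<open>simp add: abs_le_iff\<close>)
    qed
    ultimately have "exp (- (w * (c - g - s)))
        \<le> exp (\<kappa> + (- t * real m + (SUP y \<in> bowen_ball T m x \<epsilon>'. birkhoff_sum T \<psi> m y)))"
      by simp
    with 2 have "\<beta> ^ u \<le> exp \<kappa> * exp (- t * real m + (SUP y \<in> bowen_ball T m x \<epsilon>'. birkhoff_sum T \<psi> m y))"
      by (simp only: exp_add)
    then have "ennreal (\<beta> ^ u) \<le> ennreal (exp \<kappa>) * ennreal (exp (- t * real m + (SUP y \<in> bowen_ball T m x \<epsilon>'. birkhoff_sum T \<psi> m y)))"
      by (subst ennreal_mult[symmetric]) (auto intro: ennreal_leI)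
    then show ?thesis using 1 by (rule order_trans[rotated])
  qed
  show ?thesis
  proof (rule pressure_at_ge)
    show "0 < ennreal (exp (- \<kappa>))" by simp
    fix C t assume t: "t \<le> t0" and C: "C \<in> bowen_covers T Z 1 \<epsilon>'"
    let ?f = "\<lambda>(x, m). ennreal (exp (- t * real m + (SUP y \<in> bowen_ball T m x \<epsilon>'. birkhoff_sum T \<psi> m y)))"
    have "space ?PM \<subseteq> (\<Union>c\<in>C. case_prod A c)"
    proof
      fix \<omega> assume \<omega>: "\<omega> \<in> space ?PM"
      then have gd: "good (\<pi> \<omega>) \<omega>" by (rule \<pi>)
      then have "\<pi> \<omega> \<in> (\<Union>(x, m)\<in>C. bowen_ball T m x \<epsilon>')"
        using C unfolding bowen_covers_def good_def by blast
      then obtain x m where xm: "(x, m) \<in> C" "\<pi> \<omega> \<in> bowen_ball T m x \<epsilon>'" by blast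
      then have m1: "m \<ge> 1" using C unfolding bowen_covers_def by blast
      have "\<omega> j \<in> X x j" if j: "j < m div L" for j
      proof -
        have "dist ((T ^^ (j * L + i)) x) ((T ^^ i) (\<omega> j)) < 2 * \<epsilon>" if i: "i < n" for i
        proof -
          have "Suc j * L \<le> (m div L) * L" using j by (intro mult_le_mono1) simp
          also have "\<dots> \<le> m" by simp
          finally have "j * L + i < m" using i by (simp add: L_def)
          then have "dist ((T ^^ (j * L + i)) x) ((T ^^ (j * L + i)) (\<pi> \<omega>)) < \<epsilon>'"
            using xm(2) m1 by (simp add: in_bowen_ball_iff)
          moreover have "dist ((T ^^ (j * L + i)) (\<pi> \<omega>)) ((T ^^ i) (\<omega> j)) \<le> \<epsilon>"
            using gd i by (simp add: good_def)
          ultimately show ?thesis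
            using \<epsilon>(2) dist_triangle[of "(T ^^ (j * L + i)) x" "(T ^^ i) (\<omega> j)" "(T ^^ (j * L + i)) (\<pi> \<omega>)"]
            by linarith
        qed
        then show ?thesis using \<omega> by (simp add: X_def space)
      qed
      then have "\<omega> \<in> A x m" using \<omega> xm(2) by (auto simp: A_def meets_def)
      then show "\<omega> \<in> (\<Union>c\<in>C. case_prod A c)" using xm(1) by blast
    qed
    then have "emeasure ?PM (space ?PM) \<le> emeasure ?PM (\<Union>c\<in>C. case_prod A c)"
      using C A_sets by (intro emeasure_mono sets.countable_UN') (auto simp: bowen_covers_def)
    also have "\<dots> \<le> ennreal (exp \<kappa>) * infsum ?f C"
    proof (rule emeasure_UN_le_mult_infsum)
      show "countable C" using C by (simp add: bowen_covers_def)
      fix c assume c: "c \<in> C"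
      obtain x m where xm: "c = (x, m)" by (cases c)
      with c C have "m \<ge> 1" by (auto simp: bowen_covers_def)
      then show "emeasure ?PM (case_prod A c) \<le> ennreal (exp \<kappa>) * ?f c"
        using A_le[OF _ t, of m x] unfolding xm by simp
      show "case_prod A c \<in> sets ?PM" unfolding xm by (simp add: A_sets)
    qed
    finally have "1 \<le> ennreal (exp \<kappa>) * infsum ?f C" by (simp add: P.emeasure_space_1)
    then have "ennreal (exp (- \<kappa>)) * 1 \<le> ennreal (exp (- \<kappa>)) * (ennreal (exp \<kappa>) * infsum ?f C)"
      by (rule mult_left_mono) simp
    also have "\<dots> = infsum ?f C"
      by (simp add: mult.assoc[symmetric] ennreal_mult[symmetric] exp_add[symmetric])
    finally show "ennreal (exp (- \<kappa>)) \<le> infsum ?f C" by simp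
  qed
qed

section \<open>Pressure of the irregular set\<close>

text \<open>The constants are chosen in the order \<open>D\<close>, \<open>g\<close>, then \<open>\<tau>\<close> and \<open>d\<close> from the entropy, \<open>\<epsilon>\<close>, and finally
  \<open>n\<close>: the density \<open>1/D\<close> and the relative error \<open>g\<close> cost at most \<open>e\<close> in the pressure, and \<open>g\<close> is small
  compared with the oscillation \<open>\<rho> / D\<close> of the averages. All segments have their time lag below
  \<open>g n\<close>, so one gap \<open>q\<close> serves all of them.\<close>

lemma pressure_irregular_ge:
  fixes T :: "'a::metric_space \<Rightarrow> 'a" and \<phi> \<psi> :: "'a \<Rightarrow> real"
  assumes comp: "compact (UNIV :: 'a set)" and T: "continuous_on UNIV T"
    and nonunif: "nonuniform_specification m T K"
    and \<phi>: "continuous_on UNIV \<phi>" and \<psi>: "continuous_on UNIV \<psi>"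
    and \<nu>: "\<nu>1 \<in> invariant_measures_on K T" "\<nu>2 \<in> invariant_measures_on K T"
      "integral\<^sup>L \<nu>1 \<phi> < integral\<^sup>L \<nu>2 \<phi>"
    and \<mu>: "\<mu> \<in> invariant_measures_on K T"
    and P: "finite P" "partition_on UNIV P" "P \<subseteq> sets borel"
  shows "ereal (ks_entropy_partition T \<mu> P + integral\<^sup>L \<mu> \<psi>) \<le> pressure T (irregular_set \<phi> T) \<psi>"
proof (rule ereal_le_epsilon2[rule_format])
  fix e :: real assume e: "e > 0"
  define c0 where "c0 = ks_entropy_partition T \<mu> P + integral\<^sup>L \<mu> \<psi>"
  define \<rho> where "\<rho> = integral\<^sup>L \<nu>2 \<phi> - integral\<^sup>L \<nu>1 \<phi>"
  have \<rho>: "\<rho> > 0" using \<nu>(3) by (simp add: \<rho>_def)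
  have inv: "\<mu> \<in> invariant_measures T" "\<nu>1 \<in> invariant_measures T" "\<nu>2 \<in> invariant_measures T"
    and K1: "emeasure \<mu> K = 1" "emeasure \<nu>1 K = 1" "emeasure \<nu>2 K = 1"
    using \<mu> \<nu> by (auto simp: invariant_measures_on_def)
  have Tm: "T \<in> borel_measurable borel" using T by (rule borel_measurable_continuous_onI)
  have \<phi>m: "\<phi> \<in> borel_measurable borel" using \<phi> by (rule borel_measurable_continuous_onI)
  obtain B1 where B1: "B1 \<ge> 1" "\<And>x. \<bar>\<phi> x\<bar> \<le> B1" using bounded_continuous_real[OF comp \<phi>] by metis
  obtain B2 where B2: "B2 \<ge> 1" "\<And>x. \<bar>\<psi> x\<bar> \<le> B2" using bounded_continuous_real[OF comp \<psi>] by metis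
  define B where "B = max B1 B2"
  have B: "B \<ge> 1" "\<And>x. \<bar>\<phi> x\<bar> \<le> B" "\<And>x. \<bar>\<psi> x\<bar> \<le> B"
    using B1 B2 by (auto simp: B_def le_max_iff_disj)
  (* C bounds \<bar>c\<bar> + 3 g + B, the loss per unit of time outside the free segments; here c = c0 - 5 g and
     g \<le> 1. *)
  define C where "C = \<bar>c0\<bar> + 8 + B"
  have C: "C > 0" using B(1) by (simp add: C_def)
  obtain D :: nat where D': "2 * C / e < real D" using reals_Archimedean2 by blast
  have "2 * C / e > 0" using C e by simp
  then have Dpos: "real D > 0" using D' by linarith
  then have D: "D \<ge> 1" by simp
  have CD: "C / real D \<le> e / 2" using D' e Dpos by (simp add: field_simps)
  define g where "g = min 1 (min (e / (2 * (8 + C))) (\<rho> / (64 * real D * (2 + B))))"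
  have g: "g > 0" using e C \<rho> Dpos B(1) by (simp add: g_def)
  have g1: "g \<le> 1" by (simp add: g_def)
  have gC: "g * (8 + C) \<le> e / 2"
  proof -
    have "g \<le> e / (2 * (8 + C))" by (simp add: g_def)
    then have "g * (8 + C) \<le> e / (2 * (8 + C)) * (8 + C)" using C by (intro mult_right_mono) auto
    also have "\<dots> = e / 2"
    proof -
      have "e / (2 * W) * W = e / 2" if "W > 0" for W :: real using that by simp
      then show ?thesis by this (use C in simp)
    qed
    finally show ?thesis .
  qed
  have g\<rho>: "8 * real D * (g * (2 + B)) \<le> \<rho> / 8"
  proof -
    have "g \<le> \<rho> / (64 * real D * (2 + B))" by (simp add: g_def)
    then have "g * (64 * real D * (2 + B)) \<le> \<rho>" using Dpos B(1) by (simp add: pos_le_divide_eq)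
    then show ?thesis by (simp add: algebra_simps)
  qed
  from entropy_blocks[OF comp inv(1) T P \<phi> B(2) \<psi> B(3) g]
  obtain \<tau> d N0 where \<tau>: "\<tau> > 0" and d: "d > 0" and blocks:
    "\<forall>n\<ge>N0. \<forall>G. (\<forall>V\<in>sets borel. G \<subseteq> V \<longrightarrow> measure \<mu> V \<ge> 1 - \<tau>) \<longrightarrow>
    (\<exists>E a s. finite E \<and> E \<subseteq> G \<and>
      (\<forall>x\<in>E. \<bar>birkhoff_sum T \<phi> n x - real n * a\<bar> \<le> real n * g \<and>
             \<bar>birkhoff_sum T \<psi> n x - real n * s\<bar> \<le> real n * g) \<and>
      (\<forall>E'\<subseteq>E. (\<forall>x\<in>E'. \<forall>y\<in>E'. \<forall>i<n. dist ((T ^^ i) x) ((T ^^ i) y) < d)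
          \<longrightarrow> real (card E') \<le> exp (real n * g)) \<and>
      real (card E) \<ge> exp (real n * (ks_entropy_partition T \<mu> P + integral\<^sup>L \<mu> \<psi> - s - 5 * g)))"
    by (elim exE conjE)
  obtain d1 where d1: "d1 > 0" "\<And>x y. dist x y < d1 \<Longrightarrow> \<bar>\<phi> x - \<phi> y\<bar> \<le> g"
    using uniform_modulus[OF comp \<phi> g] by metis
  obtain d2 where d2: "d2 > 0" "\<And>x y. dist x y < d2 \<Longrightarrow> \<bar>\<psi> x - \<psi> y\<bar> \<le> g"
    using uniform_modulus[OF comp \<psi> g] by metis
  obtain \<eta> p where \<eta>: "\<eta> > 0"
    and pmono: "\<forall>x\<in>K. \<forall>n\<ge>1. \<forall>\<epsilon>1 \<epsilon>2. 0 < \<epsilon>1 \<and> \<epsilon>1 < \<epsilon>2 \<and> \<epsilon>2 < \<eta> \<longrightarrow> p x n \<epsilon>1 \<ge> (p x n \<epsilon>2 :: nat)"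
    and plim: "\<forall>x\<in>K. ((\<lambda>\<epsilon>. limsup (\<lambda>n. ereal (real (p x n \<epsilon>) / real n))) \<longlongrightarrow> 0) (at_right 0)"
    and pspec: "\<forall>\<epsilon>. 0 < \<epsilon> \<and> \<epsilon> < \<eta> \<longrightarrow>
          (\<forall>k\<ge>1. \<forall>(x :: nat \<Rightarrow> 'a) (n :: nat \<Rightarrow> nat) (q :: nat \<Rightarrow> nat).
             (\<forall>i\<in>{1..k}. x i \<in> K \<and> n i \<ge> 1 \<and> q i \<ge> p (x i) (n i) \<epsilon>) \<longrightarrow>
             (\<exists>z. \<forall>i\<in>{1..k}.
                (T ^^ (\<Sum>j\<in>{1..<i}. n j + q j)) z \<in> bowen_ball T (n i) (x i) \<epsilon>))"
    using nonunif unfolding nonuniform_specification_def by (elim exE conjE) (rule that)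
  define \<epsilon> where "\<epsilon> = min (min (d1 / 2) (d2 / 2)) (min (d / 4) (\<eta> / 2))"
  have \<epsilon>: "\<epsilon> > 0" using d1(1) d2(1) d \<eta> by (simp add: \<epsilon>_def)
  have "\<epsilon> \<le> d1 / 2" "\<epsilon> \<le> d2 / 2" "\<epsilon> \<le> \<eta> / 2" "\<epsilon> \<le> d / 4" by (auto simp: \<epsilon>_def)
  then have \<epsilon>d: "\<epsilon> < d1" "\<epsilon> < d2" "\<epsilon> < \<eta>" "4 * \<epsilon> \<le> d" using d1(1) d2(1) \<eta> d by linarith+
  have mod\<phi>: "\<bar>\<phi> x - \<phi> y\<bar> \<le> g" if "dist x y \<le> \<epsilon>" for x y using that \<epsilon>d(1) by (intro d1(2)) linarith
  have mod\<psi>: "\<bar>\<psi> x - \<psi> y\<bar> \<le> g" if "dist x y \<le> \<epsilon>" for x y using that \<epsilon>d(2) by (intro d2(2)) linarith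
  define G where "G N = {x\<in>K. \<forall>n\<ge>N. real (p x n \<epsilon>) \<le> g * real n}" for N
  have G_inc: "incseq G"
  proof (rule incseq_SucI)
    show "G N \<subseteq> G (Suc N)" for N by (auto simp: G_def)
  qed
  have G_K: "K \<subseteq> (\<Union>N. G N)"
  proof
    fix x assume x: "x \<in> K"
    from sublinear_lag[OF pmono plim x \<epsilon> \<epsilon>d(3) g]
    show "x \<in> (\<Union>N. G N)" using x by (auto simp: eventually_sequentially G_def)
  qed
  define \<sigma> where "\<sigma> = \<rho> / 8"
  have \<sigma>: "\<sigma> > 0" using \<rho> by (simp add: \<sigma>_def)
  define \<tau>' where "\<tau>' = \<sigma> / (2 * (2 * B + \<sigma>))"
  have \<tau>': "\<tau>' > 0" "(2 * B + \<sigma>) * \<tau>' < \<sigma>"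
  proof -
    have W: "2 * B + \<sigma> > 0" using \<sigma> B(1) by simp
    then show "\<tau>' > 0" using \<sigma> by (simp add: \<tau>'_def)
    have "W * (\<sigma> / (2 * W)) = \<sigma> / 2" if "W > 0" for W :: real using that by simp
    from this[OF W] show "(2 * B + \<sigma>) * \<tau>' < \<sigma>" unfolding \<tau>'_def using \<sigma> by linarith
  qed
  have large: "\<exists>N. \<forall>n\<ge>N. \<forall>V\<in>sets borel. G n \<subseteq> V \<longrightarrow> measure \<kappa> V \<ge> 1 - t"
    if \<kappa>: "\<kappa> \<in> invariant_measures T" "emeasure \<kappa> K = 1" "t > 0" for \<kappa> t
  proof -
    obtain N where N: "\<forall>V\<in>sets \<kappa>. G N \<subseteq> V \<longrightarrow> measure \<kappa> V \<ge> 1 - t"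
      using exhaustion_outer_measure[OF invariant_measures_D(1)[OF \<kappa>(1)] G_inc G_K \<kappa>(2,3)] by blast
    have "measure \<kappa> V \<ge> 1 - t" if "n \<ge> N" "V \<in> sets borel" "G n \<subseteq> V" for n V
      using N that incseqD[OF G_inc \<open>n \<ge> N\<close>] invariant_measures_D(2)[OF \<kappa>(1)] by blast
    then show ?thesis by blast
  qed
  obtain N1 where N1: "\<And>n V. n \<ge> N1 \<Longrightarrow> V \<in> sets borel \<Longrightarrow> G n \<subseteq> V \<Longrightarrow> measure \<mu> V \<ge> 1 - \<tau>"
    using large[OF inv(1) K1(1) \<tau>] by blast
  obtain N2 where N2: "\<And>n V. n \<ge> N2 \<Longrightarrow> V \<in> sets borel \<Longrightarrow> G n \<subseteq> V \<Longrightarrow> measure \<nu>1 V \<ge> 1 - \<tau>'"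
    using large[OF inv(2) K1(2) \<tau>'(1)] by blast
  obtain N3 where N3: "\<And>n V. n \<ge> N3 \<Longrightarrow> V \<in> sets borel \<Longrightarrow> G n \<subseteq> V \<Longrightarrow> measure \<nu>2 V \<ge> 1 - \<tau>'"
    using large[OF inv(3) K1(3) \<tau>'(1)] by blast
  define n where "n = N0 + N1 + N2 + N3 + 1"
  have n: "n \<ge> 1" "n \<ge> N0" "n \<ge> N1" "n \<ge> N2" "n \<ge> N3" by (auto simp: n_def)
  have "\<forall>V\<in>sets borel. G n \<subseteq> V \<longrightarrow> measure \<mu> V \<ge> 1 - \<tau>" using N1[OF n(3)] by blast
  from blocks[THEN spec, THEN mp, OF n(2), THEN spec, THEN mp, OF this]
  obtain E a s where E0: "finite E \<and> E \<subseteq> G n \<and>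
      (\<forall>x\<in>E. \<bar>birkhoff_sum T \<phi> n x - real n * a\<bar> \<le> real n * g \<and>
             \<bar>birkhoff_sum T \<psi> n x - real n * s\<bar> \<le> real n * g) \<and>
      (\<forall>E'\<subseteq>E. (\<forall>x\<in>E'. \<forall>y\<in>E'. \<forall>i<n. dist ((T ^^ i) x) ((T ^^ i) y) < d)
          \<longrightarrow> real (card E') \<le> exp (real n * g)) \<and>
      real (card E) \<ge> exp (real n * (ks_entropy_partition T \<mu> P + integral\<^sup>L \<mu> \<psi> - s - 5 * g))"
    by (elim exE)
  then have E: "finite E" "E \<subseteq> G n" by blast+
  have E\<phi>: "\<bar>birkhoff_sum T \<phi> n x - real n * a\<bar> \<le> real n * g" if "x \<in> E" for x using E0 that by blast
  have E\<psi>: "\<bar>birkhoff_sum T \<psi> n x - real n * s\<bar> \<le> real n * g" if "x \<in> E" for x using E0 that by blast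
  have Emult: "real (card E') \<le> exp (real n * g)"
    if "E' \<subseteq> E" "\<forall>x\<in>E'. \<forall>y\<in>E'. \<forall>i<n. dist ((T ^^ i) x) ((T ^^ i) y) < d" for E'
    using E0 that by blast
  define c where "c = c0 - 5 * g"
  have Ecard: "real (card E) \<ge> exp (real n * (c - s))"
    using E0 by (simp add: c_def c0_def algebra_simps)
  (* The common average a of E is far from the integral over at least one of the two measures. *)
  obtain y where y: "y \<in> G n" "\<bar>birkhoff_sum T \<phi> n y / real n - a\<bar> > \<rho> / 8"
  proof (cases "a \<le> (integral\<^sup>L \<nu>1 \<phi> + integral\<^sup>L \<nu>2 \<phi>) / 2")
    case True
    obtain y where y: "y \<in> G n" "birkhoff_sum T \<phi> n y \<ge> real n * (integral\<^sup>L \<nu>2 \<phi> - \<sigma>)"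
      using point_with_large_sum[OF inv(3) Tm \<phi>m B(2) N3[OF n(5)] \<sigma> \<tau>'(2) n(1)] by blast
    define Y where "Y = birkhoff_sum T \<phi> n y / real n"
    have "Y \<ge> integral\<^sup>L \<nu>2 \<phi> - \<sigma>"
      unfolding Y_def using y(2) n(1) by (simp add: pos_le_divide_eq mult.commute)
    then have "\<rho> / 8 < Y - a"
      using True \<rho> unfolding \<sigma>_def \<rho>_def by (simp add: field_simps)
    then have "\<bar>Y - a\<bar> > \<rho> / 8" using abs_ge_self[of "Y - a"] by (rule order_less_le_trans)
    then show ?thesis unfolding Y_def by (rule that[OF y(1)])
  next
    case False
    have "(\<lambda>x. - \<phi> x) \<in> borel_measurable borel" "\<And>x. \<bar>- \<phi> x\<bar> \<le> B" using \<phi>m B(2) by auto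
    from point_with_large_sum[OF inv(2) Tm this N2[OF n(4)] \<sigma> \<tau>'(2) n(1)]
    obtain y where y: "y \<in> G n" "birkhoff_sum T \<phi> n y \<le> real n * (integral\<^sup>L \<nu>1 \<phi> + \<sigma>)"
      by (auto simp: birkhoff_sum_def sum_negf algebra_simps)
    define Y where "Y = birkhoff_sum T \<phi> n y / real n"
    have "Y \<le> integral\<^sup>L \<nu>1 \<phi> + \<sigma>"
      unfolding Y_def using y(2) n(1) by (simp add: pos_divide_le_eq mult.commute)
    then have "\<rho> / 8 < - (Y - a)"
      using False \<rho> unfolding \<sigma>_def \<rho>_def by (simp add: field_simps)
    then have "\<bar>Y - a\<bar> > \<rho> / 8" using abs_ge_minus_self[of "Y - a"] by (rule order_less_le_trans)
    then show ?thesis unfolding Y_def by (rule that[OF y(1)])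
  qed
  define b where "b = birkhoff_sum T \<phi> n y / real n"
  have by_eq: "birkhoff_sum T \<phi> n y = real n * b" using n(1) by (simp add: b_def)
  have gap: "8 * real D * (g * (2 + B)) < \<bar>b - a\<bar>" using y(2) g\<rho> by (simp add: b_def)
  define q where "q = nat \<lfloor>g * real n\<rfloor>"
  have q: "real q \<le> g * real n" using g by (simp add: q_def)
  have pq: "p x n \<epsilon> \<le> q" if "x \<in> G n" for x
  proof -
    have "real (p x n \<epsilon>) \<le> g * real n" using that by (simp add: G_def)
    then show ?thesis by (simp add: q_def le_nat_floor)
  qed
  obtain F where F: "\<And>N. D * card (F \<inter> {..<N}) \<le> N + D"
    "\<And>M. \<exists>N\<ge>M. N \<ge> 1 \<and> 8 * D * card (F \<inter> {..<N}) \<le> N"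
    "\<And>M. \<exists>N\<ge>M. N \<ge> 1 \<and> N \<le> 2 * D * card (F \<inter> {..<N})"
    using oscillating_sparse_set[OF D] by blast
  have shadow: "\<exists>z\<in>irregular_set \<phi> T. \<forall>j. \<forall>i<n. dist ((T ^^ (j * (n + q) + i)) z) ((T ^^ i) (\<omega> j)) \<le> \<epsilon>"
    if \<omega>: "\<And>j. \<omega> j \<in> (if j \<in> F then {y} else E)" for \<omega>
  proof -
    have \<omega>G: "\<omega> j \<in> G n" for j using \<omega>[of j] y(1) E(2) by (auto split: if_splits)
    have \<omega>K: "\<omega> j \<in> K" for j using \<omega>G[of j] by (simp add: G_def)
    have "\<exists>z. \<forall>i\<in>{1..k}. (T ^^ (\<Sum>j\<in>{1..<i}. n + q)) z \<in> bowen_ball T n (\<omega> (i - 1)) \<epsilon>" if k: "k \<ge> 1" for k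
    proof -
      have "\<forall>i\<in>{1..k}. \<omega> (i - 1) \<in> K \<and> n \<ge> 1 \<and> q \<ge> p (\<omega> (i - 1)) n \<epsilon>"
        using \<omega>K pq[OF \<omega>G] n(1) by blast
      then show ?thesis
        using pspec[rule_format, OF conjI[OF \<epsilon> \<epsilon>d(3)] k, of "\<lambda>i. \<omega> (i - 1)" "\<lambda>_. n" "\<lambda>_. q"] by blast
    qed
    from shadow_sequence[OF comp T n(1) this]
    obtain z where z: "\<forall>j. \<forall>i<n. dist ((T ^^ (j * (n + q) + i)) z) ((T ^^ i) (\<omega> j)) \<le> \<epsilon>" by blast
    have "z \<in> irregular_set \<phi> T"
    proof (rule irregular_if_shadowing[OF n(1) B(2) mod\<phi> _ _ _ q D F(2,3) gap])
      show "dist ((T ^^ (j * (n + q) + i)) z) ((T ^^ i) (\<omega> j)) \<le> \<epsilon>" if "i < n" for i j using z that by blast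
      show "\<bar>birkhoff_sum T \<phi> n (\<omega> j) - real n * b\<bar> \<le> real n * g" if "j \<in> F" for j
      proof -
        have "\<omega> j = y" using \<omega>[of j] that by simp
        then show ?thesis using g by (simp add: by_eq)
      qed
      show "\<bar>birkhoff_sum T \<phi> n (\<omega> j) - real n * a\<bar> \<le> real n * g" if "j \<notin> F" for j
        using \<omega>[of j] that by (intro E\<phi>) simp
    qed
    then show ?thesis using z by blast
  qed
  have t0: "c0 - e \<le> c - 3 * g - (g + 1 / real D) * (\<bar>c\<bar> + 3 * g + B)"
  proof -
    have "\<bar>c\<bar> + 3 * g + B \<le> C" using g g1 by (simp add: c_def C_def)
    then have "(g + 1 / real D) * (\<bar>c\<bar> + 3 * g + B) \<le> (g + 1 / real D) * C"
      using g Dpos by (intro mult_left_mono) auto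
    also have "\<dots> = g * C + C / real D" by (simp add: algebra_simps)
    finally have "(g + 1 / real D) * (\<bar>c\<bar> + 3 * g + B) \<le> g * C + C / real D" .
    moreover have "8 * g + g * C \<le> e / 2" using gC by (simp add: distrib_left mult.commute)
    moreover have "c = c0 - 5 * g" by (fact c_def)
    ultimately show ?thesis using CD by linarith
  qed
  have "ereal (c0 - e) \<le> pressure T (irregular_set \<phi> T) \<psi>"
  proof (rule pressure_ge[OF comp \<psi> \<epsilon>])
    fix \<epsilon>' assume "0 < \<epsilon>'" "\<epsilon>' < \<epsilon>"
    then show "ereal (c0 - e) \<le> pressure_at T (irregular_set \<phi> T) \<psi> \<epsilon>'"
      using pressure_at_ge_shadowing[OF n(1) q g _ _ \<epsilon>d(4) B(3) mod\<psi> E(1) E\<psi> Emult Ecard shadow D F(1) t0, of \<epsilon>' y] by simp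
  qed
  then have "ereal (c0 - e) + ereal e \<le> pressure T (irregular_set \<phi> T) \<psi> + ereal e"
    by (rule add_right_mono)
  then show "ereal (ks_entropy_partition T \<mu> P + integral\<^sup>L \<mu> \<psi>) \<le> pressure T (irregular_set \<phi> T) \<psi> + ereal e"
    by (simp add: c0_def)
qed

theorem theorem1p1:
  fixes T :: "'a::metric_space \<Rightarrow> 'a" and m :: "'a measure" and K :: "'a set"
    and \<phi> :: "'a \<Rightarrow> real"
  assumes "compact (UNIV :: 'a set)"
    and "continuous_on UNIV T"
    and "prob_space m" and "sets m = sets borel"
    and "nonuniform_specification m T K"
    and "continuous_on UNIV \<phi>"
    and "(INF \<mu> \<in> invariant_measures_on K T. ereal (integral\<^sup>L \<mu> \<phi>))
         < (SUP \<mu> \<in> invariant_measures_on K T. ereal (integral\<^sup>L \<mu> \<phi>))"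
  shows "irregular_set \<phi> T \<noteq> {} \<and>
    (\<forall>\<psi> :: 'a \<Rightarrow> real. continuous_on UNIV \<psi> \<longrightarrow>
       pressure T (irregular_set \<phi> T) \<psi>
         \<ge> (SUP \<mu> \<in> invariant_measures_on K T. ks_entropy T \<mu> + ereal (integral\<^sup>L \<mu> \<psi>)) \<and>
       ((\<exists>\<mu> \<in> invariant_measures_on K T. equilibrium_state T \<psi> \<mu>) \<longrightarrow>
          pressure T (irregular_set \<phi> T) \<psi> = pressure T UNIV \<psi>))"
proof -
  obtain \<nu>1 \<nu>2 where \<nu>: "\<nu>1 \<in> invariant_measures_on K T" "\<nu>2 \<in> invariant_measures_on K T"
    "integral\<^sup>L \<nu>1 \<phi> < integral\<^sup>L \<nu>2 \<phi>"
    using assms(7) by (auto simp: INF_less_iff less_SUP_iff)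
  note main = pressure_irregular_ge[OF assms(1,2,5,6) _ \<nu>]
  (* The empty set has pressure - \<infinity>, so any finite lower bound excludes it; the zero potential and the
     trivial partition provide one. *)
  have nonempty: "irregular_set \<phi> T \<noteq> {}"
  proof
    assume empty: "irregular_set \<phi> T = {}"
    have "partition_on UNIV {UNIV :: 'a set}" by (rule partition_onI) auto
    then have "ereal (ks_entropy_partition T \<nu>1 {UNIV} + integral\<^sup>L \<nu>1 (\<lambda>_. 0)) \<le> pressure T {} (\<lambda>_. 0)"
      unfolding empty[symmetric] by (intro main \<nu>(1)) auto
    then show False by (simp add: pressure_empty[OF assms(1)])
  qed
  have lower: "ks_entropy T \<mu> + ereal (integral\<^sup>L \<mu> \<psi>) \<le> pressure T (irregular_set \<phi> T) \<psi>"
    if \<psi>: "continuous_on UNIV \<psi>" and \<mu>: "\<mu> \<in> invariant_measures_on K T" for \<psi> \<mu>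
  proof -
    have inv: "\<mu> \<in> invariant_measures T" using \<mu> by (simp add: invariant_measures_on_def)
    have "ks_entropy T \<mu> \<le> pressure T (irregular_set \<phi> T) \<psi> - ereal (integral\<^sup>L \<mu> \<psi>)"
      unfolding ks_entropy_def
    proof (rule SUP_least)
      fix P assume "P \<in> {P. finite P \<and> partition_on (space \<mu>) P \<and> P \<subseteq> sets \<mu>}"
      then have P: "finite P" "partition_on UNIV P" "P \<subseteq> sets borel"
        using invariant_measures_D[OF inv] by auto
      show "ereal (ks_entropy_partition T \<mu> P) \<le> pressure T (irregular_set \<phi> T) \<psi> - ereal (integral\<^sup>L \<mu> \<psi>)"
        using main[OF \<psi> \<mu> P] by (simp add: ereal_le_minus)
    qed
    then show ?thesis by (simp add: ereal_le_minus)
  qed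
  have "pressure T (irregular_set \<phi> T) \<psi> = pressure T UNIV \<psi>"
    if \<psi>: "continuous_on UNIV \<psi>" and \<mu>: "\<mu> \<in> invariant_measures_on K T" "equilibrium_state T \<psi> \<mu>" for \<psi> \<mu>
  proof (rule antisym)
    show "pressure T (irregular_set \<phi> T) \<psi> \<le> pressure T UNIV \<psi>"
      by (rule pressure_mono_set[OF assms(1) \<psi>]) simp
    show "pressure T UNIV \<psi> \<le> pressure T (irregular_set \<phi> T) \<psi>"
      using lower[OF \<psi> \<mu>(1)] \<mu>(2) by (simp add: equilibrium_state_def)
  qed
  then show ?thesis using nonempty lower by (blast intro: SUP_least)
qed

end
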